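(* Consider the Markovian proximal Bellman-ADMM iteration described in the context, under the coverage/observation assumption and the algorithmic-margin assumption stated there. For $k\ge0$ define the companion iterate $\widetilde\lambda^{k+1}=\lambda^k+\beta\widehat R_k(\pi^{k+1},V^k)$, $\widetilde z^{k+1}=(\pi^{k+1},V^k,\widetilde\lambda^{k+1})$ and $\widetilde G_{k+1}=G(\widetilde z^{k+1})$. Let $K$ be uniform on $\{0,\dots,T-1\}$ and independent of the algorithmic randomness. Then there are constants $A,B>0$ that do not depend on $T$ or the batch schedule such that $$\mathbb E[\widetilde G_{K+1}]\le\frac AT+\frac BT\sum_{k=0}^{T-1}\frac1{m_k}.$$ If $N=\sum_{k=0}^{T-1}m_k$ and $m_k=N/T$ for all $k$, then $\mathbb E[\widetilde G_{K+1}]\le\frac AT+\frac{BT}{N}$. Consequently $T(\epsilon)=O(\epsilon^{-1})$ and $N(\epsilon)=O(\epsilon^{-2})$ are sufficient for $\mathbb E[\widetilde G_{K+1}]\le\epsilon$.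
   Context: Norms are Euclidean for vectors and spectral for matrices. MDP: $(\mathcal S,\mathcal A,P,r,\rho,\gamma)$ is a finite discounted MDP with $0<\gamma<1$. Policies are $\pi\in\Pi=\prod_{s\in\mathcal S}\Delta(\mathcal A)\subset\mathbb R^{|\mathcal S||\mathcal A|}$. Set $P_\pi(s,s')=\sum_a\pi(a|s)P(s'|s,a)$, $r_\pi(s)=\sum_a\pi(a|s)r(s,a)$, $M_\pi=I-\gamma P_\pi$, $R(\pi,V)=M_\pi V-r_\pi$ for $V\in\mathbb R^{|\mathcal S|}$, $J_\pi(\pi,V)=D_\pi R(\pi,V)$. The problem is $\min_{\pi\in\Pi,V}\phi(\pi)+c^{\mathsf T}V$ subject to $R(\pi,V)=0$, where $c\in\mathbb R^{|\mathcal S|}$ and $\phi$ (possibly nonsmooth, nonconvex) is proper, lower semicontinuous and bounded below on $\Pi$ with $\operatorname{dom}\phi\cap\Pi\neq\varnothing$; $\psi=\phi+\delta_\Pi$ with $\delta_\Pi$ the indicator of $\Pi$, and $\partial\psi$ is the limiting subdifferential. Squared KKT residual: $G(\pi,V,\lambda)=\operatorname{dist}^2(0,\partial\psi(\pi)+J_\pi(\pi,V)^{\mathsf T}\lambda)+\|c+M_\pi^{\mathsf T}\lambda\|^2+\|R(\pi,V)\|^2$. The augmented Lagrangian is $\mathcal L_\beta(\pi,V,\lambda)=\phi(\pi)+c^{\mathsf T}V+\langle\lambda,R(\pi,V)\rangle+\frac\beta2\|R(\pi,V)\|^2$. Sampling: at outer iteration $k$ an exploratory behavior policy $\bar\pi^k$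 is frozen and a batch of $m_k\geq 1$ steps of the reset chain with kernel $K_k(s,s')=(1-\gamma)\rho(s')+\gamma P_{\bar\pi^k}(s,s')$ is simulated: at step $t$, in state $S_{k,t}$, an action $A_{k,t}\sim\bar\pi^k(\cdot|S_{k,t})$ and a reset indicator (reset with probability $1-\gamma$) are drawn; on a reset the next state is drawn from $\rho$, otherwise an environment transition from $P(\cdot|S_{k,t},A_{k,t})$ is observed with reward observation $Y_{k,t}$. From the non-reset transitions of batch $k$ only, form the empirical conditional transition rows $\widehat P_k(\cdot|s,a)$ and average observed rewards $\widehat r_k(s,a)$ for each $(s,a)$; an unvisited transition row is replaced by a fixed probability vector and an unvisited reward entry by a fixed bounded value. Set $\widehat P_{\pi,k}(s,\cdot)=\sum_a\pi(a|s)\widehat P_k(\cdot|s,a)$, $\widehat r_{\pi,k}(s)=\sum_a\pi(a|s)\widehat r_k(s,a)$, $\widehat M_{\pi,k}=I-\gamma\widehat P_{\pi,k}$, $\widehat R_k(\pi,V)=\widehat M_{\pi,k}V-\widehat r_{\pi,k}$, and let $\widehat{\mathcal L}_{\beta,k}$ be $\mathcal L_\beta$ with $R$ replaced by $\widehat R_k$. The constant $\bar\kappa<\infty$ satisfies $\|M_\pi^{-1}\|\le\bar\kappa$ and $\|\widehat M_{\pi,k}^{-1}\|\le\bar\kappa$ for all $\pi,k$ and all realizations (it exists since all rows are stochastic). Algorithm: from $(\pi^0,V^0,\lambda^0)$, with $\beta,\eta_\pi,\eta_V>0$, for $k=0,1,\dots$: $\pi^{k+1}\in\arg\min_{\pi\in\Pi}\{\widehat{\mathcal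 L}_{\beta,k}(\pi,V^k,\lambda^k)+\frac1{2\eta_\pi}\|\pi-\pi^k\|^2\}$; $V^{k+1}=\arg\min_V\{\widehat{\mathcal L}_{\beta,k}(\pi^{k+1},V,\lambda^k)+\frac1{2\eta_V}\|V-V^k\|^2\}$; $\lambda^{k+1}=\lambda^k+\beta\widehat R_k(\pi^{k+1},V^{k+1})$. All of $(\pi^k,V^k,\lambda^k,\bar\pi^k)$ is determined before batch $k$ is drawn. Coverage/observation assumption: there are $\rho_{\min},\alpha>0$, $R_{\max}<\infty$ with $\rho(s)\ge\rho_{\min}$, $\bar\pi^k(a|s)\ge\alpha$, $|r(s,a)|\le R_{\max}$ for all $k,s,a$. Moreover $Y_{k,t}=r(S_{k,t},A_{k,t})+\zeta_{k,t}$ with $\mathbb E[\zeta_{k,t}|\mathcal G_{k,t}]=0$ and $\mathbb E[|\zeta_{k,t}|^4|\mathcal G_{k,t}]\le M_4<\infty$, where $\mathcal G_{k,t}$ contains all past observations and the current state, action and reset indicator, before the current reward and next state are drawn. Fresh reset coins, reset states and action randomization are independent of the preceding history; on non-reset steps the conditional next-state law is $P(\cdot|S_{k,t},A_{k,t})$; the current reward and next state may be dependent. Algorithmic-margin assumption: the policy subproblem admits a global minimizer and is solved exactly; the value subproblem is solved exactly; $\pi^0$ is deterministic and lies in $\operatorname{dom}\psi$; $\|M_{\pi'}-M_\pi\|\le L_M\|\pi'-\pi\|$ for some $L_M<\infty$; $b(\pi)=\phi(\pi)+c^{\mathsf T}M_\pi^{-1}r_\pi$ is bounded below on $\Pi$;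 $\beta>\max\{60\bar\kappa^2/\eta_V,\;30\eta_\pi\bar\kappa^4L_M^2\|c\|^2\}$; $\mathbb E\|V^0\|^4+\mathbb E\|\lambda^0\|^4<\infty$. *)

theory Defs
  imports "HOL-Probability.Probability" "HOL-Library.Landau_Symbols"
begin

section \<open>Variational analysis\<close>

definition lsc_on :: "'x::topological_space set \<Rightarrow> ('x \<Rightarrow> ereal) \<Rightarrow> bool" where
  "lsc_on S f \<longleftrightarrow> (\<forall>x\<in>S. f x \<le> Liminf (at x within S) f)"

definition edom :: "('x \<Rightarrow> ereal) \<Rightarrow> 'x set" where
  "edom f = {x. f x < \<infinity>}"

definition frechet_subdiff :: "('x::euclidean_space \<Rightarrow> ereal) \<Rightarrow> 'x \<Rightarrow> 'x set" where
  "frechet_subdiff f x =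
     {v. \<bar>f x\<bar> \<noteq> \<infinity> \<and>
         0 \<le> Liminf (at x) (\<lambda>y. (f y - f x - ereal (v \<bullet> (y - x))) / ereal (norm (y - x)))}"

definition limiting_subdiff :: "('x::euclidean_space \<Rightarrow> ereal) \<Rightarrow> 'x \<Rightarrow> 'x set" where
  "limiting_subdiff f x =
     {v. \<bar>f x\<bar> \<noteq> \<infinity> \<and>
         (\<exists>xs vs. (\<forall>n. vs n \<in> frechet_subdiff f (xs n)) \<and>
            xs \<longlonglongrightarrow> x \<and> (\<lambda>n. f (xs n)) \<longlonglongrightarrow> f x \<and> vs \<longlonglongrightarrow> v)}"

text \<open>Unlike \<open>infdist\<close>, the distance of the origin to the empty set is infinite.\<close>

definition edist0 :: "'x::real_normed_vector set \<Rightarrow> ennreal" where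
  "edist0 S = (INF v\<in>S. ennreal (norm v))"


section \<open>The Markov decision process and the KKT residual\<close>

text \<open>
  A policy is an element of \<open>real^'a^'s\<close>, with \<open>\<pi> $ s $ a\<close> the probability of
  action \<open>a\<close> in state \<open>s\<close>; the norm of this type is the Euclidean norm of the
  flattened vector.  A transition model is a function \<open>P s a s'\<close> and a reward model a
  function \<open>r s a\<close>, so that the same definitions serve the true model and the
  empirical one.
\<close>

definition prob_vec :: "('x::finite \<Rightarrow> real) \<Rightarrow> bool" where
  "prob_vec p \<longleftrightarrow> (\<forall>x. 0 \<le> p x) \<and> (\<Sum>x\<in>UNIV. p x) = 1"

definition policies :: "(real^'a::finite^'s::finite) set" where
  "policies = {\<pi>. \<forall>s. prob_vec (\<lambda>a. \<pi> $ s $ a)}"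

definition P_pol :: "('s::finite \<Rightarrow> 'a::finite \<Rightarrow> 's \<Rightarrow> real) \<Rightarrow> real^'a^'s \<Rightarrow> real^'s^'s" where
  "P_pol P \<pi> = (\<chi> s s'. \<Sum>a\<in>UNIV. \<pi> $ s $ a * P s a s')"

definition r_pol :: "('s::finite \<Rightarrow> 'a::finite \<Rightarrow> real) \<Rightarrow> real^'a^'s \<Rightarrow> real^'s" where
  "r_pol r \<pi> = (\<chi> s. \<Sum>a\<in>UNIV. \<pi> $ s $ a * r s a)"

definition M_pol ::
    "real \<Rightarrow> ('s::finite \<Rightarrow> 'a::finite \<Rightarrow> 's \<Rightarrow> real) \<Rightarrow> real^'a^'s \<Rightarrow> real^'s^'s" where
  "M_pol \<gamma> P \<pi> = mat 1 - \<gamma> *\<^sub>R P_pol P \<pi>"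

definition bellman_res ::
    "real \<Rightarrow> ('s::finite \<Rightarrow> 'a::finite \<Rightarrow> 's \<Rightarrow> real) \<Rightarrow> ('s \<Rightarrow> 'a \<Rightarrow> real)
      \<Rightarrow> real^'a^'s \<Rightarrow> real^'s \<Rightarrow> real^'s" where
  "bellman_res \<gamma> P r \<pi> V = M_pol \<gamma> P \<pi> *v V - r_pol r \<pi>"

definition J_pol ::
    "real \<Rightarrow> ('s::finite \<Rightarrow> 'a::finite \<Rightarrow> 's \<Rightarrow> real) \<Rightarrow> ('s \<Rightarrow> 'a \<Rightarrow> real)
      \<Rightarrow> real^'a^'s \<Rightarrow> real^'s \<Rightarrow> (real^'a^'s \<Rightarrow> real^'s)" where
  "J_pol \<gamma> P r \<pi> V = frechet_derivative (\<lambda>p. bellman_res \<gamma> P r p V) (at \<pi>)"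

definition spectral_norm :: "real^'n^'m \<Rightarrow> real" where
  "spectral_norm A = onorm (\<lambda>x. A *v x)"

definition psi :: "(real^'a::finite^'s::finite \<Rightarrow> ereal) \<Rightarrow> real^'a^'s \<Rightarrow> ereal" where
  "psi \<phi> \<pi> = \<phi> \<pi> + (if \<pi> \<in> policies then 0 else \<infinity>)"

definition kkt_residual ::
    "(real^'a::finite^'s::finite \<Rightarrow> ereal) \<Rightarrow> real^'s \<Rightarrow> real
      \<Rightarrow> ('s \<Rightarrow> 'a \<Rightarrow> 's \<Rightarrow> real) \<Rightarrow> ('s \<Rightarrow> 'a \<Rightarrow> real)
      \<Rightarrow> real^'a^'s \<Rightarrow> real^'s \<Rightarrow> real^'s \<Rightarrow> ennreal" where
  "kkt_residual \<phi> c \<gamma> P r \<pi> V \<mu> =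
     (edist0 ((\<lambda>v. v + adjoint (J_pol \<gamma> P r \<pi> V) \<mu>) ` limiting_subdiff (psi \<phi>) \<pi>))\<^sup>2
     + ennreal ((norm (c + transpose (M_pol \<gamma> P \<pi>) *v \<mu>))\<^sup>2)
     + ennreal ((norm (bellman_res \<gamma> P r \<pi> V))\<^sup>2)"

definition aug_lagrangian ::
    "(real^'a::finite^'s::finite \<Rightarrow> ereal) \<Rightarrow> real^'s \<Rightarrow> real \<Rightarrow> real
      \<Rightarrow> ('s \<Rightarrow> 'a \<Rightarrow> 's \<Rightarrow> real) \<Rightarrow> ('s \<Rightarrow> 'a \<Rightarrow> real)
      \<Rightarrow> real^'a^'s \<Rightarrow> real^'s \<Rightarrow> real^'s \<Rightarrow> ereal" where
  "aug_lagrangian \<phi> c \<gamma> \<beta> P r \<pi> V \<mu> =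
     \<phi> \<pi> + ereal (c \<bullet> V + \<mu> \<bullet> bellman_res \<gamma> P r \<pi> V
                   + \<beta> / 2 * (norm (bellman_res \<gamma> P r \<pi> V))\<^sup>2)"


section \<open>Batches and the empirical model\<close>

text \<open>
  A run of the sampled algorithm.  The first index \<open>k\<close> is the outer iteration, the second
  index \<open>t < batch X k\<close> the step inside the batch; the state also exists at
  \<open>t = batch X k\<close>, as the successor of the last step.  \<open>hist X k t\<close> is the
  information available once the state of step \<open>t\<close> is known, before the action and the
  reset coin are drawn; in particular \<open>hist X k 0\<close> is the information available before
  batch \<open>k\<close> is drawn.  \<open>pre X k t\<close> is the sigma-algebra \<open>\<G>\<^sub>k\<^sub>,\<^sub>t\<close>: it
  additionally knows the current action and reset coin, but neither the current reward nor the
  next state.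
\<close>

record ('w, 's, 'a) run =
  batch :: "nat \<Rightarrow> nat"
  hist :: "nat \<Rightarrow> nat \<Rightarrow> 'w measure"
  pre :: "nat \<Rightarrow> nat \<Rightarrow> 'w measure"
  state :: "nat \<Rightarrow> nat \<Rightarrow> 'w \<Rightarrow> 's"
  action :: "nat \<Rightarrow> nat \<Rightarrow> 'w \<Rightarrow> 'a"
  reset :: "nat \<Rightarrow> nat \<Rightarrow> 'w \<Rightarrow> bool"
  reward :: "nat \<Rightarrow> nat \<Rightarrow> 'w \<Rightarrow> real"
  behav :: "nat \<Rightarrow> 'w \<Rightarrow> real^'a^'s"
  pol :: "nat \<Rightarrow> 'w \<Rightarrow> real^'a^'s"
  val :: "nat \<Rightarrow> 'w \<Rightarrow> real^'s"
  mult :: "nat \<Rightarrow> 'w \<Rightarrow> real^'s"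

definition visits ::
    "('w, 's::finite, 'a::finite) run \<Rightarrow> nat \<Rightarrow> 'w \<Rightarrow> 's \<Rightarrow> 'a \<Rightarrow> nat set" where
  "visits X k \<omega> s a =
     {t. t < batch X k \<and> \<not> reset X k t \<omega> \<and> state X k t \<omega> = s \<and> action X k t \<omega> = a}"

definition P_hat ::
    "('s \<Rightarrow> 'a \<Rightarrow> 's \<Rightarrow> real) \<Rightarrow> ('w, 's::finite, 'a::finite) run \<Rightarrow> nat \<Rightarrow> 'w
      \<Rightarrow> 's \<Rightarrow> 'a \<Rightarrow> 's \<Rightarrow> real" where
  "P_hat P\<^sub>0 X k \<omega> s a s' =
     (if visits X k \<omega> s a = {} then P\<^sub>0 s a s'
      else real (card {t \<in> visits X k \<omega> s a. state X k (Suc t) \<omega> = s'})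
             / real (card (visits X k \<omega> s a)))"

definition r_hat ::
    "('s \<Rightarrow> 'a \<Rightarrow> real) \<Rightarrow> ('w, 's::finite, 'a::finite) run \<Rightarrow> nat \<Rightarrow> 'w
      \<Rightarrow> 's \<Rightarrow> 'a \<Rightarrow> real" where
  "r_hat r\<^sub>0 X k \<omega> s a =
     (if visits X k \<omega> s a = {} then r\<^sub>0 s a
      else (\<Sum>t\<in>visits X k \<omega> s a. reward X k t \<omega>) / real (card (visits X k \<omega> s a)))"


section \<open>The sampled Bellman-ADMM iteration\<close>

text \<open>
  The starting state of a batch is arbitrary (it may be drawn afresh or continue the previous
  batch).  The joint conditional law of action and reset coin is a product, so together with
  the next-state law the states of batch \<open>k\<close> form a chain with kernel
  \<open>(1 - \<gamma>) * \<rho> s' + \<gamma> * P_pol P \<pi> $ s $ s'\<close>, where \<open>\<pi> = behav X k \<omega>\<close>.  The fourth conditional moment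
  is taken with \<open>nn_cond_exp\<close>, since \<open>real_cond_exp\<close> of a non-integrable function is a
  junk value; its bound makes the noise integrable.  The minimization over
  policies uses \<open>\<phi>\<close>, whose values on \<open>policies\<close> are all that matters.
\<close>

locale admm_run = prob_space M
  for M :: "'w measure" +
  fixes \<phi> :: "real^'a::finite^'s::finite \<Rightarrow> ereal" and c :: "real^'s"
    and P :: "'s \<Rightarrow> 'a \<Rightarrow> 's \<Rightarrow> real" and r :: "'s \<Rightarrow> 'a \<Rightarrow> real"
    and \<rho> :: "'s \<Rightarrow> real" and \<gamma> :: real
    and P\<^sub>0 :: "'s \<Rightarrow> 'a \<Rightarrow> 's \<Rightarrow> real" and r\<^sub>0 :: "'s \<Rightarrow> 'a \<Rightarrow> real"
    and \<pi>\<^sub>0 :: "real^'a^'s" and \<nu>\<^sub>0 :: "((real^'s) \<times> (real^'s)) measure"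
    and \<beta> \<eta>\<^sub>\<pi> \<eta>\<^sub>V \<kappa> \<alpha> M\<^sub>4 :: real
    and X :: "('w, 's, 'a) run"
  assumes batch_pos: "batch X k \<ge> 1"
    and subalg_hist: "subalgebra M (hist X k t)"
    and subalg_pre: "subalgebra M (pre X k t)"
    and hist_pre: "t < batch X k \<Longrightarrow> sets (hist X k t) \<subseteq> sets (pre X k t)"
    and pre_hist: "t < batch X k \<Longrightarrow> sets (pre X k t) \<subseteq> sets (hist X k (Suc t))"
    and hist_next: "sets (hist X k (batch X k)) \<subseteq> sets (hist X (Suc k) 0)"
    and state_meas: "t \<le> batch X k \<Longrightarrow> state X k t \<in> measurable (hist X k t) (count_space UNIV)"
    and action_meas: "t < batch X k \<Longrightarrow> action X k t \<in> measurable (pre X k t) (count_space UNIV)"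
    and reset_meas: "t < batch X k \<Longrightarrow> reset X k t \<in> measurable (pre X k t) (count_space UNIV)"
    and reward_meas: "t < batch X k \<Longrightarrow> reward X k t \<in> borel_measurable (hist X k (Suc t))"
    and behav_meas: "behav X k \<in> borel_measurable (hist X k 0)"
    and pol_meas: "pol X k \<in> borel_measurable (hist X k 0)"
    and val_meas: "val X k \<in> borel_measurable (hist X k 0)"
    and mult_meas: "mult X k \<in> borel_measurable (hist X k 0)"
    and behav_policy: "\<omega> \<in> space M \<Longrightarrow> behav X k \<omega> \<in> policies"
    and action_reset_law: "t < batch X k \<Longrightarrow>
          AE \<omega> in M. real_cond_exp M (hist X k t)
              (\<lambda>\<omega>. of_bool (action X k t \<omega> = a \<and> reset X k t \<omega> = z)) \<omega>
            = behav X k \<omega> $ state X k t \<omega> $ a * (if z then 1 - \<gamma> else \<gamma>)"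
    and next_state_law: "t < batch X k \<Longrightarrow>
          AE \<omega> in M. real_cond_exp M (pre X k t)
              (\<lambda>\<omega>. of_bool (state X k (Suc t) \<omega> = s')) \<omega>
            = (if reset X k t \<omega> then \<rho> s' else P (state X k t \<omega>) (action X k t \<omega>) s')"
    and behav_cover: "\<omega> \<in> space M \<Longrightarrow> \<alpha> \<le> behav X k \<omega> $ s $ a"
    and noise_mean: "t < batch X k \<Longrightarrow>
          AE \<omega> in M. real_cond_exp M (pre X k t)
              (\<lambda>\<omega>. reward X k t \<omega> - r (state X k t \<omega>) (action X k t \<omega>)) \<omega> = 0"
    and noise_moment: "t < batch X k \<Longrightarrow>
          AE \<omega> in M. nn_cond_exp M (pre X k t)
              (\<lambda>\<omega>. ennreal (\<bar>reward X k t \<omega> - r (state X k t \<omega>) (action X k t \<omega>)\<bar> ^ 4)) \<omega>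
            \<le> ennreal M\<^sub>4"
    and kappa_hat: "\<omega> \<in> space M \<Longrightarrow> \<pi> \<in> policies \<Longrightarrow>
          spectral_norm (matrix_inv (M_pol \<gamma> (P_hat P\<^sub>0 X k \<omega>) \<pi>)) \<le> \<kappa>"
    and pol_0: "\<omega> \<in> space M \<Longrightarrow> pol X 0 \<omega> = \<pi>\<^sub>0"
    and val_mult_0: "distr M borel (\<lambda>\<omega>. (val X 0 \<omega>, mult X 0 \<omega>)) = \<nu>\<^sub>0"
    and pol_step: "\<omega> \<in> space M \<Longrightarrow>
          is_arg_min
            (\<lambda>\<pi>. aug_lagrangian \<phi> c \<gamma> \<beta> (P_hat P\<^sub>0 X k \<omega>) (r_hat r\<^sub>0 X k \<omega>)
                   \<pi> (val X k \<omega>) (mult X k \<omega>)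
                 + ereal (1 / (2 * \<eta>\<^sub>\<pi>) * (norm (\<pi> - pol X k \<omega>))\<^sup>2))
            (\<lambda>\<pi>. \<pi> \<in> policies) (pol X (Suc k) \<omega>)"
    and val_step: "\<omega> \<in> space M \<Longrightarrow>
          is_arg_min
            (\<lambda>V. aug_lagrangian \<phi> c \<gamma> \<beta> (P_hat P\<^sub>0 X k \<omega>) (r_hat r\<^sub>0 X k \<omega>)
                   (pol X (Suc k) \<omega>) V (mult X k \<omega>)
                 + ereal (1 / (2 * \<eta>\<^sub>V) * (norm (V - val X k \<omega>))\<^sup>2))
            (\<lambda>_. True) (val X (Suc k) \<omega>)"
    and mult_step: "\<omega> \<in> space M \<Longrightarrow>
          mult X (Suc k) \<omega> = mult X k \<omega>
            + \<beta> *\<^sub>R bellman_res \<gamma> (P_hat P\<^sub>0 X k \<omega>) (r_hat r\<^sub>0 X k \<omega>)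
                      (pol X (Suc k) \<omega>) (val X (Suc k) \<omega>)"

text \<open>At argument \<open>k\<close> these are the companion quantities with index \<open>k + 1\<close>.  The
  multiplier is updated with the empirical model, the residual is that of the true model.\<close>

definition companion_mult ::
    "real \<Rightarrow> real \<Rightarrow> ('s \<Rightarrow> 'a \<Rightarrow> 's \<Rightarrow> real) \<Rightarrow> ('s \<Rightarrow> 'a \<Rightarrow> real)
      \<Rightarrow> ('w, 's::finite, 'a::finite) run \<Rightarrow> nat \<Rightarrow> 'w \<Rightarrow> real^'s" where
  "companion_mult \<gamma> \<beta> P\<^sub>0 r\<^sub>0 X k \<omega> = mult X k \<omega>
     + \<beta> *\<^sub>R bellman_res \<gamma> (P_hat P\<^sub>0 X k \<omega>) (r_hat r\<^sub>0 X k \<omega>) (pol X (Suc k) \<omega>) (val X k \<omega>)"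

definition companion_residual ::
    "(real^'a::finite^'s::finite \<Rightarrow> ereal) \<Rightarrow> real^'s
      \<Rightarrow> ('s \<Rightarrow> 'a \<Rightarrow> 's \<Rightarrow> real) \<Rightarrow> ('s \<Rightarrow> 'a \<Rightarrow> real) \<Rightarrow> real \<Rightarrow> real
      \<Rightarrow> ('s \<Rightarrow> 'a \<Rightarrow> 's \<Rightarrow> real) \<Rightarrow> ('s \<Rightarrow> 'a \<Rightarrow> real)
      \<Rightarrow> ('w, 's, 'a) run \<Rightarrow> nat \<Rightarrow> 'w \<Rightarrow> ennreal" where
  "companion_residual \<phi> c P r \<gamma> \<beta> P\<^sub>0 r\<^sub>0 X k \<omega> =
     kkt_residual \<phi> c \<gamma> P r (pol X (Suc k) \<omega>) (val X k \<omega>) (companion_mult \<gamma> \<beta> P\<^sub>0 r\<^sub>0 X k \<omega>)"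

definition run_sigma :: "'w measure \<Rightarrow> ('w, 's::finite, 'a::finite) run \<Rightarrow> 'w measure" where
  "run_sigma M X = sigma (space M) (\<Union>k. sets (hist X k 0))"

definition uniform_index ::
    "'w measure \<Rightarrow> ('w, 's::finite, 'a::finite) run \<Rightarrow> nat \<Rightarrow> ('w \<Rightarrow> nat) \<Rightarrow> bool" where
  "uniform_index M X T K \<longleftrightarrow>
     K \<in> measurable M (count_space UNIV) \<and>
     distr M (count_space UNIV) K = measure_pmf (pmf_of_set {..<T}) \<and>
     prob_space.indep_set M {K -` B \<inter> space M | B. True} (sets (run_sigma M X))"

end

theory Submission
  imports Defs
begin

text \<open>
  Write \<open>\<xi>\<^sub>k\<close> for the model error of batch \<open>k\<close>, weighted by the size of the iterates.
  The optimality condition of the value step expresses the multiplier through the last value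
  increment, so that multiplier increments are dominated by the primal increments; the margin on
  \<open>\<beta>\<close> then makes the true augmented Lagrangian, corrected by a multiple of the last squared value
  increment, decrease up to an error of order \<open>\<xi>\<^sub>k\<^sup>2\<close>.  The error is quadratic because the
  empirical and the true Lagrangian are compared at both ends of a step, and the difference of the
  two gaps is a product of model error and increment; no bias estimate is needed.  The residual of
  the companion iterate is bounded by the squared increments plus \<open>\<xi>\<^sub>k\<^sup>2\<close>.

  The expectation of \<open>\<xi>\<^sub>k\<^sup>2\<close> is of order \<open>1 / batch k\<close>: the margin also contracts the pair of
  value and multiplier, which gives uniform fourth moments, and the fourth moment of an empirical
  mean, conditionally on the past, is of order \<open>1 / (batch k)\<^sup>2\<close>.  The latter combines the fourth
  moment of a martingale with an exponentially small probability of few visits, which follows from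
  resets.
\<close>

section \<open>Policies and Bellman residuals\<close>

text \<open>The companion iterate is the point at which the policy subproblem is exactly stationary:
  its multiplier is the one that occurs in the gradient of that subproblem at the new policy and the
  old value. Its policy residual therefore contains only the proximal increment and model error. The
  Lagrangian has no constant lower bound along a run. At the final time it is bounded below only by
  a multiple of the squared size of the iterates, so moments that are uniform in time take the place
  of a deterministic bound. Fourth moments appear because the model error is weighted by the squared
  size, which \<open>\<xi>\<^sub>k\<^sup>2\<close> squares again. The iterates are known before the
  batch is drawn and act as weights; conditional estimates are therefore stated as inequalities
  between weighted integrals. The first step has no preceding value step to compare with; its
  multiplier increment is kept and bounded by the sizes of the first two iterates. Since
  \<open>A\<close> and \<open>B\<close> are chosen before the run and its batch schedule, every
  constant is a function of the problem data alone.\<close>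

lemma abs_nth_nth_le_norm: "\<bar>(\<pi>::real^'a::finite^'s::finite) $ s $ a\<bar> \<le> norm \<pi>"
  by (metis Finite_Cartesian_Product.norm_nth_le order_trans real_norm_def)

lemma norm_policy_le:
  assumes "\<pi> \<in> policies"
  shows "norm (\<pi> :: real^'a::finite^'s::finite) \<le> real CARD('s)"
proof -
  have "norm (\<pi> $ s) \<le> 1" for s
  proof -
    have "norm (\<pi> $ s) \<le> (\<Sum>a\<in>UNIV. \<bar>\<pi> $ s $ a\<bar>)"
      by (rule norm_le_l1_cart)
    also have "\<dots> = (\<Sum>a\<in>UNIV. \<pi> $ s $ a)"
      using assms by (intro sum.cong) (auto simp: policies_def prob_vec_def)
    also have "\<dots> = 1"
      using assms by (auto simp: policies_def prob_vec_def)
    finally show ?thesis .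
  qed
  then have "(\<Sum>s\<in>UNIV. norm (\<pi> $ s)) \<le> (\<Sum>s\<in>(UNIV::'s set). 1)"
    by (intro sum_mono)
  moreover have "norm \<pi> \<le> (\<Sum>s\<in>UNIV. norm (\<pi> $ s))"
    unfolding norm_vec_def by (rule L2_set_le_sum) simp
  ultimately show ?thesis by simp
qed

section \<open>Size of a model error\<close>

definition kernel_l1 :: "('s::finite \<Rightarrow> 'a::finite \<Rightarrow> 's \<Rightarrow> real) \<Rightarrow> real" where
  "kernel_l1 D = (\<Sum>s\<in>UNIV. \<Sum>a\<in>UNIV. \<Sum>s'\<in>UNIV. \<bar>D s a s'\<bar>)"

definition reward_l1 :: "('s::finite \<Rightarrow> 'a::finite \<Rightarrow> real) \<Rightarrow> real" where
  "reward_l1 d = (\<Sum>s\<in>UNIV. \<Sum>a\<in>UNIV. \<bar>d s a\<bar>)"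

text \<open>The sum over entries dominates every norm of a model difference used in the one-step
  analysis, and it is a finite sum of scalars, so that its moments reduce to those of single
  empirical means.\<close>

definition model_error ::
    "('s::finite \<Rightarrow> 'a::finite \<Rightarrow> 's \<Rightarrow> real) \<Rightarrow> ('s \<Rightarrow> 'a \<Rightarrow> real)
      \<Rightarrow> ('s \<Rightarrow> 'a \<Rightarrow> 's \<Rightarrow> real) \<Rightarrow> ('s \<Rightarrow> 'a \<Rightarrow> real) \<Rightarrow> real" where
  "model_error P r P' r' = kernel_l1 (\<lambda>s a s'. P' s a s' - P s a s') + reward_l1 (\<lambda>s a. r' s a - r s a)"

lemma kernel_l1_nonneg: "0 \<le> kernel_l1 D"
  by (simp add: kernel_l1_def sum_nonneg)

lemma reward_l1_nonneg: "0 \<le> reward_l1 d"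
  by (simp add: reward_l1_def sum_nonneg)

lemma model_error_nonneg: "0 \<le> model_error P r P' r'"
  by (simp add: model_error_def kernel_l1_nonneg reward_l1_nonneg)

text \<open>All stochastic kernels have the same l1 size; this is why bounds with constants of the
  true model hold for the empirical one in every realization.\<close>

lemma kernel_l1_stochastic:
  assumes "\<And>s a. prob_vec (D s a)"
  shows "kernel_l1 (D :: 's::finite \<Rightarrow> 'a::finite \<Rightarrow> 's \<Rightarrow> real) = real CARD('s) * real CARD('a)"
proof -
  have "(\<Sum>s'\<in>UNIV. \<bar>D s a s'\<bar>) = 1" for s a
    using assms[of s a] by (simp add: prob_vec_def)
  then show ?thesis by (simp add: kernel_l1_def)
qed

lemma norm_P_pol_mult:
  "norm (P_pol D \<pi> *v x) \<le> kernel_l1 D * norm \<pi> * norm x"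
proof -
  have "norm (P_pol D \<pi> *v x) \<le> (\<Sum>s\<in>UNIV. \<bar>(P_pol D \<pi> *v x) $ s\<bar>)"
    by (rule norm_le_l1_cart)
  also have "\<dots> \<le> (\<Sum>s\<in>UNIV. \<Sum>a\<in>UNIV. \<Sum>s'\<in>UNIV. \<bar>D s a s'\<bar> * (norm \<pi> * norm x))"
  proof (rule sum_mono)
    fix s
    have "(P_pol D \<pi> *v x) $ s = (\<Sum>s'\<in>UNIV. \<Sum>a\<in>UNIV. \<pi> $ s $ a * D s a s' * x $ s')"
      by (simp add: P_pol_def matrix_vector_mult_def sum_distrib_right)
    also have "\<dots> = (\<Sum>a\<in>UNIV. \<Sum>s'\<in>UNIV. \<pi> $ s $ a * D s a s' * x $ s')"
      by (rule sum.swap)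
    also have "\<bar>\<dots>\<bar> \<le> (\<Sum>a\<in>UNIV. \<Sum>s'\<in>UNIV. \<bar>\<pi> $ s $ a * D s a s' * x $ s'\<bar>)"
      by (rule order_trans[OF sum_abs]) (intro sum_mono sum_abs)
    also have "\<dots> \<le> (\<Sum>a\<in>UNIV. \<Sum>s'\<in>UNIV. \<bar>D s a s'\<bar> * (norm \<pi> * norm x))"
    proof (intro sum_mono)
      fix a s'
      have "\<bar>\<pi> $ s $ a\<bar> * \<bar>x $ s'\<bar> \<le> norm \<pi> * norm x"
        by (intro mult_mono abs_nth_nth_le_norm component_le_norm_cart) auto
      then have "\<bar>D s a s'\<bar> * (\<bar>\<pi> $ s $ a\<bar> * \<bar>x $ s'\<bar>) \<le> \<bar>D s a s'\<bar> * (norm \<pi> * norm x)"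
        by (rule mult_left_mono) simp
      then show "\<bar>\<pi> $ s $ a * D s a s' * x $ s'\<bar> \<le> \<bar>D s a s'\<bar> * (norm \<pi> * norm x)"
        by (simp add: abs_mult mult_ac)
    qed
    finally show "\<bar>(P_pol D \<pi> *v x) $ s\<bar> \<le> (\<Sum>a\<in>UNIV. \<Sum>s'\<in>UNIV. \<bar>D s a s'\<bar> * (norm \<pi> * norm x))" .
  qed
  also have "\<dots> = kernel_l1 D * norm \<pi> * norm x"
    by (simp add: kernel_l1_def sum_distrib_right mult.assoc)
  finally show ?thesis .
qed

lemma norm_r_pol:
  "norm (r_pol d \<pi>) \<le> reward_l1 d * norm \<pi>"
proof -
  have "norm (r_pol d \<pi>) \<le> (\<Sum>s\<in>UNIV. \<bar>r_pol d \<pi> $ s\<bar>)"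
    by (rule norm_le_l1_cart)
  also have "\<dots> \<le> (\<Sum>s\<in>UNIV. \<Sum>a\<in>UNIV. \<bar>d s a\<bar> * norm \<pi>)"
  proof (rule sum_mono)
    fix s
    have "\<bar>r_pol d \<pi> $ s\<bar> \<le> (\<Sum>a\<in>UNIV. \<bar>\<pi> $ s $ a * d s a\<bar>)"
      by (simp add: r_pol_def sum_abs)
    also have "\<dots> \<le> (\<Sum>a\<in>UNIV. \<bar>d s a\<bar> * norm \<pi>)"
      by (intro sum_mono)
        (simp add: abs_mult mult.commute[of "\<bar>\<pi> $ s $ _\<bar>"] mult_left_mono abs_nth_nth_le_norm)
    finally show "\<bar>r_pol d \<pi> $ s\<bar> \<le> (\<Sum>a\<in>UNIV. \<bar>d s a\<bar> * norm \<pi>)" .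
  qed
  also have "\<dots> = reward_l1 d * norm \<pi>"
    by (simp add: reward_l1_def sum_distrib_right)
  finally show ?thesis .
qed

lemma P_pol_diff_kernel: "P_pol D \<pi> - P_pol E \<pi> = P_pol (\<lambda>s a s'. D s a s' - E s a s') \<pi>"
  by (simp add: P_pol_def vec_eq_iff sum_subtractf algebra_simps)

lemma r_pol_diff_reward: "r_pol d \<pi> - r_pol e \<pi> = r_pol (\<lambda>s a. d s a - e s a) \<pi>"
  by (simp add: r_pol_def vec_eq_iff sum_subtractf algebra_simps)

lemma P_pol_add: "P_pol D (\<pi> + \<pi>') = P_pol D \<pi> + P_pol D \<pi>'"
  by (simp add: P_pol_def vec_eq_iff sum.distrib algebra_simps)

lemma P_pol_scaleR: "P_pol D (t *\<^sub>R \<pi>) = t *\<^sub>R P_pol D \<pi>"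
  by (simp add: P_pol_def vec_eq_iff sum_distrib_left algebra_simps)

lemma r_pol_add: "r_pol d (\<pi> + \<pi>') = r_pol d \<pi> + r_pol d \<pi>'"
  by (simp add: r_pol_def vec_eq_iff sum.distrib algebra_simps)

lemma r_pol_scaleR: "r_pol d (t *\<^sub>R \<pi>) = t *\<^sub>R r_pol d \<pi>"
  by (simp add: r_pol_def vec_eq_iff sum_distrib_left algebra_simps)

section \<open>The Bellman residual as an affine map\<close>

lemma scaleR_matrix_vector: "(t *\<^sub>R (A::real^'n^'m)) *v x = t *\<^sub>R (A *v x)"
  by (simp add: matrix_vector_mult_def vec_eq_iff sum_distrib_left mult.assoc)

lemma M_pol_mult: "M_pol \<gamma> P \<pi> *v V = V - \<gamma> *\<^sub>R (P_pol P \<pi> *v V)"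
  by (simp add: M_pol_def matrix_vector_mult_diff_rdistrib scaleR_matrix_vector)

lemma bellman_res_eq: "bellman_res \<gamma> P r \<pi> V = V - \<gamma> *\<^sub>R (P_pol P \<pi> *v V) - r_pol r \<pi>"
  by (simp add: bellman_res_def M_pol_mult)

text \<open>The negative of the derivative of the Bellman residual in the policy.\<close>

definition bellman_lin ::
    "real \<Rightarrow> ('s::finite \<Rightarrow> 'a::finite \<Rightarrow> 's \<Rightarrow> real) \<Rightarrow> ('s \<Rightarrow> 'a \<Rightarrow> real)
      \<Rightarrow> real^'s \<Rightarrow> real^'a^'s \<Rightarrow> real^'s" where
  "bellman_lin \<gamma> D d V \<delta> = \<gamma> *\<^sub>R (P_pol D \<delta> *v V) + r_pol d \<delta>"

lemma bellman_res_lin: "bellman_res \<gamma> P r \<pi> V = V - bellman_lin \<gamma> P r V \<pi>"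
  by (simp add: bellman_res_eq bellman_lin_def)

lemma linear_bellman_lin: "linear (bellman_lin \<gamma> D d V)"
  by (rule linearI)
    (simp_all add: bellman_lin_def P_pol_add r_pol_add P_pol_scaleR r_pol_scaleR
      matrix_vector_mult_add_rdistrib scaleR_matrix_vector scaleR_add_right add_ac mult.commute)

text \<open>The map is linear in the model too, so a difference of models may be inserted as if it
  were a model. The bounds for \<open>bellman_lin\<close> accordingly ask for no
  stochasticity.\<close>

lemma bellman_lin_diff_model:
  "bellman_lin \<gamma> D d V \<delta> - bellman_lin \<gamma> E e V \<delta>
    = bellman_lin \<gamma> (\<lambda>s a s'. D s a s' - E s a s') (\<lambda>s a. d s a - e s a) V \<delta>"
  by (simp add: bellman_lin_def P_pol_diff_kernel[symmetric] r_pol_diff_reward[symmetric]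
      matrix_vector_mult_diff_rdistrib algebra_simps)

lemma norm_bellman_lin:
  assumes "0 \<le> \<gamma>" "\<gamma> \<le> 1"
  shows "norm (bellman_lin \<gamma> D d V \<delta>) \<le> (kernel_l1 D + reward_l1 d) * norm \<delta> * (1 + norm V)"
proof -
  have "norm (bellman_lin \<gamma> D d V \<delta>) \<le> \<gamma> * norm (P_pol D \<delta> *v V) + norm (r_pol d \<delta>)"
    unfolding bellman_lin_def using assms by (intro order_trans[OF norm_triangle_ineq]) simp
  also have "\<dots> \<le> 1 * (kernel_l1 D * norm \<delta> * norm V) + reward_l1 d * norm \<delta>"
    using assms by (intro add_mono mult_mono norm_P_pol_mult norm_r_pol) auto
  also have "\<dots> \<le> (kernel_l1 D + reward_l1 d) * norm \<delta> * (1 + norm V)"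
    using kernel_l1_nonneg[of D] reward_l1_nonneg[of d] by (simp add: algebra_simps)
  finally show ?thesis .
qed

text \<open>The square of the norm of \<open>transpose A *v y\<close> is the pairing of
  \<open>A *v (transpose A *v y)\<close> with \<open>y\<close>, which Cauchy-Schwarz bounds; one
  factor is then cancelled.\<close>

lemma norm_transpose_mult_le:
  fixes A :: "real^'n^'m"
  assumes "\<And>x. norm (A *v x) \<le> C * norm x"
  shows "norm (transpose A *v y) \<le> C * norm y"
proof (cases "transpose A *v y = 0")
  case True
  \<comment> \<open>In the degenerate case the sign of \<open>C\<close> is all that remains to be
    shown; it comes from testing the assumption with a unit vector.\<close>
  have "0 \<le> C * norm (axis undefined 1 :: real^'n)"
    using assms norm_ge_zero by (rule order_trans[rotated])
  then have "0 \<le> C" by (simp add: norm_axis_1)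
  with True show ?thesis by simp
next
  case False
  have "(norm (transpose A *v y))\<^sup>2 = (A *v (transpose A *v y)) \<bullet> y"
    by (simp add: power2_norm_eq_inner dot_lmul_matrix[symmetric] inner_commute)
  also have "\<dots> \<le> norm (A *v (transpose A *v y)) * norm y"
    by (rule norm_cauchy_schwarz)
  also have "\<dots> \<le> (C * norm (transpose A *v y)) * norm y"
    by (intro mult_right_mono assms) simp
  finally have "norm (transpose A *v y) * norm (transpose A *v y)
      \<le> norm (transpose A *v y) * (C * norm y)"
    by (simp add: power2_eq_square mult_ac)
  with False show ?thesis by (simp add: mult_le_cancel_left)
qed

lemma norm_le_spectral_norm: "norm (A *v x) \<le> spectral_norm (A::real^'n^'m) * norm x"
  unfolding spectral_norm_def
  by (rule onorm) (simp add: linear_linear)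

lemma policy_mult_le:
  assumes "\<pi> \<in> policies" "\<And>s a. prob_vec (P s a)" "\<And>s. \<bar>x $ s\<bar> \<le> b"
  shows "\<bar>(P_pol P \<pi> *v x) $ s\<bar> \<le> b"
proof -
  have p: "0 \<le> \<pi> $ s $ a" "(\<Sum>a\<in>UNIV. \<pi> $ s $ a) = 1" for a
    using assms(1) by (auto simp: policies_def prob_vec_def)
  have inner: "\<bar>\<Sum>s'\<in>UNIV. P s a s' * x $ s'\<bar> \<le> b" for a
  proof -
    have "\<bar>\<Sum>s'\<in>UNIV. P s a s' * x $ s'\<bar> \<le> (\<Sum>s'\<in>UNIV. \<bar>P s a s' * x $ s'\<bar>)"
      by (rule sum_abs)
    also have "\<dots> \<le> (\<Sum>s'\<in>UNIV. P s a s' * b)"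
      using assms(2)[of s a] assms(3)
      by (intro sum_mono) (auto simp: prob_vec_def abs_mult intro!: mult_left_mono)
    also have "\<dots> = b"
      using assms(2)[of s a] by (simp add: prob_vec_def flip: sum_distrib_right)
    finally show ?thesis .
  qed
  have "(P_pol P \<pi> *v x) $ s = (\<Sum>s'\<in>UNIV. \<Sum>a\<in>UNIV. \<pi> $ s $ a * P s a s' * x $ s')"
    by (simp add: P_pol_def matrix_vector_mult_def sum_distrib_right)
  also have "\<dots> = (\<Sum>a\<in>UNIV. \<pi> $ s $ a * (\<Sum>s'\<in>UNIV. P s a s' * x $ s'))"
    by (subst sum.swap) (simp add: sum_distrib_left mult.assoc)
  also have "\<bar>\<dots>\<bar> \<le> (\<Sum>a\<in>UNIV. \<pi> $ s $ a * b)"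
    by (rule order_trans[OF sum_abs])
      (auto intro!: sum_mono mult_left_mono inner p(1) simp: abs_mult p(1))
  also have "\<dots> = b"
    by (simp add: p(2) flip: sum_distrib_right)
  finally show ?thesis .
qed

text \<open>A vector in the kernel is \<gamma> times an average of itself. Averaging does not
  enlarge the largest modulus of a coordinate (\<open>policy_mult_le\<close>), and \<gamma> < 1
  shrinks it, so this modulus is zero.\<close>

lemma invertible_M_pol:
  assumes "0 \<le> \<gamma>" "\<gamma> < 1" "\<pi> \<in> policies" "\<And>s a. prob_vec (P s a)"
  shows "invertible (M_pol \<gamma> P \<pi>)"
proof -
  have "x = 0" if "M_pol \<gamma> P \<pi> *v x = 0" for x
  proof -
    define b where "b = Max (range (\<lambda>s. \<bar>x $ s\<bar>))"
    have le: "\<bar>x $ s\<bar> \<le> b" for s by (simp add: b_def)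
    have "b \<in> range (\<lambda>s. \<bar>x $ s\<bar>)"
      unfolding b_def by (rule Max_in) auto
    then obtain s where s: "b = \<bar>x $ s\<bar>" by blast
    have "x = \<gamma> *\<^sub>R (P_pol P \<pi> *v x)"
      using that by (simp add: M_pol_mult)
    then have "\<bar>x $ s\<bar> = \<gamma> * \<bar>(P_pol P \<pi> *v x) $ s\<bar>"
      using assms(1) by (metis abs_mult abs_of_nonneg real_scaleR_def vector_scaleR_component)
    also have "\<dots> \<le> \<gamma> * b"
      by (intro mult_left_mono policy_mult_le assms le)
    finally have "b \<le> \<gamma> * b" by (simp add: s)
    moreover have "0 \<le> b" using le[of s] by linarith
    ultimately have "b = 0"
      using assms(2) by (smt (verit, best) mult_less_cancel_right2)
    then show "x = 0" using le by (simp add: vec_eq_iff)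
  qed
  then have "\<exists>B. B ** M_pol \<gamma> P \<pi> = mat 1"
    by (simp add: matrix_left_invertible_ker)
  then show ?thesis by (simp add: invertible_left_inverse)
qed

lemma matrix_inv_mult:
  fixes A :: "real^'n^'n"
  assumes "invertible A"
  shows "A ** matrix_inv A = mat 1" "matrix_inv A ** A = mat 1"
  using someI_ex[OF assms[unfolded invertible_def]] by (simp_all add: matrix_inv_def)

lemma norm_le_inverse_bound:
  fixes A :: "real^'n^'n"
  assumes "invertible A" "spectral_norm (matrix_inv A) \<le> \<kappa>"
  shows "norm x \<le> \<kappa> * norm (A *v x)"
proof -
  have "x = matrix_inv A *v (A *v x)"
    using assms(1) by (simp add: matrix_vector_mul_assoc matrix_inv_mult)
  then have "norm x \<le> spectral_norm (matrix_inv A) * norm (A *v x)"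
    by (metis norm_le_spectral_norm)
  also have "\<dots> \<le> \<kappa> * norm (A *v x)"
    by (intro mult_right_mono assms) simp
  finally show ?thesis .
qed

text \<open>The form in which optimality conditions are solved for the multiplier: an inverse of the
  transpose with its norm bound, and the resulting lower bound for the transpose.\<close>

lemma transpose_inverse_bound:
  fixes A :: "real^'n^'n"
  assumes "invertible A" "spectral_norm (matrix_inv A) \<le> \<kappa>"
  obtains B where "\<And>y. transpose A *v (B *v y) = y" "\<And>y. norm (B *v y) \<le> \<kappa> * norm y"
    "\<And>x. norm x \<le> \<kappa> * norm (transpose A *v x)"
proof
  let ?B = "transpose (matrix_inv A)"
  have le: "norm (matrix_inv A *v x) \<le> \<kappa> * norm x" for x
    using norm_le_spectral_norm[of "matrix_inv A" x] assms(2)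
    by (meson mult_right_mono norm_ge_zero order_trans)
  show B: "norm (?B *v y) \<le> \<kappa> * norm y" for y
    by (rule norm_transpose_mult_le) (rule le)
  have "transpose A ** ?B = mat 1" "?B ** transpose A = mat 1"
    using assms(1) by (simp_all add: matrix_transpose_mul[symmetric] matrix_inv_mult)
  then have 1: "transpose A *v (?B *v y) = y" and 2: "?B *v (transpose A *v x) = x" for x y
    by (metis matrix_vector_mul_assoc matrix_vector_mul_lid)+
  show "transpose A *v (?B *v y) = y" for y by (rule 1)
  show "norm x \<le> \<kappa> * norm (transpose A *v x)" for x
    using B[of "transpose A *v x"] by (simp only: 2)
qed

section \<open>Quadratic expansions and subgradients\<close>

text \<open>The finite part of \<open>aug_lagrangian\<close>. Splitting off the extended-valued
  \<phi> keeps all expansions in real arithmetic, and the model stays a parameter because the true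
  and the empirical version are compared.\<close>

definition smooth_lag ::
    "real^'s \<Rightarrow> real \<Rightarrow> real \<Rightarrow> ('s::finite \<Rightarrow> 'a::finite \<Rightarrow> 's \<Rightarrow> real)
      \<Rightarrow> ('s \<Rightarrow> 'a \<Rightarrow> real) \<Rightarrow> real^'a^'s \<Rightarrow> real^'s \<Rightarrow> real^'s \<Rightarrow> real" where
  "smooth_lag c \<gamma> \<beta> P r \<pi> V \<mu> = c \<bullet> V + \<mu> \<bullet> bellman_res \<gamma> P r \<pi> V
      + \<beta> / 2 * (norm (bellman_res \<gamma> P r \<pi> V))\<^sup>2"

lemma norm_add_power2: "(norm (a + b))\<^sup>2 = (norm a)\<^sup>2 + 2 * (a \<bullet> b) + (norm (b::'a::real_inner))\<^sup>2"
  by (simp add: power2_norm_eq_inner inner_add_left inner_add_right inner_commute)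

lemma bellman_res_add_value:
  "bellman_res \<gamma> P r \<pi> (V + d) = bellman_res \<gamma> P r \<pi> V + M_pol \<gamma> P \<pi> *v d"
  by (simp add: bellman_res_def matrix_vector_right_distrib)

lemma bellman_res_add_policy:
  "bellman_res \<gamma> P r (\<pi> + \<delta>) V = bellman_res \<gamma> P r \<pi> V - bellman_lin \<gamma> P r V \<delta>"
  by (simp add: bellman_res_lin linear_add[OF linear_bellman_lin])

text \<open>The residual is affine in the value, so the second-order expansion is exact. The
  multiplier in the linear term is the one a dual step taken at \<open>V\<close> would
  produce.\<close>

lemma smooth_lag_add_value:
  "smooth_lag c \<gamma> \<beta> P r \<pi> (V + d) \<mu> = smooth_lag c \<gamma> \<beta> P r \<pi> V \<mu>
     + (c + transpose (M_pol \<gamma> P \<pi>) *v (\<mu> + \<beta> *\<^sub>R bellman_res \<gamma> P r \<pi> V)) \<bullet> d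
     + \<beta> / 2 * (norm (M_pol \<gamma> P \<pi> *v d))\<^sup>2"
  by (simp add: smooth_lag_def bellman_res_add_value norm_add_power2 inner_add_left inner_add_right
      matrix_vector_right_distrib matrix_vector_mult_scaleR dot_lmul_matrix distrib_left)

lemma smooth_lag_add_policy:
  "smooth_lag c \<gamma> \<beta> P r (\<pi> + \<delta>) V \<mu> = smooth_lag c \<gamma> \<beta> P r \<pi> V \<mu>
     - (\<mu> + \<beta> *\<^sub>R bellman_res \<gamma> P r \<pi> V) \<bullet> bellman_lin \<gamma> P r V \<delta>
     + \<beta> / 2 * (norm (bellman_lin \<gamma> P r V \<delta>))\<^sup>2"
proof -
  have "(norm (bellman_res \<gamma> P r \<pi> V - bellman_lin \<gamma> P r V \<delta>))\<^sup>2 = (norm (bellman_res \<gamma> P r \<pi> V))\<^sup>2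
      - 2 * (bellman_res \<gamma> P r \<pi> V \<bullet> bellman_lin \<gamma> P r V \<delta>) + (norm (bellman_lin \<gamma> P r V \<delta>))\<^sup>2"
    using norm_add_power2[of "bellman_res \<gamma> P r \<pi> V" "- bellman_lin \<gamma> P r V \<delta>"] by simp
  then show ?thesis
    unfolding smooth_lag_def bellman_res_add_policy
    by (simp add: inner_add_left inner_diff_right right_diff_distrib distrib_left)
qed

text \<open>Replaces differentiation in the first-order condition of a quadratic: for small
  \<open>t\<close> of the sign opposite to \<open>a\<close> the linear term would win.\<close>

lemma linear_coeff_zero:
  fixes a b :: real
  assumes "\<And>t. 0 \<le> t * a + t\<^sup>2 * b"
  shows "a = 0"
proof (rule ccontr)
  assume "a \<noteq> 0"
  \<comment> \<open>Any positive \<open>k\<close> above \<open>b\<close> works: at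
    \<open>t = - a / k\<close> the expression equals \<open>a\<^sup>2 / k * (b / k - 1)\<close>,
    which is negative.\<close>
  define k where "k = 2 * (\<bar>b\<bar> + 1)"
  have k: "b < k" "0 < k" by (simp_all add: k_def)
  have "(- a / k) * a + (- a / k)\<^sup>2 * b = a\<^sup>2 / k * (b / k - 1)"
    using k by (simp add: power2_eq_square field_simps)
  moreover have "b / k - 1 < 0" using k by simp
  moreover have "0 < a\<^sup>2 / k" using k \<open>a \<noteq> 0\<close> by simp
  ultimately have "(- a / k) * a + (- a / k)\<^sup>2 * b < 0"
    using mult_pos_neg by metis
  with assms[of "- a / k"] show False by simp
qed

text \<open>A quadratic minorant that touches \<open>f\<close> at \<open>x\<close> leaves a
  difference quotient bounded below by \<open>- C * norm (y - x)\<close>, which tends to zero. This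
  gives a Frechet subgradient, and constant sequences make it a limiting one.\<close>

lemma proximal_subgradient:
  fixes f :: "'x::euclidean_space \<Rightarrow> ereal"
  assumes fin: "\<bar>f x\<bar> \<noteq> \<infinity>" and C: "0 \<le> C"
    and ge: "\<And>y. f x + ereal (v \<bullet> (y - x) - C * (norm (y - x))\<^sup>2) \<le> f y"
  shows "v \<in> limiting_subdiff f x"
proof -
  have "0 \<le> Liminf (at x) (\<lambda>y. (f y - f x - ereal (v \<bullet> (y - x))) / ereal (norm (y - x)))"
    (is "_ \<le> Liminf _ ?q")
  proof -
    obtain a where a: "f x = ereal a" using fin by auto
    have q: "ereal (- C * norm (y - x)) \<le> ?q y" if "y \<noteq> x" for y
    proof (cases "f y")
      case (real b)
      have n: "0 < norm (y - x)" using that by simp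
      have "- C * norm (y - x) \<le> (b - a - v \<bullet> (y - x)) / norm (y - x)"
        using ge[of y] real a n by (simp add: pos_le_divide_eq power2_eq_square algebra_simps)
      then show ?thesis using real a n by simp
    next
      case PInf
      then show ?thesis using that a by simp
    next
      case MInf
      then show ?thesis using ge[of y] a by simp
    qed
    have "((\<lambda>y. ereal (- C * norm (y - x))) \<longlongrightarrow> ereal (- C * norm (x - x))) (at x)"
      by (intro tendsto_intros)
    then have "Liminf (at x) (\<lambda>y. ereal (- C * norm (y - x))) = ereal (- C * norm (x - x))"
      by (intro lim_imp_Liminf) auto
    moreover have "Liminf (at x) (\<lambda>y. ereal (- C * norm (y - x))) \<le> Liminf (at x) ?q"
      using q by (intro Liminf_mono) (simp add: eventually_at_filter)
    ultimately show ?thesis by (simp add: zero_ereal_def)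
  qed
  then have "v \<in> frechet_subdiff f x" using fin by (simp add: frechet_subdiff_def)
  then show ?thesis
    using fin unfolding limiting_subdiff_def
    by (intro CollectI conjI exI[of _ "\<lambda>_. x"] exI[of _ "\<lambda>_. v"]) auto
qed

lemma edist0_le: "v \<in> S \<Longrightarrow> edist0 S \<le> ennreal (norm v)"
  unfolding edist0_def by (rule INF_lower)

text \<open>The residual is affine in the policy, so its derivative is the same at every
  policy.\<close>

lemma J_pol_eq: "J_pol \<gamma> P r \<pi> V = (\<lambda>\<delta>. - bellman_lin \<gamma> P r V \<delta>)"
proof -
  have "bounded_linear (bellman_lin \<gamma> P r V)"
    by (simp add: linear_bellman_lin linear_conv_bounded_linear[symmetric])
  then have "((\<lambda>p. bellman_res \<gamma> P r p V) has_derivative (\<lambda>\<delta>. 0 - bellman_lin \<gamma> P r V \<delta>)) (at \<pi>)"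
    unfolding bellman_res_lin
    by (intro has_derivative_diff has_derivative_const bounded_linear_imp_has_derivative)
  then show ?thesis
    unfolding J_pol_def using frechet_derivative_at by fastforce
qed

section \<open>One step of the iteration\<close>

text \<open>\<open>C\<close> is a common upper bound for the constants of the problem, so that all
  estimates can be stated with powers of a single number.\<close>

locale bellman_data =
  fixes \<phi> :: "real^'a::finite^'s::finite \<Rightarrow> ereal" and c :: "real^'s"
    and P :: "'s \<Rightarrow> 'a \<Rightarrow> 's \<Rightarrow> real" and r :: "'s \<Rightarrow> 'a \<Rightarrow> real"
    and \<gamma> \<beta> \<eta>\<^sub>\<pi> \<eta>\<^sub>V \<kappa> L C :: real
  assumes gamma: "0 < \<gamma>" "\<gamma> < 1"
    and P_stochastic: "\<And>s a. prob_vec (P s a)"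
    and phi_not_MInf: "\<And>\<pi>. \<pi> \<in> policies \<Longrightarrow> \<phi> \<pi> \<noteq> -\<infinity>"
    and steps_pos: "0 < \<beta>" "0 < \<eta>\<^sub>\<pi>" "0 < \<eta>\<^sub>V"
    and kappa_pos: "0 < \<kappa>"
    and L_nonneg: "0 \<le> L"
    and M_Lipschitz: "\<And>\<pi> \<pi>'. \<pi> \<in> policies \<Longrightarrow> \<pi>' \<in> policies \<Longrightarrow>
          spectral_norm (M_pol \<gamma> P \<pi>' - M_pol \<gamma> P \<pi>) \<le> L * norm (\<pi>' - \<pi>)"
    and beta_V: "60 * \<kappa>\<^sup>2 / \<eta>\<^sub>V < \<beta>"
    and beta_pi: "30 * \<eta>\<^sub>\<pi> * \<kappa> ^ 4 * L\<^sup>2 * (norm c)\<^sup>2 < \<beta>"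
    and C_ge: "1 \<le> C" "\<beta> \<le> C" "1 / \<beta> \<le> C" "1 / \<eta>\<^sub>\<pi> \<le> C" "1 / \<eta>\<^sub>V \<le> C" "\<kappa> \<le> C" "norm c \<le> C"
      "\<eta>\<^sub>\<pi> \<le> C" "\<eta>\<^sub>V \<le> C" "1 / \<kappa> \<le> C"
    and C_kernel: "1 + (kernel_l1 P + reward_l1 r) * real CARD('s) \<le> C"
begin

abbreviation "Res \<equiv> bellman_res \<gamma> P r"
abbreviation "err \<equiv> model_error P r"

section \<open>Bounds by the common constant\<close>

lemma C_CARD: "real CARD('s) \<le> C"
proof -
  have "1 \<le> real CARD('s) * real CARD('a)"
    by (simp add: Suc_leI flip: of_nat_mult)
  then have "1 * real CARD('s) \<le> kernel_l1 P * real CARD('s)"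
    by (intro mult_right_mono) (simp_all add: kernel_l1_stochastic[OF P_stochastic])
  also have "\<dots> \<le> C"
    using C_kernel mult_nonneg_nonneg[OF reward_l1_nonneg[of r], of "real CARD('s)"]
    by (simp add: distrib_right)
  finally show ?thesis by simp
qed

lemma C_kernel_reward: "kernel_l1 P + reward_l1 r \<le> C"
proof -
  have "(kernel_l1 P + reward_l1 r) * 1 \<le> (kernel_l1 P + reward_l1 r) * real CARD('s)"
    using kernel_l1_nonneg[of P] reward_l1_nonneg[of r]
    by (intro mult_left_mono) (simp_all add: Suc_leI)
  with C_kernel show ?thesis by simp
qed

lemma norm_policy_C: "\<pi> \<in> policies \<Longrightarrow> norm (\<pi> :: real^'a^'s) \<le> C"
  using norm_policy_le[of \<pi>] C_CARD by linarith

lemma norm_M_pol_mult: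
  fixes D :: "'s \<Rightarrow> 'a \<Rightarrow> 's \<Rightarrow> real"
  assumes "\<And>s a. prob_vec (D s a)" "\<pi> \<in> policies"
  shows "norm (M_pol \<gamma> D \<pi> *v x) \<le> C * norm x"
proof -
  have "norm (P_pol D \<pi> *v x) \<le> kernel_l1 D * norm \<pi> * norm x"
    by (rule norm_P_pol_mult)
  also have "kernel_l1 D = kernel_l1 P"
    by (simp add: kernel_l1_stochastic assms P_stochastic)
  also have "kernel_l1 P * norm \<pi> * norm x \<le> kernel_l1 P * real CARD('s) * norm x"
    by (intro mult_right_mono mult_left_mono norm_policy_le assms kernel_l1_nonneg) simp
  finally have "norm (P_pol D \<pi> *v x) \<le> kernel_l1 P * real CARD('s) * norm x" .
  moreover have "norm (M_pol \<gamma> D \<pi> *v x) \<le> norm x + \<gamma> * norm (P_pol D \<pi> *v x)"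
    using norm_triangle_ineq4[of x "\<gamma> *\<^sub>R (P_pol D \<pi> *v x)"] gamma by (simp add: M_pol_mult)
  moreover have "\<gamma> * norm (P_pol D \<pi> *v x) \<le> 1 * norm (P_pol D \<pi> *v x)"
    using gamma by (intro mult_right_mono) auto
  ultimately have "norm (M_pol \<gamma> D \<pi> *v x) \<le> (1 + kernel_l1 P * real CARD('s)) * norm x"
    by (simp add: distrib_right)
  also have "\<dots> \<le> C * norm x"
  proof (intro mult_right_mono)
    show "1 + kernel_l1 P * real CARD('s) \<le> C"
      using C_kernel mult_nonneg_nonneg[OF reward_l1_nonneg[of r], of "real CARD('s)"]
      by (simp add: distrib_right)
  qed simp
  finally show ?thesis .
qed

lemma norm_bellman_lin_true:
  "norm (bellman_lin \<gamma> P r V \<delta>) \<le> C * norm \<delta> * (1 + norm V)"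
proof -
  have "norm (bellman_lin \<gamma> P r V \<delta>) \<le> (kernel_l1 P + reward_l1 r) * norm \<delta> * (1 + norm V)"
    using gamma by (intro norm_bellman_lin) auto
  also have "\<dots> \<le> C * norm \<delta> * (1 + norm V)"
    by (intro mult_right_mono C_kernel_reward) auto
  finally show ?thesis .
qed

lemma norm_bellman_res_true:
  assumes "\<pi> \<in> policies"
  shows "norm (Res \<pi> V) \<le> C * (1 + norm V)"
proof -
  have "norm (bellman_lin \<gamma> P r V \<pi>) \<le> (kernel_l1 P + reward_l1 r) * norm \<pi> * (1 + norm V)"
    using gamma by (intro norm_bellman_lin) auto
  also have "\<dots> \<le> (kernel_l1 P + reward_l1 r) * real CARD('s) * (1 + norm V)"
    using kernel_l1_nonneg[of P] reward_l1_nonneg[of r]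
    by (intro mult_right_mono mult_left_mono norm_policy_le assms) auto
  also have "\<dots> \<le> (C - 1) * (1 + norm V)"
    using C_kernel by (intro mult_right_mono) auto
  finally have "norm (bellman_lin \<gamma> P r V \<pi>) \<le> (C - 1) * (1 + norm V)" .
  then show ?thesis
    using norm_triangle_ineq4[of V "bellman_lin \<gamma> P r V \<pi>"] by (simp add: bellman_res_lin algebra_simps)
qed

text \<open>Controls the Lagrangian at both ends of a run by the squared size of the
  iterates.\<close>

lemma smooth_lag_bound:
  assumes "\<pi> \<in> policies"
  shows "\<bar>smooth_lag c \<gamma> \<beta> P r \<pi> V \<mu>\<bar> \<le> 3 * C ^ 3 * (1 + norm V + norm \<mu>)\<^sup>2"
proof -
  let ?t = "1 + norm V + norm \<mu>"
  have C0: "0 \<le> C" using C_ge by simp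
  have R: "norm (Res \<pi> V) \<le> C * ?t"
    using norm_bellman_res_true[OF assms, of V] mult_left_mono[of "1 + norm V" ?t C] C0 by simp
  have t1: "?t \<le> ?t\<^sup>2" by (rule self_le_power) auto
  have CC: "C \<le> C ^ 3" using C_ge by (intro self_le_power) auto
  have "\<bar>c \<bullet> V\<bar> \<le> C * ?t"
    using Cauchy_Schwarz_ineq2[of c V] mult_mono[OF C_ge(7), of "norm V" ?t] C0 by simp
  also have "\<dots> \<le> C ^ 3 * ?t\<^sup>2"
    using C0 by (intro mult_mono t1 CC) auto
  finally have 1: "\<bar>c \<bullet> V\<bar> \<le> C ^ 3 * ?t\<^sup>2" .
  have "\<bar>\<mu> \<bullet> Res \<pi> V\<bar> \<le> ?t * (C * ?t)"
    by (rule order_trans[OF Cauchy_Schwarz_ineq2]) (intro mult_mono R, use C0 in auto)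
  also have "\<dots> = C * ?t\<^sup>2" by (simp add: power2_eq_square)
  also have "\<dots> \<le> C ^ 3 * ?t\<^sup>2" by (intro mult_right_mono CC) simp
  finally have 2: "\<bar>\<mu> \<bullet> Res \<pi> V\<bar> \<le> C ^ 3 * ?t\<^sup>2" .
  have "\<bar>\<beta> / 2 * (norm (Res \<pi> V))\<^sup>2\<bar> \<le> C * (C * ?t)\<^sup>2"
  proof -
    have "\<beta> / 2 * (norm (Res \<pi> V))\<^sup>2 \<le> C * (C * ?t)\<^sup>2"
      using steps_pos C_ge C0 by (intro mult_mono power_mono R) auto
    then show ?thesis using steps_pos by (simp add: abs_mult)
  qed
  also have "\<dots> = C ^ 3 * ?t\<^sup>2" by (simp add: power2_eq_square power3_eq_cube mult_ac)
  finally have 3: "\<bar>\<beta> / 2 * (norm (Res \<pi> V))\<^sup>2\<bar> \<le> C ^ 3 * ?t\<^sup>2" .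
  show ?thesis using 1 2 3 unfolding smooth_lag_def by linarith
qed

end

locale bellman_step = bellman_data \<phi> c P r \<gamma> \<beta> \<eta>\<^sub>\<pi> \<eta>\<^sub>V \<kappa> L C
  for \<phi> :: "real^'a::finite^'s::finite \<Rightarrow> ereal" and c P r \<gamma> \<beta> \<eta>\<^sub>\<pi> \<eta>\<^sub>V \<kappa> L C +
  fixes Q :: "'s \<Rightarrow> 'a \<Rightarrow> 's \<Rightarrow> real" and q :: "'s \<Rightarrow> 'a \<Rightarrow> real"
    and \<pi> :: "real^'a^'s" and V \<mu> :: "real^'s"
    and \<pi>' :: "real^'a^'s" and V' \<mu>' :: "real^'s"
  assumes Q_stochastic: "\<And>s a. prob_vec (Q s a)"
    and Q_inverse: "\<And>\<pi>. \<pi> \<in> policies \<Longrightarrow> spectral_norm (matrix_inv (M_pol \<gamma> Q \<pi>)) \<le> \<kappa>"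
    and pi_policy: "\<pi> \<in> policies" and phi_pi_finite: "\<phi> \<pi> \<noteq> \<infinity>"
    and policy_step: "is_arg_min
          (\<lambda>p. aug_lagrangian \<phi> c \<gamma> \<beta> Q q p V \<mu> + ereal (1 / (2 * \<eta>\<^sub>\<pi>) * (norm (p - \<pi>))\<^sup>2))
          (\<lambda>p. p \<in> policies) \<pi>'"
    and value_step: "is_arg_min
          (\<lambda>W. aug_lagrangian \<phi> c \<gamma> \<beta> Q q \<pi>' W \<mu> + ereal (1 / (2 * \<eta>\<^sub>V) * (norm (W - V))\<^sup>2))
          (\<lambda>_. True) V'"
    and multiplier_step: "\<mu>' = \<mu> + \<beta> *\<^sub>R bellman_res \<gamma> Q q \<pi>' V'"
begin

abbreviation "Lag \<equiv> smooth_lag c \<gamma> \<beta> P r"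
abbreviation "LagQ \<equiv> smooth_lag c \<gamma> \<beta> Q q"
abbreviation "ResQ \<equiv> bellman_res \<gamma> Q q"
abbreviation "MQ \<equiv> M_pol \<gamma> Q \<pi>'"

section \<open>Descent of the empirical Lagrangian\<close>

lemma policy_step_mono:
  assumes "p \<in> policies"
  shows "\<phi> \<pi>' + ereal (LagQ \<pi>' V \<mu> + 1 / (2 * \<eta>\<^sub>\<pi>) * (norm (\<pi>' - \<pi>))\<^sup>2)
      \<le> \<phi> p + ereal (LagQ p V \<mu> + 1 / (2 * \<eta>\<^sub>\<pi>) * (norm (p - \<pi>))\<^sup>2)"
proof -
  have "\<not> \<phi> p + ereal (LagQ p V \<mu>) + ereal (1 / (2 * \<eta>\<^sub>\<pi>) * (norm (p - \<pi>))\<^sup>2)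
      < \<phi> \<pi>' + ereal (LagQ \<pi>' V \<mu>) + ereal (1 / (2 * \<eta>\<^sub>\<pi>) * (norm (\<pi>' - \<pi>))\<^sup>2)"
    using policy_step assms unfolding is_arg_min_def aug_lagrangian_def smooth_lag_def by blast
  then show ?thesis unfolding not_less by (simp only: add.assoc plus_ereal.simps(1))
qed

lemma pi'_policy: "\<pi>' \<in> policies"
  using policy_step by (simp add: is_arg_min_def)

text \<open>The current policy is a competitor with finite objective; properness excludes the other
  infinity.\<close>

lemma phi_pi'_finite: "\<bar>\<phi> \<pi>'\<bar> \<noteq> \<infinity>"
  using policy_step_mono[OF pi_policy] phi_pi_finite phi_not_MInf[OF pi_policy] phi_not_MInf[OF pi'_policy]
  by (cases "\<phi> \<pi>"; cases "\<phi> \<pi>'") auto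

lemma policy_descent:
  "real_of_ereal (\<phi> \<pi>') + LagQ \<pi>' V \<mu> + (norm (\<pi>' - \<pi>))\<^sup>2 / (2 * \<eta>\<^sub>\<pi>)
     \<le> real_of_ereal (\<phi> \<pi>) + LagQ \<pi> V \<mu>"
  using policy_step_mono[OF pi_policy] phi_pi_finite phi_not_MInf[OF pi_policy] phi_pi'_finite
  by (cases "\<phi> \<pi>"; cases "\<phi> \<pi>'") auto

lemma value_step_real:
  "LagQ \<pi>' V' \<mu> + (norm (V' - V))\<^sup>2 / (2 * \<eta>\<^sub>V) \<le> LagQ \<pi>' W \<mu> + (norm (W - V))\<^sup>2 / (2 * \<eta>\<^sub>V)"
proof -
  obtain f where f: "\<phi> \<pi>' = ereal f" using phi_pi'_finite by auto
  have "\<not> ereal f + ereal (LagQ \<pi>' W \<mu>) + ereal (1 / (2 * \<eta>\<^sub>V) * (norm (W - V))\<^sup>2)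
      < ereal f + ereal (LagQ \<pi>' V' \<mu>) + ereal (1 / (2 * \<eta>\<^sub>V) * (norm (V' - V))\<^sup>2)"
    using value_step unfolding is_arg_min_def aug_lagrangian_def f smooth_lag_def by blast
  then show ?thesis by simp
qed

lemma value_expand:
  "LagQ \<pi>' (V' + d) \<mu> + (norm (V' + d - V))\<^sup>2 / (2 * \<eta>\<^sub>V)
   = LagQ \<pi>' V' \<mu> + (norm (V' - V))\<^sup>2 / (2 * \<eta>\<^sub>V)
     + (c + transpose MQ *v \<mu>' + (1 / \<eta>\<^sub>V) *\<^sub>R (V' - V)) \<bullet> d
     + (\<beta> / 2 * (norm (MQ *v d))\<^sup>2 + (norm d)\<^sup>2 / (2 * \<eta>\<^sub>V))"
proof -
  have "V' + d - V = (V' - V) + d" by simp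
  then have "(norm (V' + d - V))\<^sup>2 = (norm (V' - V))\<^sup>2 + 2 * ((V' - V) \<bullet> d) + (norm d)\<^sup>2"
    by (simp only: norm_add_power2)
  then show ?thesis
    using steps_pos
    by (simp add: smooth_lag_add_value multiplier_step inner_add_left add_divide_distrib del: transpose_matrix_vector)
qed

text \<open>The subproblem is quadratic, and the minimizer is perturbed along the claimed gradient
  itself. The updated multiplier appears because the dual step uses the residual at the new
  value.\<close>

lemma value_gradient: "c + transpose MQ *v \<mu>' + (1 / \<eta>\<^sub>V) *\<^sub>R (V' - V) = 0" (is "?g = 0")
proof -
  have "?g \<bullet> ?g = 0"
  proof (rule linear_coeff_zero)
    fix t :: real
    show "0 \<le> t * (?g \<bullet> ?g) + t\<^sup>2 * (\<beta> / 2 * (norm (MQ *v ?g))\<^sup>2 + (norm ?g)\<^sup>2 / (2 * \<eta>\<^sub>V))"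
      using value_step_real[of "V' + t *\<^sub>R ?g"] value_expand[of "t *\<^sub>R ?g"]
      by (simp add: matrix_vector_mult_scaleR power_mult_distrib distrib_left mult_ac
          del: transpose_matrix_vector)
  qed
  then show ?thesis by (simp only: inner_eq_zero_iff)
qed

text \<open>The full \<open>1 / \<eta>\<^sub>V\<close>, twice the proximal coefficient, comes from
  strong convexity: moving back from the minimizer to \<open>V\<close> gains the proximal square
  once more.\<close>

lemma value_descent:
  "LagQ \<pi>' V' \<mu> + (norm (V' - V))\<^sup>2 / \<eta>\<^sub>V \<le> LagQ \<pi>' V \<mu>"
proof -
  have "0 \<le> \<beta> / 2 * (norm (MQ *v (V - V')))\<^sup>2" using steps_pos by simp
  then show ?thesis
    using value_expand[of "V - V'"] value_gradient steps_pos
    by (simp add: norm_minus_commute del: transpose_matrix_vector)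
qed

text \<open>The dual step raises the Lagrangian by exactly
  \<open>(norm (\<mu>' - \<mu>))\<^sup>2 / \<beta>\<close>, because the increment is \<beta> times
  the residual. This is the term which the margin on \<beta> has to absorb.\<close>

lemma empirical_descent:
  "real_of_ereal (\<phi> \<pi>') + LagQ \<pi>' V' \<mu>' \<le> real_of_ereal (\<phi> \<pi>) + LagQ \<pi> V \<mu>
     - (norm (\<pi>' - \<pi>))\<^sup>2 / (2 * \<eta>\<^sub>\<pi>) - (norm (V' - V))\<^sup>2 / \<eta>\<^sub>V + (norm (\<mu>' - \<mu>))\<^sup>2 / \<beta>"
proof -
  have d: "\<mu>' - \<mu> = \<beta> *\<^sub>R ResQ \<pi>' V'" by (simp add: multiplier_step)
  have "LagQ \<pi>' V' \<mu>' = LagQ \<pi>' V' \<mu> + (\<mu>' - \<mu>) \<bullet> ResQ \<pi>' V'"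
    by (simp add: smooth_lag_def inner_diff_left)
  also have "(\<mu>' - \<mu>) \<bullet> ResQ \<pi>' V' = (norm (\<mu>' - \<mu>))\<^sup>2 / \<beta>"
    unfolding d using steps_pos by (simp add: power_mult_distrib power2_norm_eq_inner power2_eq_square[of \<beta>])
  finally show ?thesis using policy_descent value_descent by simp
qed

end

section \<open>Elementary inequalities and the multiplier increment\<close>

lemma transpose_diff: "transpose (A - B) = transpose A - transpose (B :: real^'n^'m)"
  by (simp add: transpose_def vec_eq_iff)

lemma power2_sum4_le: "(a + b + c + d)\<^sup>2 \<le> 4 * (a\<^sup>2 + b\<^sup>2 + c\<^sup>2 + (d::real)\<^sup>2)"
proof -
  have "0 \<le> (a - b)\<^sup>2 + (a - c)\<^sup>2 + (a - d)\<^sup>2 + (b - c)\<^sup>2 + (b - d)\<^sup>2 + (c - d)\<^sup>2" by simp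
  then show ?thesis by (simp add: power2_eq_square algebra_simps)
qed

lemma power2_sum5_le: "(a + b + c + d + e)\<^sup>2 \<le> 5 * (a\<^sup>2 + b\<^sup>2 + c\<^sup>2 + d\<^sup>2 + (e::real)\<^sup>2)"
proof -
  have "0 \<le> (a - b)\<^sup>2 + (a - c)\<^sup>2 + (a - d)\<^sup>2 + (a - e)\<^sup>2 + (b - c)\<^sup>2 + (b - d)\<^sup>2 + (b - e)\<^sup>2
      + (c - d)\<^sup>2 + (c - e)\<^sup>2 + (d - e)\<^sup>2" by simp
  then show ?thesis by (simp add: power2_eq_square algebra_simps)
qed

lemma young_ineq:
  fixes K x y \<epsilon> :: real
  assumes "0 < \<epsilon>"
  shows "2 * K * x * y \<le> \<epsilon> * y\<^sup>2 + K\<^sup>2 / \<epsilon> * x\<^sup>2"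
proof -
  have "0 \<le> (\<epsilon> * y - K * x)\<^sup>2 / \<epsilon>" using assms by simp
  also have "\<dots> = \<epsilon> * y\<^sup>2 + K\<^sup>2 / \<epsilon> * x\<^sup>2 - 2 * K * x * y"
    using assms by (simp add: power2_eq_square field_simps)
  finally show ?thesis by simp
qed

context bellman_data
begin

lemma norm_M_pol_model_diff:
  assumes "\<pi> \<in> policies"
  shows "norm ((M_pol \<gamma> Q \<pi> - M_pol \<gamma> P \<pi>) *v x) \<le> C * err Q q * norm x"
proof -
  have "(M_pol \<gamma> Q \<pi> - M_pol \<gamma> P \<pi>) *v x = - (\<gamma> *\<^sub>R (P_pol (\<lambda>s a s'. Q s a s' - P s a s') \<pi> *v x))"
    by (simp add: matrix_vector_mult_diff_rdistrib M_pol_mult P_pol_diff_kernel[symmetric] scaleR_diff_right)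
  then have "norm ((M_pol \<gamma> Q \<pi> - M_pol \<gamma> P \<pi>) *v x)
      = \<gamma> * norm (P_pol (\<lambda>s a s'. Q s a s' - P s a s') \<pi> *v x)"
    using gamma by simp
  also have "\<dots> \<le> 1 * (kernel_l1 (\<lambda>s a s'. Q s a s' - P s a s') * norm \<pi> * norm x)"
    using gamma by (intro mult_mono norm_P_pol_mult) auto
  also have "\<dots> \<le> err Q q * C * norm x"
    unfolding mult_1
    by (intro mult_right_mono mult_mono norm_policy_C assms)
      (simp_all add: model_error_def kernel_l1_nonneg reward_l1_nonneg)
  finally show ?thesis by (simp add: mult_ac)
qed

text \<open>Subtracting the optimality conditions of two value steps bounds the change of the
  multiplier by quantities that the proximal terms control.  Solving for the
  multipliers first, the drift of the policy meets only the bounded vector \<open>c\<close>.\<close>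

lemma dual_difference:
  assumes Q: "\<And>s a. prob_vec (Q s a)" "\<And>s a. prob_vec (Q\<^sub>0 s a)"
    and inv: "spectral_norm (matrix_inv (M_pol \<gamma> Q \<pi>')) \<le> \<kappa>"
      "spectral_norm (matrix_inv (M_pol \<gamma> Q\<^sub>0 \<pi>)) \<le> \<kappa>"
    and pol: "\<pi>' \<in> policies" "\<pi> \<in> policies"
    and opt: "c + transpose (M_pol \<gamma> Q \<pi>') *v \<mu>' + (1 / \<eta>\<^sub>V) *\<^sub>R d' = 0"
      "c + transpose (M_pol \<gamma> Q\<^sub>0 \<pi>) *v \<mu> + (1 / \<eta>\<^sub>V) *\<^sub>R d = 0"
  shows "norm (\<mu>' - \<mu>) \<le> \<kappa>\<^sup>2 * L * norm c * norm (\<pi>' - \<pi>) + C ^ 4 * err Q q + C ^ 4 * err Q\<^sub>0 q\<^sub>0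
      + \<kappa> / \<eta>\<^sub>V * norm d' + \<kappa> / \<eta>\<^sub>V * norm d"
proof -
  let ?M = "M_pol \<gamma> Q \<pi>'" and ?N = "M_pol \<gamma> Q\<^sub>0 \<pi>"
  have inv': "invertible ?M" "invertible ?N"
    using gamma Q pol by (auto intro!: invertible_M_pol)
  obtain B where B: "\<And>y. transpose ?M *v (B *v y) = y" "\<And>y. norm (B *v y) \<le> \<kappa> * norm y"
    "\<And>x. norm x \<le> \<kappa> * norm (transpose ?M *v x)"
    using transpose_inverse_bound[OF inv'(1) inv(1)] by blast
  obtain B0 where B0: "\<And>y. transpose ?N *v (B0 *v y) = y" "\<And>y. norm (B0 *v y) \<le> \<kappa> * norm y"
    "\<And>x. norm x \<le> \<kappa> * norm (transpose ?N *v x)"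
    using transpose_inverse_bound[OF inv'(2) inv(2)] by blast
  \<comment> \<open>The vectors \<open>- ?u\<close> and \<open>- ?w\<close> are the multipliers that
    would solve the two conditions without proximal terms. The deviation from them costs only value
    increments, which \<open>1\<close> and \<open>2\<close> record.\<close>
  let ?u = "B *v c" and ?w = "B0 *v c"
  have "norm (\<mu>' + ?u) \<le> \<kappa> * norm (transpose ?M *v (\<mu>' + ?u))" by (rule B(3))
  also have "transpose ?M *v (\<mu>' + ?u) = - ((1 / \<eta>\<^sub>V) *\<^sub>R d')"
    using opt(1) unfolding matrix_vector_right_distrib B(1) by (simp add: add_eq_0_iff add.commute)
  finally have 1: "norm (\<mu>' + ?u) \<le> \<kappa> / \<eta>\<^sub>V * norm d'" using steps_pos by simp
  have "norm (\<mu> + ?w) \<le> \<kappa> * norm (transpose ?N *v (\<mu> + ?w))" by (rule B0(3))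
  also have "transpose ?N *v (\<mu> + ?w) = - ((1 / \<eta>\<^sub>V) *\<^sub>R d)"
    using opt(2) unfolding matrix_vector_right_distrib B0(1) by (simp add: add_eq_0_iff add.commute)
  finally have 2: "norm (\<mu> + ?w) \<le> \<kappa> / \<eta>\<^sub>V * norm d" using steps_pos by simp
  let ?E = "C * err Q q + L * norm (\<pi>' - \<pi>) + C * err Q\<^sub>0 q\<^sub>0"
  have E: "norm ((?M - ?N) *v x) \<le> ?E * norm x" for x
  proof -
    have "(?M - ?N) *v x = (?M - M_pol \<gamma> P \<pi>') *v x + (M_pol \<gamma> P \<pi>' - M_pol \<gamma> P \<pi>) *v x
        - (?N - M_pol \<gamma> P \<pi>) *v x"
      by (simp add: matrix_vector_mult_diff_rdistrib)
    also have "norm \<dots> \<le> norm ((?M - M_pol \<gamma> P \<pi>') *v x) + norm ((M_pol \<gamma> P \<pi>' - M_pol \<gamma> P \<pi>) *v x)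
        + norm ((?N - M_pol \<gamma> P \<pi>) *v x)"
      by (rule order_trans[OF norm_triangle_ineq4]) (simp add: norm_triangle_ineq)
    also have "\<dots> \<le> C * err Q q * norm x + L * norm (\<pi>' - \<pi>) * norm x + C * err Q\<^sub>0 q\<^sub>0 * norm x"
      by (intro add_mono norm_M_pol_model_diff pol order_trans[OF norm_le_spectral_norm]
          mult_right_mono M_Lipschitz norm_ge_zero)
    finally show ?thesis by (simp add: distrib_right)
  qed
  have E0: "0 \<le> ?E"
    using C_ge L_nonneg model_error_nonneg[of P r] by simp
  have "norm (?u - ?w) \<le> \<kappa> * norm (transpose ?M *v (?u - ?w))" by (rule B(3))
  \<comment> \<open>Resolvent identity: \<open>transpose ?M *v ?u\<close> and
    \<open>transpose ?N *v ?w\<close> both equal \<open>c\<close>, so only the difference of the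
    matrices, applied to the bounded vector \<open>?w\<close>, remains.\<close>
  also have "transpose ?M *v (?u - ?w) = - (transpose (?M - ?N) *v ?w)"
    unfolding transpose_diff matrix_vector_mult_diff_distrib matrix_vector_mult_diff_rdistrib B(1) B0(1)
    by simp
  also have "\<kappa> * norm (- (transpose (?M - ?N) *v ?w)) \<le> \<kappa> * (?E * (\<kappa> * norm c))"
    unfolding norm_minus_cancel
    by (intro mult_left_mono order_trans[OF norm_transpose_mult_le[OF E]] B0(2) E0)
      (use kappa_pos in auto)
  also have "\<dots> = \<kappa>\<^sup>2 * L * norm c * norm (\<pi>' - \<pi>) + \<kappa>\<^sup>2 * norm c * C * err Q q + \<kappa>\<^sup>2 * norm c * C * err Q\<^sub>0 q\<^sub>0"
    by (simp add: power2_eq_square algebra_simps)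
  also have "\<dots> \<le> \<kappa>\<^sup>2 * L * norm c * norm (\<pi>' - \<pi>) + C ^ 4 * err Q q + C ^ 4 * err Q\<^sub>0 q\<^sub>0"
  proof -
    have "\<kappa>\<^sup>2 * norm c * C \<le> C\<^sup>2 * C * C"
      using kappa_pos C_ge by (intro mult_mono power_mono) auto
    also have "\<dots> = C ^ 4" by (simp add: power2_eq_square power4_eq_xxxx)
    finally show ?thesis by (intro add_mono mult_right_mono model_error_nonneg order_refl)
  qed
  finally have 3: "norm (?u - ?w) \<le> \<kappa>\<^sup>2 * L * norm c * norm (\<pi>' - \<pi>) + C ^ 4 * err Q q + C ^ 4 * err Q\<^sub>0 q\<^sub>0" .
  have "\<mu>' - \<mu> = (\<mu>' + ?u) - (\<mu> + ?w) - (?u - ?w)" by simp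
  also have "norm \<dots> \<le> norm (\<mu>' + ?u) + norm (\<mu> + ?w) + norm (?u - ?w)"
    by (meson norm_triangle_le_diff norm_triangle_ineq4 add_right_mono order_trans)
  finally show ?thesis using 1 2 3 by linarith
qed

end

context bellman_step
begin

section \<open>Model noise in one step\<close>

definition noise :: "real^'s \<Rightarrow> real^'a^'s \<Rightarrow> real^'s" where
  "noise = bellman_lin \<gamma> (\<lambda>s a s'. Q s a s' - P s a s') (\<lambda>s a. q s a - r s a)"

abbreviation "e \<equiv> err Q q"
abbreviation "\<theta> \<equiv> 1 + norm V + norm \<mu>"
abbreviation "dp \<equiv> norm (\<pi>' - \<pi>)"
abbreviation "dv \<equiv> norm (V' - V)"
abbreviation "dm \<equiv> norm (\<mu>' - \<mu>)"
abbreviation "\<xi> \<equiv> e * (1 + e) * \<theta>\<^sup>2"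

lemma ResQ_eq: "ResQ p W = Res p W - noise W p"
  using bellman_lin_diff_model[of \<gamma> Q q W p P r] by (simp add: bellman_res_lin noise_def algebra_simps)

lemma e_nonneg: "0 \<le> e"
  by (rule model_error_nonneg)

lemma norm_noise: "norm (noise W p) \<le> e * norm p * (1 + norm W)"
  using norm_bellman_lin[of \<gamma> _ _ W p] gamma unfolding noise_def model_error_def by simp

lemma norm_noise_policy: "p \<in> policies \<Longrightarrow> norm (noise W p) \<le> C * e * (1 + norm W)"
  using norm_noise[of W p] mult_left_mono[OF norm_policy_C e_nonneg]
  by (smt (verit) mult.commute mult_right_mono norm_ge_zero)

text \<open>The level \<xi> is chosen to dominate all error products below: a multiplier of size
  \<theta> is paired with noise of size \<open>e * \<theta>\<close>, and the next value and the
  companion multiplier, built from the empirical model, contribute the factor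
  \<open>1 + e\<close>.\<close>

lemma e_theta_le: "e * \<theta> \<le> e * \<theta>\<^sup>2" "e * \<theta>\<^sup>2 \<le> \<xi>" "e \<le> \<xi>" "e * (1 + e) * \<theta> \<le> \<xi>"
proof -
  have t: "1 \<le> \<theta>" "\<theta> \<le> \<theta>\<^sup>2" by (auto intro!: self_le_power)
  show 1: "e * \<theta> \<le> e * \<theta>\<^sup>2" by (intro mult_left_mono t e_nonneg)
  have "(e * \<theta>\<^sup>2) * 1 \<le> (e * \<theta>\<^sup>2) * (1 + e)"
    using e_nonneg by (intro mult_left_mono) auto
  then show 2: "e * \<theta>\<^sup>2 \<le> \<xi>" by (simp add: mult_ac)
  have "e * 1 \<le> e * \<theta>" by (intro mult_left_mono t e_nonneg)
  with 1 2 show "e \<le> \<xi>" by linarith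
  show "e * (1 + e) * \<theta> \<le> \<xi>" using e_nonneg by (intro mult_left_mono t) auto
qed

section \<open>Growth of value and multiplier\<close>

lemma q1_le: "\<kappa>\<^sup>2 / (\<beta> * \<eta>\<^sub>V) \<le> 1 / 60"
  using beta_V steps_pos by (simp add: field_simps)

text \<open>An energy estimate. The optimality condition is tested with \<open>V'\<close> after the
  multiplier update has been inserted; the term \<open>\<beta> * (norm (MQ *v V'))\<^sup>2\<close>
  is coercive by the inverse bound, and one factor \<open>norm (MQ *v V')\<close> cancels. The
  \<open>1 + e\<close> is due to the empirical rewards.\<close>

lemma value_growth:
  "norm V' \<le> \<kappa>\<^sup>2 / (\<beta> * \<eta>\<^sub>V) * norm V + \<kappa> / \<beta> * norm \<mu> + 2 * C ^ 4 * (1 + e)"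
proof -
  let ?m = "norm (MQ *v V')"
  have le: "norm V' \<le> \<kappa> * ?m"
    using gamma by (intro norm_le_inverse_bound invertible_M_pol Q_inverse pi'_policy Q_stochastic) auto
  have mu: "\<mu>' = \<mu> + \<beta> *\<^sub>R (MQ *v V') - \<beta> *\<^sub>R r_pol q \<pi>'"
    by (simp add: multiplier_step bellman_res_def scaleR_diff_right)
  have "0 = (c + transpose MQ *v \<mu>' + (1 / \<eta>\<^sub>V) *\<^sub>R (V' - V)) \<bullet> V'"
    by (simp only: value_gradient inner_zero_left)
  also have "\<dots> = c \<bullet> V' + \<mu>' \<bullet> (MQ *v V') + (1 / \<eta>\<^sub>V) * (V' \<bullet> V' - V \<bullet> V')"
    by (simp add: inner_add_left inner_diff_left dot_lmul_matrix)
  also have "\<dots> = c \<bullet> V' + \<mu> \<bullet> (MQ *v V') + \<beta> * ?m\<^sup>2 - \<beta> * (r_pol q \<pi>' \<bullet> (MQ *v V'))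
      + (1 / \<eta>\<^sub>V) * (V' \<bullet> V') - (1 / \<eta>\<^sub>V) * (V \<bullet> V')"
    unfolding mu by (simp add: inner_add_left inner_diff_left power2_norm_eq_inner right_diff_distrib)
  finally have "\<beta> * ?m\<^sup>2 = - (c \<bullet> V') - \<mu> \<bullet> (MQ *v V') + \<beta> * (r_pol q \<pi>' \<bullet> (MQ *v V')) + (1 / \<eta>\<^sub>V) * (V \<bullet> V')
      - (1 / \<eta>\<^sub>V) * (V' \<bullet> V')"
    by linarith
  also have "\<dots> \<le> - (c \<bullet> V') - \<mu> \<bullet> (MQ *v V') + \<beta> * (r_pol q \<pi>' \<bullet> (MQ *v V')) + (1 / \<eta>\<^sub>V) * (V \<bullet> V')"
    using steps_pos by simp
  also have "\<dots> \<le> norm c * (\<kappa> * ?m) + norm \<mu> * ?m + \<beta> * (norm (r_pol q \<pi>') * ?m) + (1 / \<eta>\<^sub>V) * (norm V * (\<kappa> * ?m))"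
  proof -
    have "norm c * norm V' \<le> norm c * (\<kappa> * ?m)" by (intro mult_left_mono le) simp
    then have 1: "- (c \<bullet> V') \<le> norm c * (\<kappa> * ?m)"
      using Cauchy_Schwarz_ineq2[of c V'] by linarith
    have 2: "- (\<mu> \<bullet> (MQ *v V')) \<le> norm \<mu> * ?m"
      using Cauchy_Schwarz_ineq2[of \<mu> "MQ *v V'"] by linarith
    have 3: "\<beta> * (r_pol q \<pi>' \<bullet> (MQ *v V')) \<le> \<beta> * (norm (r_pol q \<pi>') * ?m)"
      using steps_pos by (intro mult_left_mono norm_cauchy_schwarz) auto
    have "norm V * norm V' \<le> norm V * (\<kappa> * ?m)" by (intro mult_left_mono le) simp
    then have 4: "1 / \<eta>\<^sub>V * (V \<bullet> V') \<le> 1 / \<eta>\<^sub>V * (norm V * (\<kappa> * ?m))"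
      using norm_cauchy_schwarz[of V V'] steps_pos by (intro mult_left_mono) auto
    show ?thesis using 1 2 3 4 by linarith
  qed
  also have "\<dots> = (norm c * \<kappa> + norm \<mu> + \<beta> * norm (r_pol q \<pi>') + 1 / \<eta>\<^sub>V * norm V * \<kappa>) * ?m"
    by (simp add: algebra_simps)
  finally have "(\<beta> * ?m) * ?m \<le> (norm c * \<kappa> + norm \<mu> + \<beta> * norm (r_pol q \<pi>') + 1 / \<eta>\<^sub>V * norm V * \<kappa>) * ?m"
    by (simp add: power2_eq_square mult_ac)
  then have "\<beta> * ?m \<le> norm c * \<kappa> + norm \<mu> + \<beta> * norm (r_pol q \<pi>') + 1 / \<eta>\<^sub>V * norm V * \<kappa>"
    using steps_pos kappa_pos by (cases "?m = 0") (auto simp: mult_le_cancel_right)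
  then have "?m \<le> (norm c * \<kappa> + norm \<mu> + \<beta> * norm (r_pol q \<pi>') + 1 / \<eta>\<^sub>V * norm V * \<kappa>) / \<beta>"
    using steps_pos by (simp add: pos_le_divide_eq mult.commute)
  then have "\<kappa> * ?m \<le> \<kappa> * ((norm c * \<kappa> + norm \<mu> + \<beta> * norm (r_pol q \<pi>') + 1 / \<eta>\<^sub>V * norm V * \<kappa>) / \<beta>)"
    using kappa_pos by (intro mult_left_mono) auto
  also have "\<dots> = \<kappa>\<^sup>2 / (\<beta> * \<eta>\<^sub>V) * norm V + \<kappa> / \<beta> * norm \<mu> + \<kappa> * norm (r_pol q \<pi>') + \<kappa> * \<kappa> * norm c * (1 / \<beta>)"
    using steps_pos by (simp add: power2_eq_square field_simps)
  finally have A: "norm V' \<le> \<kappa>\<^sup>2 / (\<beta> * \<eta>\<^sub>V) * norm V + \<kappa> / \<beta> * norm \<mu> + \<kappa> * norm (r_pol q \<pi>') + \<kappa> * \<kappa> * norm c * (1 / \<beta>)"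
    using le by linarith
  have "reward_l1 q \<le> reward_l1 r + reward_l1 (\<lambda>s a. q s a - r s a)"
    unfolding reward_l1_def sum.distrib[symmetric] by (intro sum_mono) auto
  also have "\<dots> \<le> C + e"
    using C_kernel_reward kernel_l1_nonneg[of P] kernel_l1_nonneg[of "\<lambda>s a s'. Q s a s' - P s a s'"]
    unfolding model_error_def by linarith
  finally have ql: "reward_l1 q \<le> C + e" .
  have "norm (r_pol q \<pi>') \<le> (C + e) * C"
    using C_ge e_nonneg
    by (intro order_trans[OF norm_r_pol] mult_mono ql norm_policy_C pi'_policy) auto
  then have "\<kappa> * norm (r_pol q \<pi>') \<le> C * ((C + e) * C)"
    using kappa_pos C_ge by (intro mult_mono) auto
  also have "\<dots> \<le> C ^ 4 * (1 + e)"
  proof -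
    have "C + e \<le> C * (1 + e)" using C_ge mult_right_mono[of 1 C e] e_nonneg by (simp add: distrib_left)
    then have "C * ((C + e) * C) \<le> C * ((C * (1 + e)) * C)"
      using C_ge by (intro mult_left_mono mult_right_mono) auto
    also have "\<dots> = C ^ 3 * (1 + e)" by (simp add: power3_eq_cube)
    also have "\<dots> \<le> C ^ 4 * (1 + e)"
      using C_ge e_nonneg by (intro mult_right_mono power_increasing) auto
    finally show ?thesis .
  qed
  finally have B: "\<kappa> * norm (r_pol q \<pi>') \<le> C ^ 4 * (1 + e)" .
  have "\<kappa> * \<kappa> * norm c * (1 / \<beta>) \<le> C * C * C * C"
    using kappa_pos C_ge steps_pos by (intro mult_mono) auto
  also have "\<dots> = C ^ 4" by (simp add: power4_eq_xxxx)
  also have "\<dots> \<le> C ^ 4 * (1 + e)"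
    using C_ge e_nonneg by simp
  finally show ?thesis using A B by linarith
qed

text \<open>The value condition is solved for the new multiplier, so that the old multiplier no
  longer enters directly. The scaling by \<open>\<kappa> / \<beta>\<close> is that of the multiplier
  in \<open>value_growth\<close>.\<close>

lemma multiplier_growth:
  "\<kappa> / \<beta> * norm \<mu>' \<le> C ^ 4 + \<kappa>\<^sup>2 / (\<beta> * \<eta>\<^sub>V) * (norm V' + norm V)"
proof -
  obtain B where B: "\<And>x. norm x \<le> \<kappa> * norm (transpose MQ *v x)"
    using gamma transpose_inverse_bound[OF invertible_M_pol Q_inverse, of \<pi>'] pi'_policy Q_stochastic
    by (metis less_imp_le)
  have "transpose MQ *v \<mu>' = - (c + (1 / \<eta>\<^sub>V) *\<^sub>R (V' - V))"
    using value_gradient by (intro eq_neg_iff_add_eq_0[THEN iffD2]) (simp only: ac_simps)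
  then have "norm \<mu>' \<le> \<kappa> * norm (c + (1 / \<eta>\<^sub>V) *\<^sub>R (V' - V))"
    using B[of \<mu>'] by (simp only: norm_minus_cancel)
  also have "\<dots> \<le> \<kappa> * (norm c + (1 / \<eta>\<^sub>V) * (norm V' + norm V))"
  proof (intro mult_left_mono order_trans[OF norm_triangle_ineq] add_left_mono)
    show "norm ((1 / \<eta>\<^sub>V) *\<^sub>R (V' - V)) \<le> 1 / \<eta>\<^sub>V * (norm V' + norm V)"
      using steps_pos norm_triangle_ineq4[of V' V] by (simp add: divide_right_mono)
  qed (use kappa_pos in auto)
  finally have "\<kappa> / \<beta> * norm \<mu>' \<le> \<kappa> / \<beta> * (\<kappa> * (norm c + (1 / \<eta>\<^sub>V) * (norm V' + norm V)))"
    using kappa_pos steps_pos by (intro mult_left_mono) auto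
  also have "\<dots> = \<kappa> * \<kappa> * norm c * (1 / \<beta>) + \<kappa>\<^sup>2 / (\<beta> * \<eta>\<^sub>V) * (norm V' + norm V)"
    using steps_pos by (simp add: power2_eq_square field_simps)
  also have "\<kappa> * \<kappa> * norm c * (1 / \<beta>) \<le> C * C * C * C"
    using kappa_pos C_ge steps_pos by (intro mult_mono) auto
  also have "\<dots> = C ^ 4" by (simp add: power4_eq_xxxx)
  finally show ?thesis by simp
qed

text \<open>Writing \<open>u\<close> for the scaled multiplier and \<open>q1\<close> for
  \<open>\<kappa>\<^sup>2 / (\<beta> * \<eta>\<^sub>V)\<close>, at most \<open>1 / 60\<close>, the
  old \<open>u\<close> enters the left-hand side with coefficient at most \<open>1 + 2 * q1\<close>.
  Weighting the multiplier by 2 turns this into a factor close to one half, below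
  \<open>3 / 5\<close>; the old value has coefficient far below that, and the model error about
  \<open>4 + 4 * q1\<close>, below 5.\<close>

lemma contraction:
  "norm V' + 2 * (\<kappa> / \<beta> * norm \<mu>') \<le> 3 / 5 * (norm V + 2 * (\<kappa> / \<beta> * norm \<mu>)) + 5 * C ^ 4 * (1 + e)"
proof -
  define q1 where "q1 = \<kappa>\<^sup>2 / (\<beta> * \<eta>\<^sub>V)"
  define u u' E where "u = \<kappa> / \<beta> * norm \<mu>" "u' = \<kappa> / \<beta> * norm \<mu>'" "E = C ^ 4 * (1 + e)"
  have q1: "0 \<le> q1" "q1 \<le> 1 / 60" using q1_le steps_pos by (simp_all add: q1_def)
  have 1: "norm V' \<le> q1 * norm V + u + 2 * E"
    using value_growth by (simp add: q1_def u_u'_E_def)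
  have "C ^ 4 \<le> E" using C_ge e_nonneg by (simp add: u_u'_E_def)
  then have 2: "u' \<le> E + q1 * (norm V' + norm V)"
    using multiplier_growth by (simp add: q1_def u_u'_E_def)
  have 3: "q1 * norm V \<le> 1 / 60 * norm V" "q1 * (norm V' + norm V) \<le> 1 / 60 * (norm V' + norm V)"
    by (intro mult_right_mono q1(2); simp)+
  have "0 \<le> u" "0 \<le> E" using kappa_pos steps_pos C_ge e_nonneg by (simp_all add: u_u'_E_def)
  moreover have "norm V' \<le> 1 / 60 * norm V + u + 2 * E" using 1 3(1) by simp
  moreover have "u' \<le> E + 1 / 60 * (norm V' + norm V)"
    by (rule order_trans[OF 2 add_left_mono[OF 3(2)]])
  ultimately have "norm V' + 2 * u' \<le> 3 / 5 * (norm V + 2 * u) + 5 * E"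
    using norm_ge_zero[of V] by argo
  then show ?thesis by (simp add: u_u'_E_def)
qed

lemma norm_V'_le: "1 + norm V' \<le> 3 * C ^ 4 * \<theta> * (1 + e)"
proof -
  have C4: "1 \<le> C ^ 4" using C_ge by simp
  have "\<kappa>\<^sup>2 / (\<beta> * \<eta>\<^sub>V) * norm V \<le> 1 * norm V"
    by (intro mult_right_mono order_trans[OF q1_le]) auto
  moreover have "\<kappa> / \<beta> * norm \<mu> \<le> C ^ 4 * norm \<mu>"
  proof (intro mult_right_mono)
    have "\<kappa> * (1 / \<beta>) \<le> C * C" using kappa_pos C_ge steps_pos by (intro mult_mono) auto
    also have "\<dots> \<le> C ^ 4" using C_ge power_increasing[of 2 4 C] by (simp add: power2_eq_square)
    finally show "\<kappa> / \<beta> \<le> C ^ 4" by simp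
  qed simp
  moreover have "1 * norm V \<le> C ^ 4 * norm V" using C4 by (intro mult_right_mono) auto
  ultimately have "1 + norm V' \<le> C ^ 4 * \<theta> + 2 * (C ^ 4 * (1 + e))"
    using value_growth C4 by (simp add: distrib_left)
  also have "C ^ 4 * \<theta> \<le> C ^ 4 * \<theta> * (1 + e)"
    using mult_left_mono[of 1 "1 + e" "C ^ 4 * \<theta>"] e_nonneg C_ge by simp
  also have "C ^ 4 * (1 + e) \<le> C ^ 4 * \<theta> * (1 + e)"
    using C_ge e_nonneg by (intro mult_right_mono) auto
  finally show ?thesis by (simp add: mult_ac)
qed

lemma norm_noise_V: "norm (noise V \<pi>') \<le> C * e * \<theta>" "norm (noise V \<pi>) \<le> C * e * \<theta>"
proof -
  have "norm (noise V p) \<le> C * e * \<theta>" if "p \<in> policies" for p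
    using C_ge e_nonneg by (intro order_trans[OF norm_noise_policy[OF that]] mult_left_mono) auto
  then show "norm (noise V \<pi>') \<le> C * e * \<theta>" "norm (noise V \<pi>) \<le> C * e * \<theta>"
    using pi'_policy pi_policy by auto
qed

text \<open>The intermediate point is the new policy with the old value: the noise is affine in the
  value and linear in the policy, so each leg is a product of model error and one increment.\<close>

lemma norm_noise_diff: "norm (noise V' \<pi>' - noise V \<pi>) \<le> e * dp * \<theta> + C * e * dv"
proof -
  have "noise V' \<pi>' - noise V \<pi>'
      = \<gamma> *\<^sub>R (P_pol (\<lambda>s a s'. Q s a s' - P s a s') \<pi>' *v (V' - V))"
    by (simp add: noise_def bellman_lin_def matrix_vector_mult_diff_distrib scaleR_diff_right)
  then have "norm (noise V' \<pi>' - noise V \<pi>')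
      = \<gamma> * norm (P_pol (\<lambda>s a s'. Q s a s' - P s a s') \<pi>' *v (V' - V))"
    using gamma by simp
  also have "\<dots> \<le> 1 * (e * C * dv)"
    using gamma C_ge
    by (intro mult_mono order_trans[OF norm_P_pol_mult] norm_policy_C pi'_policy)
      (simp_all add: model_error_def kernel_l1_nonneg reward_l1_nonneg)
  finally have 1: "norm (noise V' \<pi>' - noise V \<pi>') \<le> C * e * dv" by (simp add: mult_ac)
  have "noise V \<pi>' - noise V \<pi> = noise V (\<pi>' - \<pi>)"
    unfolding noise_def by (simp add: linear_diff[OF linear_bellman_lin])
  then have "norm (noise V \<pi>' - noise V \<pi>) \<le> e * dp * (1 + norm V)"
    using norm_noise[of V "\<pi>' - \<pi>"] by simp
  also have "\<dots> \<le> e * dp * \<theta>" using e_nonneg by (intro mult_left_mono) auto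
  finally have 2: "norm (noise V \<pi>' - noise V \<pi>) \<le> e * dp * \<theta>" .
  show ?thesis
    using 1 2 norm_triangle_ineq[of "noise V' \<pi>' - noise V \<pi>'" "noise V \<pi>' - noise V \<pi>"] by simp
qed

section \<open>Descent of the true Lagrangian\<close>

lemma Lag_model_diff:
  "LagQ p W \<nu> - Lag p W \<nu> = \<beta> / 2 * (norm (noise W p))\<^sup>2 - (\<nu> + \<beta> *\<^sub>R Res p W) \<bullet> noise W p"
proof -
  have sq: "(norm (Res p W - noise W p))\<^sup>2
      = (norm (Res p W))\<^sup>2 - 2 * (Res p W \<bullet> noise W p) + (norm (noise W p))\<^sup>2"
    using norm_add_power2[of "Res p W" "- noise W p"] by simp
  then show ?thesis
    unfolding smooth_lag_def ResQ_eq sq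
    by (simp add: inner_add_left inner_diff_right algebra_simps)
qed

text \<open>Only the increment of the model error along the step enters, which is why the bias of
  the empirical model plays no role.\<close>

lemma noise_gap:
  "(LagQ \<pi> V \<mu> - Lag \<pi> V \<mu>) - (LagQ \<pi>' V' \<mu>' - Lag \<pi>' V' \<mu>')
     \<le> 6 * C ^ 7 * \<xi> * (dp + dv + dm) + C ^ 3 * \<xi>\<^sup>2"
proof -
  let ?\<Lambda> = "\<mu> + \<beta> *\<^sub>R Res \<pi> V" and ?\<Lambda>' = "\<mu>' + \<beta> *\<^sub>R Res \<pi>' V'"
  have C0: "0 \<le> C" and t1: "1 \<le> \<theta>" using C_ge by auto
  have "norm (\<beta> *\<^sub>R Res \<pi> V) \<le> C * (C * (1 + norm V))"
    using steps_pos C_ge C0 by (auto intro!: mult_mono norm_bellman_res_true pi_policy)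
  also have "\<dots> \<le> C * (C * \<theta>)" using C0 by (intro mult_left_mono) auto
  finally have "norm (\<beta> *\<^sub>R Res \<pi> V) \<le> C\<^sup>2 * \<theta>" by (simp add: power2_eq_square mult.assoc)
  moreover have "norm \<mu> \<le> C\<^sup>2 * \<theta>"
    using mult_mono[of 1 "C\<^sup>2" "norm \<mu>" \<theta>] C_ge by simp
  ultimately have \<Lambda>: "norm ?\<Lambda> \<le> 2 * C\<^sup>2 * \<theta>"
    using norm_triangle_ineq[of \<mu> "\<beta> *\<^sub>R Res \<pi> V"] by linarith
  have "Res \<pi>' V' = Res \<pi> V - bellman_lin \<gamma> P r V (\<pi>' - \<pi>) + M_pol \<gamma> P \<pi>' *v (V' - V)"
    using bellman_res_add_value[of \<gamma> P r \<pi>' V "V' - V"] bellman_res_add_policy[of \<gamma> P r \<pi> "\<pi>' - \<pi>" V] by simp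
  then have "norm (Res \<pi>' V' - Res \<pi> V) \<le> norm (bellman_lin \<gamma> P r V (\<pi>' - \<pi>)) + norm (M_pol \<gamma> P \<pi>' *v (V' - V))"
    using norm_triangle_ineq4[of "M_pol \<gamma> P \<pi>' *v (V' - V)" "bellman_lin \<gamma> P r V (\<pi>' - \<pi>)"] by simp
  also have "\<dots> \<le> C * dp * (1 + norm V) + C * dv"
    by (intro add_mono norm_bellman_lin_true norm_M_pol_mult P_stochastic pi'_policy)
  also have "\<dots> \<le> C * dp * \<theta> + C * dv * \<theta>"
  proof (rule add_mono)
    show "C * dp * (1 + norm V) \<le> C * dp * \<theta>" using C0 by (intro mult_left_mono) auto
    show "C * dv \<le> C * dv * \<theta>" using C0 t1 mult_left_mono[of 1 \<theta> "C * dv"] by simp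
  qed
  finally have R: "norm (Res \<pi>' V' - Res \<pi> V) \<le> C * \<theta> * (dp + dv)" by (simp add: algebra_simps)
  have eq: "?\<Lambda>' - ?\<Lambda> = (\<mu>' - \<mu>) + \<beta> *\<^sub>R (Res \<pi>' V' - Res \<pi> V)" by (simp add: algebra_simps)
  have "norm (?\<Lambda>' - ?\<Lambda>) \<le> dm + \<beta> * norm (Res \<pi>' V' - Res \<pi> V)"
    unfolding eq using norm_triangle_ineq[of "\<mu>' - \<mu>" "\<beta> *\<^sub>R (Res \<pi>' V' - Res \<pi> V)"] steps_pos by simp
  also have "\<dots> \<le> C\<^sup>2 * \<theta> * dm + C * (C * \<theta> * (dp + dv))"
  proof (intro add_mono)
    have "1 * 1 \<le> C\<^sup>2 * \<theta>" using C_ge t1 by (intro mult_mono) auto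
    then show "dm \<le> C\<^sup>2 * \<theta> * dm" using mult_right_mono[of 1 "C\<^sup>2 * \<theta>" dm] by simp
    show "\<beta> * norm (Res \<pi>' V' - Res \<pi> V) \<le> C * (C * \<theta> * (dp + dv))"
      using steps_pos C_ge C0 by (intro mult_mono R) auto
  qed
  finally have \<Lambda>': "norm (?\<Lambda>' - ?\<Lambda>) \<le> C\<^sup>2 * \<theta> * (dp + dv + dm)"
    by (simp add: power2_eq_square algebra_simps)
  have N': "norm (noise V' \<pi>') \<le> C * e * (3 * C ^ 4 * \<theta> * (1 + e))"
    using C0 e_nonneg
    by (intro order_trans[OF norm_noise_policy[OF pi'_policy]] mult_left_mono norm_V'_le) auto
  have "(?\<Lambda>' - ?\<Lambda>) \<bullet> noise V' \<pi>' \<le> (C\<^sup>2 * \<theta> * (dp + dv + dm)) * (C * e * (3 * C ^ 4 * \<theta> * (1 + e)))"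
    using C0 t1 by (intro order_trans[OF norm_cauchy_schwarz] mult_mono \<Lambda>' N') auto
  also have "\<dots> = 3 * C ^ 7 * \<xi> * (dp + dv + dm)"
    by (simp add: power2_eq_square eval_nat_numeral mult_ac)
  finally have 1: "(?\<Lambda>' - ?\<Lambda>) \<bullet> noise V' \<pi>' \<le> 3 * C ^ 7 * \<xi> * (dp + dv + dm)" .
  have "?\<Lambda> \<bullet> (noise V' \<pi>' - noise V \<pi>) \<le> (2 * C\<^sup>2 * \<theta>) * (e * dp * \<theta> + C * e * dv)"
    using C0 t1 by (intro order_trans[OF norm_cauchy_schwarz] mult_mono \<Lambda> norm_noise_diff) auto
  also have "\<dots> \<le> (2 * C\<^sup>2 * \<theta>) * (C * e * \<theta> * dp + C * e * \<theta> * dv)"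
  proof (intro mult_left_mono add_mono)
    show "e * dp * \<theta> \<le> C * e * \<theta> * dp"
      using mult_right_mono[OF C_ge(1), of "e * dp * \<theta>"] e_nonneg by (simp add: mult_ac)
    show "C * e * dv \<le> C * e * \<theta> * dv"
      using mult_left_mono[OF t1, of "C * e * dv"] e_nonneg C0 by (simp add: mult_ac)
  qed (use C0 in auto)
  also have "\<dots> = 2 * C ^ 3 * (e * \<theta>\<^sup>2) * (dp + dv)"
    by (simp add: power2_eq_square eval_nat_numeral algebra_simps)
  also have "\<dots> \<le> 3 * C ^ 7 * \<xi> * (dp + dv + dm)"
  proof (rule mult_mono[OF mult_mono[OF _ e_theta_le(2)]])
    show "2 * C ^ 3 \<le> 3 * C ^ 7" using C_ge by (intro mult_mono power_increasing) auto
  qed (use C0 e_nonneg in auto)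
  finally have 2: "?\<Lambda> \<bullet> (noise V' \<pi>' - noise V \<pi>) \<le> 3 * C ^ 7 * \<xi> * (dp + dv + dm)" .
  have "norm (noise V \<pi>) \<le> C * \<xi>"
    using norm_noise_V(2) mult_left_mono[of "e * \<theta>" \<xi> C] e_theta_le(1,2) C0 by (simp add: mult.assoc)
  then have "\<beta> / 2 * (norm (noise V \<pi>))\<^sup>2 \<le> C * (C * \<xi>)\<^sup>2"
    using C_ge steps_pos by (intro mult_mono power_mono) auto
  also have "\<dots> = C ^ 3 * \<xi>\<^sup>2" by (simp add: power2_eq_square power3_eq_cube mult_ac)
  finally have 3: "\<beta> / 2 * (norm (noise V \<pi>))\<^sup>2 \<le> C ^ 3 * \<xi>\<^sup>2" .
  have 4: "0 \<le> \<beta> / 2 * (norm (noise V' \<pi>'))\<^sup>2" using steps_pos by simp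
  \<comment> \<open>A product rule for the pairing of multiplier and noise: one term carries the
    increment of the first factor, one that of the second. Of the two squares, the one at the new
    point has the favourable sign and is dropped.\<close>
  have "(LagQ \<pi> V \<mu> - Lag \<pi> V \<mu>) - (LagQ \<pi>' V' \<mu>' - Lag \<pi>' V' \<mu>')
     = (?\<Lambda>' - ?\<Lambda>) \<bullet> noise V' \<pi>' + ?\<Lambda> \<bullet> (noise V' \<pi>' - noise V \<pi>)
       + \<beta> / 2 * (norm (noise V \<pi>))\<^sup>2 - \<beta> / 2 * (norm (noise V' \<pi>'))\<^sup>2"
    unfolding Lag_model_diff by (simp add: inner_diff_left inner_diff_right)
  then show ?thesis using 1 2 3 4 by linarith
qed

text \<open>Young's inequality gives each of the three increments the share
  \<open>1 / (12 * C)\<close> and costs \<open>108 * C ^ 15 * \<xi>\<^sup>2\<close> every time; with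
  the quadratic term of \<open>noise_gap\<close> this makes 325.\<close>

lemma true_descent:
  "real_of_ereal (\<phi> \<pi>') + Lag \<pi>' V' \<mu>' \<le> real_of_ereal (\<phi> \<pi>) + Lag \<pi> V \<mu>
     - dp\<^sup>2 / (2 * \<eta>\<^sub>\<pi>) - dv\<^sup>2 / \<eta>\<^sub>V + dm\<^sup>2 / \<beta> + (dp\<^sup>2 + dv\<^sup>2 + dm\<^sup>2) / (12 * C) + 325 * C ^ 15 * \<xi>\<^sup>2"
proof -
  have C0: "0 < C" using C_ge by simp
  have y: "6 * C ^ 7 * \<xi> * y \<le> y\<^sup>2 / (12 * C) + 108 * C ^ 15 * \<xi>\<^sup>2" for y
  proof -
    have "2 * (3 * C ^ 7) * \<xi> * y \<le> 1 / (12 * C) * y\<^sup>2 + (3 * C ^ 7)\<^sup>2 / (1 / (12 * C)) * \<xi>\<^sup>2"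
      by (rule young_ineq) (use C0 in simp)
    also have "(3 * C ^ 7)\<^sup>2 / (1 / (12 * C)) = 108 * C ^ 15"
      by (simp add: power_mult_distrib eval_nat_numeral)
    finally show ?thesis by simp
  qed
  have "C ^ 3 * \<xi>\<^sup>2 \<le> C ^ 15 * \<xi>\<^sup>2" using C_ge by (intro mult_right_mono power_increasing) auto
  moreover have "6 * C ^ 7 * \<xi> * (dp + dv + dm) \<le> (dp\<^sup>2 + dv\<^sup>2 + dm\<^sup>2) / (12 * C) + 3 * (108 * C ^ 15 * \<xi>\<^sup>2)"
    using y[of dp] y[of dv] y[of dm] by (simp add: distrib_left add_divide_distrib)
  ultimately show ?thesis using empirical_descent noise_gap by simp
qed

text \<open>Serves the first step, where no earlier value condition is available to bound the
  multiplier increment. That increment stays on the right, and the correction by the value increment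
  is already in place for the following step.\<close>

lemma initial_descent:
  "real_of_ereal (\<phi> \<pi>') + Lag \<pi>' V' \<mu>' + dv\<^sup>2 / (6 * \<eta>\<^sub>V)
    \<le> real_of_ereal (\<phi> \<pi>) + Lag \<pi> V \<mu> - (dp\<^sup>2 + dv\<^sup>2) / (12 * C) + 2 * C * dm\<^sup>2 + 335 * C ^ 15 * \<xi>\<^sup>2"
proof -
  have C0: "0 < C" "1 / C \<le> C" using C_ge by (auto simp: field_simps intro: order_trans[OF _ mult_mono[of 1 C 1 C]])
  define p1 where "p1 = 1 / \<eta>\<^sub>\<pi> * dp\<^sup>2"
  define p2 where "p2 = 1 / C * dp\<^sup>2"
  define v1 where "v1 = 1 / \<eta>\<^sub>V * dv\<^sup>2"
  define v2 where "v2 = 1 / C * dv\<^sup>2"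
  define m1 where "m1 = 1 / \<beta> * dm\<^sup>2"
  define m2 where "m2 = 1 / C * dm\<^sup>2"
  define m3 where "m3 = C * dm\<^sup>2"
  define X1 where "X1 = 325 * C ^ 15 * \<xi>\<^sup>2"
  define X2 where "X2 = 335 * C ^ 15 * \<xi>\<^sup>2"
  have 1: "p2 \<le> p1" "v2 \<le> v1"
    unfolding p1_def p2_def v1_def v2_def using C_ge steps_pos C0 by (intro mult_right_mono; simp add: field_simps)+
  have 2: "m1 \<le> m3" "m2 \<le> m3"
    unfolding m1_def m2_def m3_def using C_ge C0 by (intro mult_right_mono; simp)+
  have 3: "X1 \<le> X2" unfolding X1_def X2_def using C0 by (intro mult_right_mono) auto
  have 4: "0 \<le> p2" "0 \<le> v2" "0 \<le> m3" unfolding p2_def v2_def m3_def using C0 by auto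
  have 5: "real_of_ereal (\<phi> \<pi>') + Lag \<pi>' V' \<mu>' \<le> real_of_ereal (\<phi> \<pi>) + Lag \<pi> V \<mu>
     - p1 / 2 - v1 + m1 + (p2 + v2 + m2) / 12 + X1"
    using true_descent
    by (simp add: p1_def p2_def v1_def v2_def m1_def m2_def X1_def add_divide_distrib mult.commute)
  have "real_of_ereal (\<phi> \<pi>') + Lag \<pi>' V' \<mu>' + v1 / 6
      \<le> real_of_ereal (\<phi> \<pi>) + Lag \<pi> V \<mu> - (p2 + v2) / 12 + 2 * m3 + X2"
    using 1 2 3 4 5 by argo
  then show ?thesis
    by (simp add: p2_def v1_def v2_def m3_def X2_def add_divide_distrib mult_ac)
qed

section \<open>Multiplier increments, the corrected potential and the companion residual\<close>

lemma companion_multiplier_bound: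
  "norm (\<mu> + \<beta> *\<^sub>R ResQ \<pi>' V) \<le> 3 * C\<^sup>2 * \<theta> * (1 + e)"
proof -
  have C0: "0 \<le> C" and t1: "1 \<le> \<theta>" using C_ge by auto
  have "norm (ResQ \<pi>' V) \<le> norm (Res \<pi>' V) + norm (noise V \<pi>')"
    unfolding ResQ_eq by (rule norm_triangle_ineq4)
  also have "norm (Res \<pi>' V) \<le> C * \<theta>"
    using norm_bellman_res_true[OF pi'_policy, of V] mult_left_mono[of "1 + norm V" \<theta> C] C0 by simp
  finally have "norm (ResQ \<pi>' V) \<le> C * \<theta> * (1 + e)"
    using norm_noise_V(1) by (simp add: algebra_simps)
  then have "norm (\<beta> *\<^sub>R ResQ \<pi>' V) \<le> C * (C * \<theta> * (1 + e))"
    using steps_pos C_ge C0 by (auto intro!: mult_mono)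
  moreover have "norm \<mu> \<le> C\<^sup>2 * \<theta> * (1 + e)"
  proof -
    have "1 * norm \<mu> * 1 \<le> C\<^sup>2 * \<theta> * (1 + e)"
      using C_ge e_nonneg by (intro mult_mono) auto
    then show ?thesis by simp
  qed
  moreover have "0 \<le> C\<^sup>2 * \<theta> * (1 + e)" using e_nonneg by simp
  ultimately show ?thesis
    using norm_triangle_ineq[of \<mu> "\<beta> *\<^sub>R ResQ \<pi>' V"] by (simp add: power2_eq_square mult.assoc)
qed

text \<open>The origin of the margin constants. Squaring the five terms of
  \<open>dual_difference\<close> costs a factor 5 and the prefactor \<open>2 / \<beta>\<close> makes
  it 10; 30 and 60 are what is needed to bring the policy term down to
  \<open>1 / (3 * \<eta>\<^sub>\<pi>)\<close> and the value terms down to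
  \<open>1 / (6 * \<eta>\<^sub>V)\<close>.\<close>

lemma dual_increment:
  assumes Q0: "\<And>s a. prob_vec (Q\<^sub>0 s a)" "spectral_norm (matrix_inv (M_pol \<gamma> Q\<^sub>0 \<pi>)) \<le> \<kappa>"
    and opt: "c + transpose (M_pol \<gamma> Q\<^sub>0 \<pi>) *v \<mu> + (1 / \<eta>\<^sub>V) *\<^sub>R d = 0"
  shows "2 / \<beta> * dm\<^sup>2 \<le> dp\<^sup>2 / (3 * \<eta>\<^sub>\<pi>) + (dv\<^sup>2 + (norm d)\<^sup>2) / (6 * \<eta>\<^sub>V) + 10 * C ^ 9 * (\<xi>\<^sup>2 + (err Q\<^sub>0 q\<^sub>0)\<^sup>2)"
proof -
  have "dm \<le> \<kappa>\<^sup>2 * L * norm c * dp + C ^ 4 * e + C ^ 4 * err Q\<^sub>0 q\<^sub>0 + \<kappa> / \<eta>\<^sub>V * dv + \<kappa> / \<eta>\<^sub>V * norm d"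
    by (rule dual_difference[OF Q_stochastic Q0(1) Q_inverse Q0(2) pi'_policy pi_policy value_gradient opt])
      (rule pi'_policy)
  then have "dm\<^sup>2 \<le> (\<kappa>\<^sup>2 * L * norm c * dp + C ^ 4 * e + C ^ 4 * err Q\<^sub>0 q\<^sub>0 + \<kappa> / \<eta>\<^sub>V * dv + \<kappa> / \<eta>\<^sub>V * norm d)\<^sup>2"
    by (intro power_mono) auto
  also have "\<dots> \<le> 5 * ((\<kappa>\<^sup>2 * L * norm c * dp)\<^sup>2 + (C ^ 4 * e)\<^sup>2 + (C ^ 4 * err Q\<^sub>0 q\<^sub>0)\<^sup>2 + (\<kappa> / \<eta>\<^sub>V * dv)\<^sup>2 + (\<kappa> / \<eta>\<^sub>V * norm d)\<^sup>2)"
    by (rule power2_sum5_le)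
  finally have "2 / \<beta> * dm\<^sup>2 \<le> 2 / \<beta> * (5 * ((\<kappa>\<^sup>2 * L * norm c * dp)\<^sup>2 + (C ^ 4 * e)\<^sup>2 + (C ^ 4 * err Q\<^sub>0 q\<^sub>0)\<^sup>2 + (\<kappa> / \<eta>\<^sub>V * dv)\<^sup>2 + (\<kappa> / \<eta>\<^sub>V * norm d)\<^sup>2))"
    using steps_pos by (intro mult_left_mono) auto
  also have "\<dots> = 10 * \<kappa> ^ 4 * L\<^sup>2 * (norm c)\<^sup>2 / \<beta> * dp\<^sup>2 + 10 * C ^ 8 * (1 / \<beta>) * (e\<^sup>2 + (err Q\<^sub>0 q\<^sub>0)\<^sup>2)
      + 10 * \<kappa>\<^sup>2 / (\<beta> * \<eta>\<^sub>V\<^sup>2) * (dv\<^sup>2 + (norm d)\<^sup>2)"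
    using steps_pos by (simp add: power_mult_distrib power_divide field_simps flip: power_mult)
  also have "\<dots> \<le> 1 / (3 * \<eta>\<^sub>\<pi>) * dp\<^sup>2 + 10 * C ^ 9 * (\<xi>\<^sup>2 + (err Q\<^sub>0 q\<^sub>0)\<^sup>2) + 1 / (6 * \<eta>\<^sub>V) * (dv\<^sup>2 + (norm d)\<^sup>2)"
  proof (intro add_mono mult_right_mono)
    show "10 * \<kappa> ^ 4 * L\<^sup>2 * (norm c)\<^sup>2 / \<beta> \<le> 1 / (3 * \<eta>\<^sub>\<pi>)"
      using beta_pi steps_pos by (simp add: field_simps)
    have "60 * \<kappa>\<^sup>2 \<le> \<beta> * \<eta>\<^sub>V" using beta_V steps_pos by (simp add: field_simps)
    then have "60 * \<kappa>\<^sup>2 * \<eta>\<^sub>V \<le> \<beta> * \<eta>\<^sub>V * \<eta>\<^sub>V" using steps_pos by (intro mult_right_mono) auto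
    then show "10 * \<kappa>\<^sup>2 / (\<beta> * \<eta>\<^sub>V\<^sup>2) \<le> 1 / (6 * \<eta>\<^sub>V)"
      using steps_pos by (simp add: field_simps power2_eq_square)
    have "e\<^sup>2 \<le> \<xi>\<^sup>2" using e_theta_le(3) e_nonneg by (rule power_mono)
    moreover have k: "10 * C ^ 8 * (1 / \<beta>) \<le> 10 * C ^ 9"
      using mult_left_mono[OF C_ge(3), of "10 * C ^ 8"] C_ge by (simp add: eval_nat_numeral mult_ac)
    ultimately show "10 * C ^ 8 * (1 / \<beta>) * (e\<^sup>2 + (err Q\<^sub>0 q\<^sub>0)\<^sup>2) \<le> 10 * C ^ 9 * (\<xi>\<^sup>2 + (err Q\<^sub>0 q\<^sub>0)\<^sup>2)"
      using C_ge by (intro mult_mono[OF k] add_right_mono) auto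
  qed auto
  finally show ?thesis by simp
qed

text \<open>The same estimate without the small factors; it is used to sum multiplier increments,
  where only their order matters.\<close>

lemma dual_increment_C:
  assumes "\<And>s a. prob_vec (Q\<^sub>0 s a)" "spectral_norm (matrix_inv (M_pol \<gamma> Q\<^sub>0 \<pi>)) \<le> \<kappa>"
    and "c + transpose (M_pol \<gamma> Q\<^sub>0 \<pi>) *v \<mu> + (1 / \<eta>\<^sub>V) *\<^sub>R d = 0"
  shows "dm\<^sup>2 \<le> 5 * C ^ 10 * (dp\<^sup>2 + dv\<^sup>2 + (norm d)\<^sup>2 + \<xi>\<^sup>2 + (err Q\<^sub>0 q\<^sub>0)\<^sup>2)"
proof -
  let ?S = "dp\<^sup>2 + dv\<^sup>2 + (norm d)\<^sup>2 + \<xi>\<^sup>2 + (err Q\<^sub>0 q\<^sub>0)\<^sup>2"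
  have C9: "C \<le> C ^ 9" using C_ge by (intro self_le_power) auto
  have "dp\<^sup>2 / (3 * \<eta>\<^sub>\<pi>) \<le> C ^ 9 * dp\<^sup>2"
  proof -
    have "dp\<^sup>2 / (3 * \<eta>\<^sub>\<pi>) \<le> 1 / \<eta>\<^sub>\<pi> * dp\<^sup>2" using steps_pos by (simp add: field_simps)
    also have "\<dots> \<le> C ^ 9 * dp\<^sup>2" using C_ge C9 by (intro mult_right_mono) auto
    finally show ?thesis .
  qed
  moreover have "(dv\<^sup>2 + (norm d)\<^sup>2) / (6 * \<eta>\<^sub>V) \<le> C ^ 9 * (dv\<^sup>2 + (norm d)\<^sup>2)"
  proof -
    have "(dv\<^sup>2 + (norm d)\<^sup>2) / (6 * \<eta>\<^sub>V) \<le> 1 / \<eta>\<^sub>V * (dv\<^sup>2 + (norm d)\<^sup>2)"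
      using steps_pos by (simp add: field_simps)
    also have "\<dots> \<le> C ^ 9 * (dv\<^sup>2 + (norm d)\<^sup>2)" using C_ge C9 by (intro mult_right_mono) auto
    finally show ?thesis .
  qed
  moreover have "0 \<le> C ^ 9 * (dp\<^sup>2 + dv\<^sup>2 + (norm d)\<^sup>2)" using C_ge by simp
  ultimately have A: "2 / \<beta> * dm\<^sup>2 \<le> 10 * C ^ 9 * ?S"
    using dual_increment[OF assms, of q\<^sub>0] unfolding distrib_left mult.assoc by argo
  have "\<beta> * (2 / \<beta> * dm\<^sup>2) \<le> C * (10 * C ^ 9 * ?S)"
    using C_ge steps_pos by (intro mult_mono[of \<beta> C] A) auto
  also have "\<dots> = 10 * C ^ 10 * ?S" by (simp add: eval_nat_numeral mult_ac)
  finally show ?thesis using steps_pos by (simp add: mult.assoc)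
qed

text \<open>The budget: the ascent \<open>1 / \<beta>\<close> and the Young share of the multiplier
  increment together stay below \<open>2 / \<beta>\<close>, which \<open>dual_increment\<close>
  converts. The policy coefficient becomes \<open>- 1 / 2 + 1 / 3 + 1 / 12 = - 1 / 12\<close>. The
  value coefficient has room for the correction \<open>1 / 6\<close> on the left, and the previous
  value increment \<open>d\<close> is charged exactly the correction left by the preceding
  step.\<close>

lemma potential_descent:
  assumes "\<And>s a. prob_vec (Q\<^sub>0 s a)" "spectral_norm (matrix_inv (M_pol \<gamma> Q\<^sub>0 \<pi>)) \<le> \<kappa>"
    and "c + transpose (M_pol \<gamma> Q\<^sub>0 \<pi>) *v \<mu> + (1 / \<eta>\<^sub>V) *\<^sub>R d = 0"
  shows "real_of_ereal (\<phi> \<pi>') + Lag \<pi>' V' \<mu>' + dv\<^sup>2 / (6 * \<eta>\<^sub>V)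
    \<le> real_of_ereal (\<phi> \<pi>) + Lag \<pi> V \<mu> + (norm d)\<^sup>2 / (6 * \<eta>\<^sub>V)
      - (dp\<^sup>2 + dv\<^sup>2) / (12 * C) + 335 * C ^ 15 * (\<xi>\<^sup>2 + (err Q\<^sub>0 q\<^sub>0)\<^sup>2)"
proof -
  have C0: "0 < C" using C_ge by simp
  have b: "1 / (12 * C) * dm\<^sup>2 \<le> 1 / \<beta> * dm\<^sup>2"
    using C_ge steps_pos C0 by (intro mult_right_mono) (auto simp: field_simps)
  have p: "1 / (12 * C) * dp\<^sup>2 \<le> 1 / (12 * \<eta>\<^sub>\<pi>) * dp\<^sup>2" and v: "1 / (12 * C) * dv\<^sup>2 \<le> 1 / (12 * \<eta>\<^sub>V) * dv\<^sup>2"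
    using C_ge steps_pos C0 by (intro mult_right_mono; simp add: field_simps)+
  have "10 * C ^ 9 * (\<xi>\<^sup>2 + (err Q\<^sub>0 q\<^sub>0)\<^sup>2) \<le> 10 * C ^ 15 * (\<xi>\<^sup>2 + (err Q\<^sub>0 q\<^sub>0)\<^sup>2)"
    using C_ge by (intro mult_right_mono mult_left_mono power_increasing) auto
  moreover have "325 * C ^ 15 * \<xi>\<^sup>2 \<le> 325 * C ^ 15 * (\<xi>\<^sup>2 + (err Q\<^sub>0 q\<^sub>0)\<^sup>2)"
    using C0 by (intro mult_left_mono) auto
  ultimately have x: "325 * C ^ 15 * \<xi>\<^sup>2 + 10 * C ^ 9 * (\<xi>\<^sup>2 + (err Q\<^sub>0 q\<^sub>0)\<^sup>2) \<le> 335 * C ^ 15 * (\<xi>\<^sup>2 + (err Q\<^sub>0 q\<^sub>0)\<^sup>2)"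
    by linarith
  define a1 where "a1 = 1 / \<eta>\<^sub>\<pi> * dp\<^sup>2"
  define a2 where "a2 = 1 / \<eta>\<^sub>V * dv\<^sup>2"
  define a3 where "a3 = 1 / \<eta>\<^sub>V * (norm d)\<^sup>2"
  define a4 where "a4 = 1 / C * dp\<^sup>2"
  define a5 where "a5 = 1 / C * dv\<^sup>2"
  define a6 where "a6 = 1 / \<beta> * dm\<^sup>2"
  define a7 where "a7 = 1 / C * dm\<^sup>2"
  define X9 where "X9 = 10 * C ^ 9 * (\<xi>\<^sup>2 + (err Q\<^sub>0 q\<^sub>0)\<^sup>2)"
  define X where "X = 335 * C ^ 15 * (\<xi>\<^sup>2 + (err Q\<^sub>0 q\<^sub>0)\<^sup>2)"
  define X0 where "X0 = 325 * C ^ 15 * \<xi>\<^sup>2"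
  have x': "X0 + X9 \<le> X" using x by (simp only: X9_def X0_def X_def)
  have 1: "2 * a6 \<le> a1 / 3 + (a2 + a3) / 6 + X9"
    using dual_increment[OF assms, of q\<^sub>0] by (simp add: a1_def a2_def a3_def a6_def X9_def add_divide_distrib)
  have 2: "real_of_ereal (\<phi> \<pi>') + Lag \<pi>' V' \<mu>' \<le> real_of_ereal (\<phi> \<pi>) + Lag \<pi> V \<mu>
     - a1 / 2 - a2 + a6 + (a4 + a5 + a7) / 12 + X0"
    using true_descent by (simp add: X0_def a1_def a2_def a4_def a5_def a6_def a7_def add_divide_distrib mult.commute)
  have 3: "a7 / 12 \<le> a6" "a4 / 12 \<le> a1 / 12" "a5 / 12 \<le> a2 / 12"
    using b p v by (simp_all add: a1_def a2_def a4_def a5_def a6_def a7_def)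
  have 4: "0 \<le> a1" "0 \<le> a2" using steps_pos by (simp_all add: a1_def a2_def)
  have "real_of_ereal (\<phi> \<pi>') + Lag \<pi>' V' \<mu>' + a2 / 6
    \<le> real_of_ereal (\<phi> \<pi>) + Lag \<pi> V \<mu> + a3 / 6 - (a4 + a5) / 12 + X"
    using 1 2 3 4 x' by argo
  then show ?thesis
    by (simp add: X_def a2_def a3_def a4_def a5_def add_divide_distrib mult.commute)
qed

text \<open>Each of the three parts vanishes for the empirical model up to increments, because it is
  the optimality condition of one update; replacing the empirical by the true model then costs a
  multiple of \<xi>.\<close>

lemma companion_residual_bound:
  "kkt_residual \<phi> c \<gamma> P r \<pi>' V (\<mu> + \<beta> *\<^sub>R ResQ \<pi>' V)
     \<le> ennreal (108 * C ^ 6 * (dp\<^sup>2 + dv\<^sup>2 + dm\<^sup>2 + \<xi>\<^sup>2))"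
proof -
  define m where "m = \<mu> + \<beta> *\<^sub>R ResQ \<pi>' V"
  let ?Z = "3 * C ^ 3 * (dp + dv + dm + \<xi>)"
  have C0: "0 \<le> C" and t1: "1 \<le> \<theta>" using C_ge by auto
  have C13: "C \<le> C ^ 3" "C\<^sup>2 \<le> C ^ 3" "1 \<le> C ^ 3"
    using C_ge by (auto intro!: self_le_power power_increasing)
  have x0: "0 \<le> \<xi>" using e_nonneg by simp
  have m: "norm m \<le> 3 * C\<^sup>2 * \<theta> * (1 + e)"
    unfolding m_def by (rule companion_multiplier_bound)
  have em: "e * norm m \<le> 3 * C\<^sup>2 * \<xi>"
  proof -
    have "e * norm m \<le> e * (3 * C\<^sup>2 * \<theta> * (1 + e))" by (intro mult_left_mono m e_nonneg)
    also have "\<dots> = 3 * C\<^sup>2 * (e * (1 + e) * \<theta>)" by (simp add: mult_ac)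
    also have "\<dots> \<le> 3 * C\<^sup>2 * \<xi>" by (intro mult_left_mono e_theta_le(4)) simp
    finally show ?thesis .
  qed
  \<comment> \<open>Stationarity of the policy subproblem. The policy derivative of the residual is
    the negative of \<open>bellman_lin\<close>, which explains the sign of the first term.\<close>
  let ?g = "adjoint (bellman_lin \<gamma> Q q V) m - (1 / \<eta>\<^sub>\<pi>) *\<^sub>R (\<pi>' - \<pi>)"
  have "?g \<in> limiting_subdiff (psi \<phi>) \<pi>'"
  proof (rule proximal_subgradient)
    have psi': "psi \<phi> \<pi>' = \<phi> \<pi>'" using pi'_policy by (simp add: psi_def)
    show "\<bar>psi \<phi> \<pi>'\<bar> \<noteq> \<infinity>" using phi_pi'_finite psi' by simp
    \<comment> \<open>The curvature of the penalty plus that of the proximal term. It may depend on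
      the iterate, since a quadratic term of any size disappears from the subdifferential.\<close>
    let ?K = "\<beta> / 2 * ((kernel_l1 Q + reward_l1 q) * (1 + norm V))\<^sup>2 + 1 / (2 * \<eta>\<^sub>\<pi>)"
    show "0 \<le> ?K" using steps_pos by simp
    fix y
    show "psi \<phi> \<pi>' + ereal (?g \<bullet> (y - \<pi>') - ?K * (norm (y - \<pi>'))\<^sup>2) \<le> psi \<phi> y"
    proof (cases "y \<in> policies")
      case False
      then show ?thesis by (simp add: psi_def)
    next
      case True
      obtain f where f: "\<phi> \<pi>' = ereal f" using phi_pi'_finite by auto
      let ?\<delta> = "y - \<pi>'"
      have 1: "LagQ y V \<mu> = LagQ \<pi>' V \<mu> - m \<bullet> bellman_lin \<gamma> Q q V ?\<delta>
          + \<beta> / 2 * (norm (bellman_lin \<gamma> Q q V ?\<delta>))\<^sup>2"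
        using smooth_lag_add_policy[of c \<gamma> \<beta> Q q \<pi>' ?\<delta> V \<mu>] by (simp add: m_def)
      have 2: "m \<bullet> bellman_lin \<gamma> Q q V ?\<delta> = adjoint (bellman_lin \<gamma> Q q V) m \<bullet> ?\<delta>"
        using adjoint_works[OF linear_bellman_lin, of ?\<delta> \<gamma> Q q V m] by (simp add: inner_commute)
      have 3: "\<beta> / 2 * (norm (bellman_lin \<gamma> Q q V ?\<delta>))\<^sup>2
          \<le> \<beta> / 2 * ((kernel_l1 Q + reward_l1 q) * norm ?\<delta> * (1 + norm V))\<^sup>2"
        using gamma steps_pos by (intro mult_left_mono power_mono norm_bellman_lin) auto
      have "(norm (y - \<pi>))\<^sup>2 = (norm (\<pi>' - \<pi>))\<^sup>2 + 2 * ((\<pi>' - \<pi>) \<bullet> ?\<delta>) + (norm ?\<delta>)\<^sup>2"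
        using norm_add_power2[of "\<pi>' - \<pi>" ?\<delta>] by simp
      then have 4: "1 / (2 * \<eta>\<^sub>\<pi>) * (norm (y - \<pi>))\<^sup>2 = 1 / (2 * \<eta>\<^sub>\<pi>) * (norm (\<pi>' - \<pi>))\<^sup>2
          + 1 / \<eta>\<^sub>\<pi> * ((\<pi>' - \<pi>) \<bullet> ?\<delta>) + 1 / (2 * \<eta>\<^sub>\<pi>) * (norm ?\<delta>)\<^sup>2"
        by (simp add: add_divide_distrib)
      have 5: "?g \<bullet> ?\<delta> = adjoint (bellman_lin \<gamma> Q q V) m \<bullet> ?\<delta> - 1 / \<eta>\<^sub>\<pi> * ((\<pi>' - \<pi>) \<bullet> ?\<delta>)"
        by (simp only: inner_diff_left[of _ "(1 / \<eta>\<^sub>\<pi>) *\<^sub>R (\<pi>' - \<pi>)"] inner_scaleR_left)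
      have "((kernel_l1 Q + reward_l1 q) * norm ?\<delta> * (1 + norm V))\<^sup>2
          = ((kernel_l1 Q + reward_l1 q) * (1 + norm V))\<^sup>2 * (norm ?\<delta>)\<^sup>2"
        by (simp add: power_mult_distrib)
      then have 6: "?K * (norm ?\<delta>)\<^sup>2 = \<beta> / 2 * ((kernel_l1 Q + reward_l1 q) * norm ?\<delta> * (1 + norm V))\<^sup>2
          + 1 / (2 * \<eta>\<^sub>\<pi>) * (norm ?\<delta>)\<^sup>2"
        by (simp only: distrib_right[of _ _ "(norm ?\<delta>)\<^sup>2"] mult.assoc)
      have "LagQ y V \<mu> + 1 / (2 * \<eta>\<^sub>\<pi>) * (norm (y - \<pi>))\<^sup>2
          \<le> LagQ \<pi>' V \<mu> + 1 / (2 * \<eta>\<^sub>\<pi>) * (norm (\<pi>' - \<pi>))\<^sup>2 - (?g \<bullet> ?\<delta> - ?K * (norm ?\<delta>)\<^sup>2)"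
        using 3 unfolding 1 2 4 5 6 by argo
      then show ?thesis
        using policy_step_mono[OF True] True f psi' by (cases "\<phi> y") (auto simp: psi_def)
    qed
  qed
  then have d: "edist0 ((\<lambda>v. v + adjoint (J_pol \<gamma> P r \<pi>' V) m) ` limiting_subdiff (psi \<phi>) \<pi>')
      \<le> ennreal (norm (?g + adjoint (J_pol \<gamma> P r \<pi>' V) m))"
    by (intro edist0_le imageI)
  let ?h = "?g + adjoint (J_pol \<gamma> P r \<pi>' V) m"
  let ?w = "adjoint (bellman_lin \<gamma> Q q V) m + adjoint (J_pol \<gamma> P r \<pi>' V) m"
  \<comment> \<open>The vector \<open>?w\<close> is the adjoint of the noise map applied to
    \<open>m\<close>. Pairing it with itself moves the adjoint to the other side, so the bound for
    the noise map itself suffices.\<close>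
  have "(norm ?w)\<^sup>2 = ?w \<bullet> adjoint (bellman_lin \<gamma> Q q V) m + ?w \<bullet> adjoint (J_pol \<gamma> P r \<pi>' V) m"
    by (simp only: power2_norm_eq_inner inner_add_right)
  also have "\<dots> = bellman_lin \<gamma> Q q V ?w \<bullet> m - bellman_lin \<gamma> P r V ?w \<bullet> m"
    unfolding J_pol_eq
    by (subst (1 2) adjoint_works) (auto intro: linear_bellman_lin linear_compose_neg)
  also have "\<dots> = noise V ?w \<bullet> m"
    by (simp only: noise_def bellman_lin_diff_model[symmetric] inner_diff_left)
  also have "\<dots> \<le> norm (noise V ?w) * norm m" by (rule norm_cauchy_schwarz)
  also have "\<dots> \<le> (e * norm ?w * (1 + norm V)) * norm m" by (intro mult_right_mono norm_noise) simp
  finally have "norm ?w * norm ?w \<le> (e * norm m * (1 + norm V)) * norm ?w"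
    by (simp add: power2_eq_square mult_ac)
  then have "norm ?w \<le> e * norm m * (1 + norm V)"
    using e_nonneg by (cases "norm ?w = 0") (auto simp: mult_le_cancel_right)
  also have "\<dots> \<le> e * (3 * C\<^sup>2 * \<theta> * (1 + e)) * \<theta>"
    using e_nonneg C0 by (intro mult_mono m order_refl) auto
  also have "\<dots> = 3 * C\<^sup>2 * \<xi>" by (simp add: power2_eq_square mult_ac)
  also have "\<dots> \<le> 3 * C ^ 3 * \<xi>" using x0 C13 by (intro mult_right_mono) auto
  finally have w: "norm ?w \<le> 3 * C ^ 3 * \<xi>" .
  have h: "?h = ?w - (1 / \<eta>\<^sub>\<pi>) *\<^sub>R (\<pi>' - \<pi>)" by simp
  have "norm ?h \<le> norm ?w + 1 / \<eta>\<^sub>\<pi> * dp"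
    unfolding h using norm_triangle_ineq4[of ?w "(1 / \<eta>\<^sub>\<pi>) *\<^sub>R (\<pi>' - \<pi>)"] steps_pos by simp
  also have "1 / \<eta>\<^sub>\<pi> * dp \<le> 3 * C ^ 3 * dp"
    using C_ge C13 by (intro mult_right_mono) auto
  finally have "norm ?h \<le> 3 * C ^ 3 * \<xi> + 3 * C ^ 3 * dp" using w by simp
  also have "\<dots> \<le> ?Z" using C0 by (simp add: algebra_simps)
  finally have Z1: "norm ?h \<le> ?Z" .

  \<comment> \<open>The companion multiplier differs from the updated one only through the value
    increment, so that \<open>value_gradient\<close> applies to it up to that increment.\<close>
  have "m = \<mu>' - \<beta> *\<^sub>R (MQ *v (V' - V))"
    using bellman_res_add_value[of \<gamma> Q q \<pi>' V "V' - V"] by (simp add: m_def multiplier_step scaleR_add_right)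
  then have "c + transpose MQ *v m = (c + transpose MQ *v \<mu>' + (1 / \<eta>\<^sub>V) *\<^sub>R (V' - V))
      - (1 / \<eta>\<^sub>V) *\<^sub>R (V' - V) - \<beta> *\<^sub>R (transpose MQ *v (MQ *v (V' - V)))"
    by (simp add: matrix_vector_mult_diff_distrib matrix_vector_mult_scaleR del: transpose_matrix_vector)
  then have cm: "c + transpose MQ *v m = - ((1 / \<eta>\<^sub>V) *\<^sub>R (V' - V)) - \<beta> *\<^sub>R (transpose MQ *v (MQ *v (V' - V)))"
    unfolding value_gradient by simp
  have "c + transpose (M_pol \<gamma> P \<pi>') *v m
      = (- ((1 / \<eta>\<^sub>V) *\<^sub>R (V' - V)) - \<beta> *\<^sub>R (transpose MQ *v (MQ *v (V' - V)))) - transpose (MQ - M_pol \<gamma> P \<pi>') *v m"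
    unfolding cm[symmetric] transpose_diff matrix_vector_mult_diff_rdistrib by simp
  also have "norm \<dots> \<le> norm ((1 / \<eta>\<^sub>V) *\<^sub>R (V' - V)) + norm (\<beta> *\<^sub>R (transpose MQ *v (MQ *v (V' - V))))
      + norm (transpose (MQ - M_pol \<gamma> P \<pi>') *v m)"
    by (intro order_trans[OF norm_triangle_ineq4] add_right_mono)
      (simp only: norm_minus_cancel order_refl)
  also have "\<dots> \<le> C * dv + C * (C * (C * dv)) + C * e * norm m"
  proof (intro add_mono)
    show "norm ((1 / \<eta>\<^sub>V) *\<^sub>R (V' - V)) \<le> C * dv"
      using steps_pos mult_right_mono[OF C_ge(5), of dv] by simp
    have "norm (transpose MQ *v (MQ *v (V' - V))) \<le> C * norm (MQ *v (V' - V))"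
      by (intro norm_transpose_mult_le norm_M_pol_mult Q_stochastic pi'_policy)
    also have "\<dots> \<le> C * (C * dv)"
      by (intro mult_left_mono norm_M_pol_mult Q_stochastic pi'_policy C0)
    finally have "\<beta> * norm (transpose MQ *v (MQ *v (V' - V))) \<le> C * (C * (C * dv))"
      using C0 C_ge steps_pos by (intro mult_mono) auto
    then show "norm (\<beta> *\<^sub>R (transpose MQ *v (MQ *v (V' - V)))) \<le> C * (C * (C * dv))"
      using steps_pos by (simp del: transpose_matrix_vector)
    show "norm (transpose (MQ - M_pol \<gamma> P \<pi>') *v m) \<le> C * e * norm m"
      by (intro norm_transpose_mult_le norm_M_pol_model_diff pi'_policy)
  qed
  also have "\<dots> \<le> C ^ 3 * dv + C ^ 3 * dv + 3 * C ^ 3 * \<xi>"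
  proof (intro add_mono)
    show "C * dv \<le> C ^ 3 * dv" by (intro mult_right_mono C13) simp
    show "C * (C * (C * dv)) \<le> C ^ 3 * dv" by (simp add: power3_eq_cube)
    show "C * e * norm m \<le> 3 * C ^ 3 * \<xi>"
      using mult_left_mono[OF em C0] by (simp add: eval_nat_numeral mult_ac)
  qed
  also have "\<dots> \<le> ?Z"
  proof -
    have "0 \<le> C ^ 3 * dv" "0 \<le> C ^ 3 * dp" "0 \<le> C ^ 3 * dm" using C0 by auto
    then show ?thesis unfolding distrib_left mult.assoc by linarith
  qed
  finally have Z2: "norm (c + transpose (M_pol \<gamma> P \<pi>') *v m) \<le> ?Z" .

  \<comment> \<open>The dual update says that the empirical residual at the new value is the
    multiplier increment divided by \<beta>; going back to the old value and to the true model adds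
    the other two terms.\<close>
  have "Res \<pi>' V = (1 / \<beta>) *\<^sub>R (\<mu>' - \<mu>) - MQ *v (V' - V) + noise V \<pi>'"
    using bellman_res_add_value[of \<gamma> Q q \<pi>' V "V' - V"] steps_pos ResQ_eq[of \<pi>' V] by (simp add: multiplier_step)
  then have "norm (Res \<pi>' V) \<le> norm ((1 / \<beta>) *\<^sub>R (\<mu>' - \<mu>)) + norm (MQ *v (V' - V)) + norm (noise V \<pi>')"
    by (simp only:) (intro order_trans[OF norm_triangle_ineq] add_right_mono norm_triangle_ineq4)
  also have "\<dots> \<le> C * dm + C * dv + C * \<xi>"
  proof (intro add_mono)
    show "norm ((1 / \<beta>) *\<^sub>R (\<mu>' - \<mu>)) \<le> C * dm"
      using steps_pos mult_right_mono[OF C_ge(3), of dm] by simp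
    show "norm (MQ *v (V' - V)) \<le> C * dv"
      by (intro norm_M_pol_mult Q_stochastic pi'_policy)
    have "C * (e * \<theta>) \<le> C * \<xi>" using e_theta_le(1,2) C0 by (intro mult_left_mono) linarith+
    then show "norm (noise V \<pi>') \<le> C * \<xi>" using norm_noise_V(1) by (simp add: mult.assoc)
  qed
  also have "\<dots> \<le> C ^ 3 * (dm + dv + \<xi>)"
    using mult_right_mono[OF C13(1), of "dm + dv + \<xi>"] x0 by (simp add: distrib_left)
  also have "\<dots> \<le> (3 * C ^ 3) * (dp + dv + dm + \<xi>)"
    using C0 x0 by (intro mult_mono) auto
  finally have Z3: "norm (Res \<pi>' V) \<le> ?Z" .

  have "kkt_residual \<phi> c \<gamma> P r \<pi>' V m \<le> (ennreal ?Z)\<^sup>2 + ennreal (?Z\<^sup>2) + ennreal (?Z\<^sup>2)"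
    unfolding kkt_residual_def
    using d Z1 Z2 Z3
    by (intro add_mono power_mono ennreal_leI) (auto intro: order_trans ennreal_leI simp del: transpose_matrix_vector)
  also have "\<dots> = ennreal (3 * ?Z\<^sup>2)"
    using C0 x0 by (subst ennreal_power) (auto simp flip: ennreal_plus)
  also have "\<dots> \<le> ennreal (108 * C ^ 6 * (dp\<^sup>2 + dv\<^sup>2 + dm\<^sup>2 + \<xi>\<^sup>2))"
  proof (intro ennreal_leI)
    have "3 * ?Z\<^sup>2 = 27 * C ^ 6 * (dp + dv + dm + \<xi>)\<^sup>2"
      by (simp add: power_mult_distrib flip: power_mult)
    also have "\<dots> \<le> 27 * C ^ 6 * (4 * (dp\<^sup>2 + dv\<^sup>2 + dm\<^sup>2 + \<xi>\<^sup>2))"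
      using C0 by (intro mult_left_mono power2_sum4_le) auto
    finally show "3 * ?Z\<^sup>2 \<le> 108 * C ^ 6 * (dp\<^sup>2 + dv\<^sup>2 + dm\<^sup>2 + \<xi>\<^sup>2)" by (simp only: mult_ac)
  qed
  finally show ?thesis unfolding m_def .
qed

end

section \<open>Empirical means at visited pairs\<close>

text \<open>Says that the conditional expectation of \<open>f\<close> given \<open>F\<close> is at
  most \<open>K\<close>, in a form that avoids conditional expectations of unbounded functions.
  Events of \<open>F\<close> are enough to check; simple functions and monotone limits give all
  weights.\<close>

lemma nn_integral_weight_le:
  fixes f :: "'w \<Rightarrow> ennreal"
  assumes sub: "subalgebra M F" and f: "f \<in> borel_measurable M"
    and le: "\<And>A. A \<in> sets F \<Longrightarrow> (\<integral>\<^sup>+x. indicator A x * f x \<partial>M) \<le> K * emeasure M A"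
    and w: "w \<in> borel_measurable F"
  shows "(\<integral>\<^sup>+x. w x * f x \<partial>M) \<le> K * (\<integral>\<^sup>+x. w x \<partial>M)"
  using w
proof (induction rule: borel_measurable_induct)
  have meas: "h \<in> borel_measurable M" if "h \<in> borel_measurable F" for h :: "'w \<Rightarrow> ennreal"
    using measurable_from_subalg[OF sub that] .
  note f [measurable]
  have space: "space F = space M" using sub by (simp add: subalgebra_def)
  {
    case (cong g h)
    have eq: "g x = h x" if "x \<in> space M" for x using cong(3) that space by simp
    have "(\<integral>\<^sup>+x. g x * f x \<partial>M) = (\<integral>\<^sup>+x. h x * f x \<partial>M)" "(\<integral>\<^sup>+x. g x \<partial>M) = (\<integral>\<^sup>+x. h x \<partial>M)"
      by (intro nn_integral_cong; simp add: eq)+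
    with cong(4) show ?case by (simp only:)
  next
    case (set A)
    then have "A \<in> sets M" using sub by (auto simp: subalgebra_def)
    with le[OF set] show ?case by simp
  next
    case (mult u a)
    have [measurable]: "u \<in> borel_measurable M" by (rule meas) (rule mult)
    have "(\<integral>\<^sup>+x. a * u x * f x \<partial>M) = a * (\<integral>\<^sup>+x. u x * f x \<partial>M)"
      unfolding mult.assoc by (rule nn_integral_cmult) measurable
    also have "\<dots> \<le> a * (K * (\<integral>\<^sup>+x. u x \<partial>M))" by (intro mult_left_mono mult) auto
    also have "\<dots> = K * (\<integral>\<^sup>+x. a * u x \<partial>M)"
      by (subst nn_integral_cmult) (simp_all add: mult_ac)
    finally show ?case .
  next
    case (add u v)
    have [measurable]: "u \<in> borel_measurable M" "v \<in> borel_measurable M" by (rule meas, rule add)+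
    have "(\<integral>\<^sup>+x. (v x + u x) * f x \<partial>M) = (\<integral>\<^sup>+x. v x * f x \<partial>M) + (\<integral>\<^sup>+x. u x * f x \<partial>M)"
      unfolding distrib_right by (rule nn_integral_add) measurable
    also have "\<dots> \<le> K * (\<integral>\<^sup>+x. v x \<partial>M) + K * (\<integral>\<^sup>+x. u x \<partial>M)" by (intro add_mono add)
    also have "\<dots> = K * (\<integral>\<^sup>+x. v x + u x \<partial>M)"
      by (subst nn_integral_add) (simp_all add: distrib_left)
    finally show ?case .
  next
    case (seq U)
    have [measurable]: "U i \<in> borel_measurable M" for i by (rule meas) (rule seq)
    have "(\<integral>\<^sup>+x. (SUP i. U i) x * f x \<partial>M) = (\<integral>\<^sup>+x. (SUP i. U i x * f x) \<partial>M)"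
      by (simp add: SUP_mult_right_ennreal image_comp)
    also have "\<dots> = (SUP i. \<integral>\<^sup>+x. U i x * f x \<partial>M)"
    proof (rule nn_integral_monotone_convergence_SUP)
      show "incseq (\<lambda>i x. U i x * f x)"
        using seq by (auto simp: incseq_def le_fun_def intro!: mult_right_mono)
    qed measurable
    also have "\<dots> \<le> K * (\<integral>\<^sup>+x. (SUP i. U i) x \<partial>M)"
    proof (rule SUP_least)
      fix i
      have "(\<integral>\<^sup>+x. U i x * f x \<partial>M) \<le> K * (\<integral>\<^sup>+x. U i x \<partial>M)" by (rule seq)
      also have "\<dots> \<le> K * (\<integral>\<^sup>+x. (SUP i. U i) x \<partial>M)"
        by (intro mult_left_mono nn_integral_mono) (auto simp: image_comp intro: SUP_upper)
      finally show "(\<integral>\<^sup>+x. U i x * f x \<partial>M) \<le> K * (\<integral>\<^sup>+x. (SUP i. U i) x \<partial>M)" .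
    qed
    finally show ?case .
  }
qed

section \<open>Inequalities for fourth powers\<close>

lemma abs_mult_le_power4:
  fixes a b :: real
  shows "\<bar>a ^ 3 * b\<bar> \<le> a ^ 4 + b ^ 4" "\<bar>a\<^sup>2 * b\<^sup>2\<bar> \<le> a ^ 4 + b ^ 4" "\<bar>a * b ^ 3\<bar> \<le> a ^ 4 + b ^ 4"
proof -
  define x y where "x = \<bar>a\<bar>" "y = \<bar>b\<bar>"
  define z where "z = max x y"
  have z: "0 \<le> x" "0 \<le> y" "x \<le> z" "y \<le> z" "0 \<le> z" by (auto simp: x_y_def z_def)
  have z4: "z ^ 4 \<le> x ^ 4 + y ^ 4" by (cases "x \<le> y") (simp_all add: z_def max_def)
  have "x ^ 3 * y \<le> z ^ 3 * z" "x\<^sup>2 * y\<^sup>2 \<le> z\<^sup>2 * z\<^sup>2" "x * y ^ 3 \<le> z * z ^ 3"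
    using z by (intro mult_mono power_mono; simp)+
  moreover have "z ^ 3 * z = z ^ 4" "z\<^sup>2 * z\<^sup>2 = z ^ 4" "z * z ^ 3 = z ^ 4"
    by (simp_all add: eval_nat_numeral)
  ultimately have "x ^ 3 * y \<le> z ^ 4" "x\<^sup>2 * y\<^sup>2 \<le> z ^ 4" "x * y ^ 3 \<le> z ^ 4"
    by simp_all
  then have "x ^ 3 * y \<le> x ^ 4 + y ^ 4" "x\<^sup>2 * y\<^sup>2 \<le> x ^ 4 + y ^ 4" "x * y ^ 3 \<le> x ^ 4 + y ^ 4"
    using z4 by linarith+
  then show "\<bar>a ^ 3 * b\<bar> \<le> a ^ 4 + b ^ 4" "\<bar>a\<^sup>2 * b\<^sup>2\<bar> \<le> a ^ 4 + b ^ 4" "\<bar>a * b ^ 3\<bar> \<le> a ^ 4 + b ^ 4"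
    by (simp_all add: x_y_def abs_mult power_abs)
qed

lemma power2_le_1_power4: "(a::real)\<^sup>2 \<le> 1 + a ^ 4"
proof -
  have "0 \<le> (a\<^sup>2 - 1)\<^sup>2" by simp
  also have "(a\<^sup>2 - 1)\<^sup>2 = a ^ 4 - 2 * a\<^sup>2 + 1" by (simp add: power2_eq_square power4_eq_xxxx algebra_simps)
  finally show ?thesis using zero_le_power2[of a] by linarith
qed

text \<open>Cauchy-Schwarz twice.\<close>

lemma power4_sum_le:
  fixes f :: "'i \<Rightarrow> real"
  shows "(sum f A) ^ 4 \<le> real (card A) ^ 3 * (\<Sum>i\<in>A. f i ^ 4)"
proof -
  have "((sum f A)\<^sup>2)\<^sup>2 \<le> ((\<Sum>i\<in>A. (f i)\<^sup>2) * real (card A))\<^sup>2"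
    by (intro power_mono sum_squared_le_sum_of_squares) simp
  also have "\<dots> = (\<Sum>i\<in>A. (f i)\<^sup>2)\<^sup>2 * (real (card A))\<^sup>2" by (rule power_mult_distrib)
  also have "\<dots> \<le> ((\<Sum>i\<in>A. ((f i)\<^sup>2)\<^sup>2) * real (card A)) * (real (card A))\<^sup>2"
    by (intro mult_right_mono sum_squared_le_sum_of_squares) simp
  finally show ?thesis by (simp add: eval_nat_numeral mult_ac)
qed

text \<open>The events \<open>I t\<close> are the visits of a state-action pair and \<open>\<eta> t\<close> the centred
  observations made at them.  Since a visit is guaranteed a conditional probability only
  one step ahead, the number of visits is controlled along blocks of two steps.\<close>

locale visited_mean = prob_space M for M :: "'w measure" +
  fixes F G :: "nat \<Rightarrow> 'w measure" and I :: "nat \<Rightarrow> 'w set" and \<eta> :: "nat \<Rightarrow> 'w \<Rightarrow> real"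
    and m :: nat and p B :: real
  assumes subalg_F: "\<And>t. subalgebra M (F t)" and subalg_G: "\<And>t. subalgebra M (G t)"
    and F_G: "\<And>t. t < m \<Longrightarrow> sets (F t) \<subseteq> sets (G t)"
    and G_F: "\<And>t. t < m \<Longrightarrow> sets (G t) \<subseteq> sets (F (Suc t))"
    and I_meas: "\<And>t. t < m \<Longrightarrow> I t \<in> sets (G t)"
    and eta_meas: "\<And>t. t < m \<Longrightarrow> \<eta> t \<in> borel_measurable (F (Suc t))"
    and eta_centred: "\<And>t h. t < m \<Longrightarrow> h \<in> borel_measurable (G t) \<Longrightarrow> integrable M h \<Longrightarrow>
          integrable M (\<lambda>x. h x * \<eta> t x) \<Longrightarrow> (\<integral>x. h x * \<eta> t x \<partial>M) = 0"
    and eta_fourth: "\<And>t h. t < m \<Longrightarrow> h \<in> borel_measurable (G t) \<Longrightarrow>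
          (\<integral>\<^sup>+x. h x * ennreal (\<eta> t x ^ 4) \<partial>M) \<le> ennreal B * (\<integral>\<^sup>+x. h x \<partial>M)"
    and eta_outside: "\<And>t x. t < m \<Longrightarrow> x \<notin> I t \<Longrightarrow> \<eta> t x = 0"
    and visit_prob: "\<And>t A. Suc t < m \<Longrightarrow> A \<in> sets (F t) \<Longrightarrow> p * prob A \<le> prob (A \<inter> I (Suc t))"
    and p: "0 < p" "p \<le> 1" and B: "0 \<le> B"
begin

section \<open>Filtration and conditional moments of one observation\<close>

lemma F_mono: "s \<le> t \<Longrightarrow> t \<le> m \<Longrightarrow> sets (F s) \<subseteq> sets (F t)"
proof (induction t rule: dec_induct)
  case (step t)
  then show ?case using F_G[of t] G_F[of t] by auto
qed simp

lemma space_F: "space (F t) = space M" and space_G: "space (G t) = space M"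
  using subalg_F subalg_G by (auto simp: subalgebra_def)

lemma measurable_F_mono: "f \<in> borel_measurable (F s) \<Longrightarrow> s \<le> t \<Longrightarrow> t \<le> m \<Longrightarrow> f \<in> borel_measurable (F t)"
  using F_mono[of s t] by (auto simp: measurable_def space_F)

lemma measurable_F_G: "f \<in> borel_measurable (F t) \<Longrightarrow> t < m \<Longrightarrow> f \<in> borel_measurable (G t)"
  using F_G[of t] by (auto simp: measurable_def space_F space_G)

lemma measurable_F_M: "f \<in> borel_measurable (F t) \<Longrightarrow> f \<in> borel_measurable M"
  by (rule measurable_from_subalg[OF subalg_F])

lemma measurable_G_M: "f \<in> borel_measurable (G t) \<Longrightarrow> f \<in> borel_measurable M"
  by (rule measurable_from_subalg[OF subalg_G])

lemma eta_measurable_M: "t < m \<Longrightarrow> \<eta> t \<in> borel_measurable M"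
  using eta_meas measurable_F_M by blast

lemma integral_eta_power4:
  assumes t: "t < m" and h: "h \<in> borel_measurable (G t)" "\<And>x. 0 \<le> h x" "integrable M h"
  shows "integrable M (\<lambda>x. h x * \<eta> t x ^ 4)" "(\<integral>x. h x * \<eta> t x ^ 4 \<partial>M) \<le> B * (\<integral>x. h x \<partial>M)"
proof -
  note [measurable] = eta_measurable_M[OF t] measurable_G_M[OF h(1)]
  have hG: "(\<lambda>x. ennreal (h x)) \<in> borel_measurable (G t)" using h(1) by measurable
  have "(\<integral>\<^sup>+x. ennreal (h x * \<eta> t x ^ 4) \<partial>M) = (\<integral>\<^sup>+x. ennreal (h x) * ennreal (\<eta> t x ^ 4) \<partial>M)"
    using h(2) by (intro nn_integral_cong) (auto simp: ennreal_mult)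
  also have "\<dots> \<le> ennreal B * (\<integral>\<^sup>+x. ennreal (h x) \<partial>M)" by (rule eta_fourth[OF t hG])
  also have "\<dots> = ennreal (B * (\<integral>x. h x \<partial>M))"
    using h B by (subst nn_integral_eq_integral) (auto simp: ennreal_mult)
  finally have le: "(\<integral>\<^sup>+x. ennreal (h x * \<eta> t x ^ 4) \<partial>M) \<le> ennreal (B * (\<integral>x. h x \<partial>M))" .
  show int: "integrable M (\<lambda>x. h x * \<eta> t x ^ 4)"
    using le h(2) by (intro integrableI_nonneg) (auto simp: top_unique ennreal_less_top[THEN le_less_trans[rotated]] zero_le_even_power intro: le_less_trans[OF le])
  have "0 \<le> B * (\<integral>x. h x \<partial>M)" using h B by (intro mult_nonneg_nonneg integral_nonneg) auto
  moreover have "(\<integral>\<^sup>+x. ennreal (h x * \<eta> t x ^ 4) \<partial>M) = ennreal (\<integral>x. h x * \<eta> t x ^ 4 \<partial>M)"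
    using h(2) by (intro nn_integral_eq_integral int) (auto simp: zero_le_even_power)
  ultimately show "(\<integral>x. h x * \<eta> t x ^ 4 \<partial>M) \<le> B * (\<integral>x. h x \<partial>M)" using le by simp
qed

text \<open>The second moment is read off from the fourth through
  \<open>a\<^sup>2 \<le> 1 + a ^ 4\<close>, which keeps the bound linear in
  \<open>B\<close>.\<close>

lemma integral_eta_power2:
  assumes t: "t < m" and h: "h \<in> borel_measurable (G t)" "\<And>x. 0 \<le> h x" "integrable M h"
  shows "integrable M (\<lambda>x. h x * (\<eta> t x)\<^sup>2)" "(\<integral>x. h x * (\<eta> t x)\<^sup>2 \<partial>M) \<le> (1 + B) * (\<integral>x. h x \<partial>M)"
proof -
  note [measurable] = eta_measurable_M[OF t] measurable_G_M[OF h(1)]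
  note i4 = integral_eta_power4[OF assms]
  have le: "h x * (\<eta> t x)\<^sup>2 \<le> h x + h x * \<eta> t x ^ 4" for x
    using mult_left_mono[OF power2_le_1_power4[of "\<eta> t x"] h(2)[of x]] by (simp add: distrib_left)
  have iadd: "integrable M (\<lambda>x. h x + h x * \<eta> t x ^ 4)" using h(3) i4(1) by (rule Bochner_Integration.integrable_add)
  show int: "integrable M (\<lambda>x. h x * (\<eta> t x)\<^sup>2)"
    by (rule Bochner_Integration.integrable_bound[OF iadd]) (use le h(2) in \<open>auto simp: zero_le_even_power intro!: AE_I2\<close>)
  have "(\<integral>x. h x * (\<eta> t x)\<^sup>2 \<partial>M) \<le> (\<integral>x. h x + h x * \<eta> t x ^ 4 \<partial>M)"
    by (rule integral_mono[OF int iadd le])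
  also have "\<dots> = (\<integral>x. h x \<partial>M) + (\<integral>x. h x * \<eta> t x ^ 4 \<partial>M)"
    by (rule Bochner_Integration.integral_add[OF h(3) i4(1)])
  finally show "(\<integral>x. h x * (\<eta> t x)\<^sup>2 \<partial>M) \<le> (1 + B) * (\<integral>x. h x \<partial>M)"
    using i4(2) by (simp add: distrib_right)
qed

section \<open>Fourth moment of the martingale of observations\<close>

definition S :: "nat \<Rightarrow> 'w \<Rightarrow> real" where
  "S n x = (\<Sum>t<n. \<eta> t x)"

lemma S_Suc: "S (Suc n) x = S n x + \<eta> n x"
  by (simp add: S_def)

lemma S_meas: "n \<le> m \<Longrightarrow> S n \<in> borel_measurable (F n)"
  unfolding S_def
  by (intro borel_measurable_sum) (auto intro: measurable_F_mono[OF eta_meas])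

lemma S_meas_M [measurable]: "n \<le> m \<Longrightarrow> S n \<in> borel_measurable M"
  using S_meas measurable_F_M by blast

lemma integrable_of_power4:
  fixes f :: "'w \<Rightarrow> real"
  assumes [measurable]: "f \<in> borel_measurable M" and "integrable M (\<lambda>x. f x ^ 4)" "k \<le> 4"
  shows "integrable M (\<lambda>x. f x ^ k)"
proof (rule Bochner_Integration.integrable_bound)
  show "integrable M (\<lambda>x. 1 + f x ^ 4)" using assms(2) by simp
  have "\<bar>a\<bar> ^ k \<le> 1 + a ^ 4" for a :: real
  proof (cases "\<bar>a\<bar> \<le> 1")
    case True
    then have "\<bar>a\<bar> ^ k \<le> 1" by (intro power_le_one) auto
    moreover have "0 \<le> a ^ 4" by (simp add: zero_le_even_power)
    ultimately show ?thesis by linarith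
  next
    case False
    then have "\<bar>a\<bar> ^ k \<le> \<bar>a\<bar> ^ 4" using assms(3) by (intro power_increasing) auto
    then show ?thesis by simp
  qed
  then show "AE x in M. norm (f x ^ k) \<le> norm (1 + f x ^ 4)"
    by (auto simp: power_abs zero_le_even_power)
qed (use assms in measurable)

lemma integrable_S4: "n \<le> m \<Longrightarrow> integrable M (\<lambda>x. S n x ^ 4)"
proof -
  assume n: "n \<le> m"
  note [measurable] = S_meas_M[OF n]
  have "integrable M (\<lambda>x. real (card {..<n}) ^ 3 * (\<Sum>t<n. \<eta> t x ^ 4))"
  proof (intro integrable_mult_right Bochner_Integration.integrable_sum)
    fix t assume "t \<in> {..<n}"
    then have "t < m" using n by simp
    then have "integrable M (\<lambda>x. 1 * \<eta> t x ^ 4)" by (rule integral_eta_power4) auto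
    then show "integrable M (\<lambda>x. \<eta> t x ^ 4)" by simp
  qed
  then show ?thesis
  proof (rule Bochner_Integration.integrable_bound)
    show "AE x in M. norm (S n x ^ 4) \<le> norm (real (card {..<n}) ^ 3 * (\<Sum>t<n. \<eta> t x ^ 4))"
      using power4_sum_le[of "\<lambda>t. \<eta> t _" "{..<n}"]
      by (intro AE_I2) (auto simp: S_def intro!: order_trans[OF _ abs_ge_self])
  qed measurable
qed

text \<open>Orthogonality of increments: the cross term vanishes by centring. The event
  \<open>A\<close> is carried along so that the estimate holds conditionally on the information
  before the batch.\<close>

lemma integral_S2:
  assumes A: "A \<in> sets (F 0)" and "n \<le> m"
  shows "(\<integral>x. indicator A x * (S n x)\<^sup>2 \<partial>M) \<le> real n * (1 + B) * prob A"
  using assms(2)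
proof (induction n)
  case 0
  then show ?case by (simp add: S_def)
next
  case (Suc n)
  then have n: "n < m" "n \<le> m" by auto
  have AG: "A \<in> sets (G n)" using A F_mono[of 0 n] F_G[of n] n by auto
  then have AM: "A \<in> sets M" using subalg_G by (auto simp: subalgebra_def)
  note [measurable] = eta_measurable_M[OF n(1)] S_meas_M[OF n(2)] AM
  have SG: "S n \<in> borel_measurable (G n)" using S_meas measurable_F_G n by blast
  have hG: "(\<lambda>x. indicator A x * S n x) \<in> borel_measurable (G n)" using AG SG by measurable
  have i2: "integrable M (\<lambda>x. (S n x)\<^sup>2)" "integrable M (S n)"
    using integrable_of_power4[OF _ integrable_S4[OF n(2)], of 2] integrable_of_power4[OF _ integrable_S4[OF n(2)], of 1] by auto
  have ie: "integrable M (\<lambda>x. 1 * (\<eta> n x)\<^sup>2)" by (rule integral_eta_power2[OF n(1)]) auto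
  have iA: "integrable M (\<lambda>x. indicator A x * f x)" if "integrable M f" for f :: "'w \<Rightarrow> real"
    using integrable_real_mult_indicator[OF AM that] by (simp add: mult.commute)
  have ip: "integrable M (\<lambda>x. indicator A x * S n x * \<eta> n x)"
  proof (rule Bochner_Integration.integrable_bound)
    show "integrable M (\<lambda>x. (S n x)\<^sup>2 + 1 * (\<eta> n x)\<^sup>2)" by (intro Bochner_Integration.integrable_add i2 ie)
    have "\<bar>a * b\<bar> \<le> a\<^sup>2 + b\<^sup>2" for a b :: real
    proof -
      have "2 * \<bar>a\<bar> * \<bar>b\<bar> \<le> \<bar>a\<bar>\<^sup>2 + \<bar>b\<bar>\<^sup>2" by (rule sum_squares_bound)
      moreover have "0 \<le> \<bar>a\<bar> * \<bar>b\<bar>" by simp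
      ultimately show ?thesis unfolding abs_mult power2_abs by linarith
    qed
    then show "AE x in M. norm (indicator A x * S n x * \<eta> n x) \<le> norm ((S n x)\<^sup>2 + 1 * (\<eta> n x)\<^sup>2)"
      by (auto simp: indicator_def intro!: AE_I2)
  qed measurable
  have "(\<integral>x. indicator A x * (S (Suc n) x)\<^sup>2 \<partial>M)
      = (\<integral>x. indicator A x * (S n x)\<^sup>2 + 2 * (indicator A x * S n x * \<eta> n x) + indicator A x * (\<eta> n x)\<^sup>2 \<partial>M)"
    by (intro Bochner_Integration.integral_cong) (auto simp: S_Suc power2_eq_square algebra_simps)
  also have "\<dots> = (\<integral>x. indicator A x * (S n x)\<^sup>2 \<partial>M) + 2 * (\<integral>x. indicator A x * S n x * \<eta> n x \<partial>M)
      + (\<integral>x. indicator A x * (\<eta> n x)\<^sup>2 \<partial>M)"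
    using iA[OF i2(1)] ip iA[OF ie] by simp
  also have "(\<integral>x. indicator A x * S n x * \<eta> n x \<partial>M) = 0"
    by (rule eta_centred[OF n(1) hG iA[OF i2(2)] ip])
  also have "(\<integral>x. indicator A x * (\<eta> n x)\<^sup>2 \<partial>M) \<le> (1 + B) * (\<integral>x. indicator A x \<partial>M)"
    by (rule integral_eta_power2[OF n(1)]) (use AG AM in \<open>auto intro: integrable_real_indicator simp: less_top[symmetric]\<close>)
  finally show ?case using Suc.IH[OF n(2)] AM by (simp add: algebra_simps)
qed

text \<open>Induction on the number of steps. The cubic cross term vanishes by centring, and the
  mixed term is integrated over the new observation and then bounded by the second moment, which is
  linear in \<open>n\<close>; its sum gives the growth of order \<open>n\<^sup>2\<close>.\<close>

lemma integral_S4: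
  assumes A: "A \<in> sets (F 0)" and "n \<le> m"
  shows "(\<integral>x. indicator A x * S n x ^ 4 \<partial>M) \<le> 8 * (1 + B)\<^sup>2 * (real n)\<^sup>2 * prob A"
  using assms(2)
proof (induction n)
  case 0
  then show ?case by (simp add: S_def)
next
  case (Suc n)
  then have n: "n < m" "n \<le> m" by auto
  have AG: "A \<in> sets (G n)" using A F_mono[of 0 n] F_G[of n] n by auto
  then have AM: "A \<in> sets M" using subalg_G by (auto simp: subalgebra_def)
  note [measurable] = eta_measurable_M[OF n(1)] S_meas_M[OF n(2)] AM
  have SG: "S n \<in> borel_measurable (G n)" using S_meas measurable_F_G n by blast
  have iA: "integrable M (\<lambda>x. indicator A x * f x)" if "integrable M f" for f :: "'w \<Rightarrow> real"
    using integrable_real_mult_indicator[OF AM that] by (simp add: mult.commute)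
  have hG: "(\<lambda>x. indicator A x * S n x ^ 3) \<in> borel_measurable (G n)"
    "(\<lambda>x. indicator A x * (S n x)\<^sup>2) \<in> borel_measurable (G n)" using AG SG by measurable
  note i4 = integrable_S4[OF n(2)]
  have i3: "integrable M (\<lambda>x. S n x ^ 3)" "integrable M (\<lambda>x. (S n x)\<^sup>2)"
    using integrable_of_power4[OF _ i4, of 3] integrable_of_power4[OF _ i4, of 2] by auto
  have ie: "integrable M (\<lambda>x. 1 * \<eta> n x ^ 4)" by (rule integral_eta_power4[OF n(1)]) auto
  have ip: "integrable M (\<lambda>x. indicator A x * S n x ^ 3 * \<eta> n x)"
  proof (rule Bochner_Integration.integrable_bound)
    show "integrable M (\<lambda>x. S n x ^ 4 + 1 * \<eta> n x ^ 4)" by (intro Bochner_Integration.integrable_add i4 ie)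
    show "AE x in M. norm (indicator A x * S n x ^ 3 * \<eta> n x) \<le> norm (S n x ^ 4 + 1 * \<eta> n x ^ 4)"
      using abs_mult_le_power4(1) by (auto simp: indicator_def intro!: AE_I2)
  qed measurable
  note e2 = integral_eta_power2[OF n(1) hG(2) _ iA[OF i3(2)]]
  have iL: "integrable M (\<lambda>x. indicator A x * S (Suc n) x ^ 4)" by (rule iA[OF integrable_S4[OF Suc.prems]])
  have "(\<integral>x. indicator A x * S (Suc n) x ^ 4 \<partial>M)
      \<le> (\<integral>x. indicator A x * S n x ^ 4 + 4 * (indicator A x * S n x ^ 3 * \<eta> n x)
          + 8 * (indicator A x * (S n x)\<^sup>2 * (\<eta> n x)\<^sup>2) + 3 * (indicator A x * (1 * \<eta> n x ^ 4)) \<partial>M)"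
  proof (rule integral_mono[OF iL])
    show "integrable M (\<lambda>x. indicator A x * S n x ^ 4 + 4 * (indicator A x * S n x ^ 3 * \<eta> n x)
          + 8 * (indicator A x * (S n x)\<^sup>2 * (\<eta> n x)\<^sup>2) + 3 * (indicator A x * (1 * \<eta> n x ^ 4)))"
      using iA[OF i4] ip e2(1) iA[OF ie]
      by (intro Bochner_Integration.integrable_add integrable_mult_right) auto
    \<comment> \<open>The term \<open>4 * a * b ^ 3\<close>, whose sign is unknown, is absorbed by
      \<open>2 * b\<^sup>2 * (a - b)\<^sup>2 \<ge> 0\<close>; this turns the coefficients 6 and 1
      into 8 and 3.\<close>
    have "(a + b) ^ 4 \<le> a ^ 4 + 4 * (a ^ 3 * b) + 8 * (a\<^sup>2 * b\<^sup>2) + 3 * b ^ 4" for a b :: real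
    proof -
      have "0 \<le> 2 * b\<^sup>2 * (a - b)\<^sup>2" by simp
      then show ?thesis by (simp add: eval_nat_numeral algebra_simps)
    qed
    then show "indicator A x * S (Suc n) x ^ 4 \<le> indicator A x * S n x ^ 4 + 4 * (indicator A x * S n x ^ 3 * \<eta> n x)
          + 8 * (indicator A x * (S n x)\<^sup>2 * (\<eta> n x)\<^sup>2) + 3 * (indicator A x * (1 * \<eta> n x ^ 4))" for x
      by (simp add: indicator_def S_Suc)
  qed
  also have "\<dots> = (\<integral>x. indicator A x * S n x ^ 4 \<partial>M) + 4 * (\<integral>x. indicator A x * S n x ^ 3 * \<eta> n x \<partial>M)
      + 8 * (\<integral>x. indicator A x * (S n x)\<^sup>2 * (\<eta> n x)\<^sup>2 \<partial>M) + 3 * (\<integral>x. indicator A x * (1 * \<eta> n x ^ 4) \<partial>M)"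
    using iA[OF i4] ip e2(1) iA[OF ie] by simp
  also have "(\<integral>x. indicator A x * S n x ^ 3 * \<eta> n x \<partial>M) = 0"
    by (rule eta_centred[OF n(1) hG(1) iA[OF i3(1)] ip])
  also have "(\<integral>x. indicator A x * (S n x)\<^sup>2 * (\<eta> n x)\<^sup>2 \<partial>M) \<le> (1 + B) * (\<integral>x. indicator A x * (S n x)\<^sup>2 \<partial>M)"
    by (rule e2) simp
  also have "(\<integral>x. indicator A x * (S n x)\<^sup>2 \<partial>M) \<le> real n * (1 + B) * prob A"
    by (rule integral_S2[OF A n(2)])
  also have "(\<integral>x. indicator A x * (1 * \<eta> n x ^ 4) \<partial>M) \<le> B * (\<integral>x. indicator A x \<partial>M)"
    unfolding mult_1
    by (rule integral_eta_power4[OF n(1)]) (use AG AM in \<open>auto intro: integrable_real_indicator simp: less_top[symmetric]\<close>)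
  finally have "(\<integral>x. indicator A x * S (Suc n) x ^ 4 \<partial>M)
      \<le> 8 * (1 + B)\<^sup>2 * (real n)\<^sup>2 * prob A + 8 * ((1 + B) * (real n * (1 + B) * prob A)) + 3 * (B * prob A)"
    using Suc.IH[OF n(2)] AM B by (simp add: mult_left_mono)
  also have "\<dots> \<le> 8 * (1 + B)\<^sup>2 * (real (Suc n))\<^sup>2 * prob A"
  proof -
    have "3 * B \<le> 8 * (1 + B)\<^sup>2" using B by (simp add: power2_eq_square algebra_simps)
    then have "3 * B * prob A \<le> 8 * (1 + B)\<^sup>2 * prob A" by (intro mult_right_mono) auto
    moreover have "0 \<le> 8 * (1 + B)\<^sup>2 * real n * prob A" by simp
    ultimately show ?thesis by (simp add: power2_eq_square algebra_simps)
  qed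
  finally show ?case .
qed

lemma weighted_S4:
  assumes w: "w \<in> borel_measurable (F 0)"
  shows "(\<integral>\<^sup>+x. w x * ennreal (S m x ^ 4) \<partial>M) \<le> ennreal (8 * (1 + B)\<^sup>2 * (real m)\<^sup>2) * (\<integral>\<^sup>+x. w x \<partial>M)"
proof (rule nn_integral_weight_le[OF subalg_F _ _ w])
  note [measurable] = S_meas_M[OF order_refl]
  show "(\<lambda>x. ennreal (S m x ^ 4)) \<in> borel_measurable M" by measurable
  fix A assume A: "A \<in> sets (F 0)"
  then have AM [measurable]: "A \<in> sets M" using subalg_F by (auto simp: subalgebra_def)
  have "(\<integral>\<^sup>+x. indicator A x * ennreal (S m x ^ 4) \<partial>M) = (\<integral>\<^sup>+x. ennreal (indicator A x * S m x ^ 4) \<partial>M)"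
    by (intro nn_integral_cong) (auto simp: indicator_def)
  also have "\<dots> = ennreal (\<integral>x. indicator A x * S m x ^ 4 \<partial>M)"
    using integrable_real_mult_indicator[OF AM integrable_S4[OF order_refl]]
    by (intro nn_integral_eq_integral) (auto simp: mult.commute zero_le_even_power)
  also have "\<dots> \<le> ennreal (8 * (1 + B)\<^sup>2 * (real m)\<^sup>2 * prob A)"
    by (intro ennreal_leI integral_S4 A order_refl)
  also have "\<dots> = ennreal (8 * (1 + B)\<^sup>2 * (real m)\<^sup>2) * emeasure M A"
    by (simp add: ennreal_mult emeasure_eq_measure)
  finally show "(\<integral>\<^sup>+x. indicator A x * ennreal (S m x ^ 4) \<partial>M) \<le> ennreal (8 * (1 + B)\<^sup>2 * (real m)\<^sup>2) * emeasure M A" .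
qed

section \<open>Exponential weights for the number of visits\<close>

definition half :: "nat \<Rightarrow> 'w \<Rightarrow> ennreal" where
  "half t x = ennreal (if x \<in> I t then 1 / 2 else 1)"

text \<open>Over the whole batch this is 2 to the power of minus the number of visits, the quantity
  of a Chernoff bound for few visits. The product form allows factors to be integrated out one by
  one.\<close>

definition halves :: "nat \<Rightarrow> nat \<Rightarrow> 'w \<Rightarrow> ennreal" where
  "halves s t x = (\<Prod>j\<in>{s..<t}. half j x)"

text \<open>If a visit has conditional probability at least \<open>p\<close>, then a factor that is
  one half on visits and one elsewhere has conditional mean at most
  \<open>1 - p / 2\<close>.\<close>

definition \<theta> :: real where "\<theta> = 1 - p / 2"

lemma theta: "0 < \<theta>" "\<theta> < 1"
  using p by (auto simp: \<theta>_def)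

lemma half_le_1: "half t x \<le> 1"
  by (auto simp: half_def intro!: ennreal_le_1[THEN iffD2])

lemma halves_le_1: "halves s t x \<le> 1"
  unfolding halves_def by (intro prod_le_1) (simp add: half_le_1)

lemma half_meas_G: "t < m \<Longrightarrow> half t \<in> borel_measurable (G t)"
  unfolding half_def using I_meas[of t] by measurable

lemma half_meas_F: "t < m \<Longrightarrow> half t \<in> borel_measurable (F (Suc t))"
  using half_meas_G[of t] G_F[of t] by (auto simp: measurable_def space_F space_G)

lemma half_meas_M: "t < m \<Longrightarrow> half t \<in> borel_measurable M"
  by (rule measurable_G_M[OF half_meas_G])

lemma halves_meas: "t \<le> m \<Longrightarrow> halves s t \<in> borel_measurable (F t)"
  unfolding halves_def
  by (intro borel_measurable_prod_ennreal) (auto intro: measurable_F_mono[OF half_meas_F])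

lemma halves_split: "s \<le> t \<Longrightarrow> t \<le> u \<Longrightarrow> halves s u x = halves s t x * halves t u x"
  unfolding halves_def by (rule prod.atLeastLessThan_concat[symmetric])

lemma visit_halves:
  assumes t: "Suc t < m" and w: "w \<in> borel_measurable (F t)"
  shows "(\<integral>\<^sup>+x. w x * half (Suc t) x \<partial>M) \<le> ennreal \<theta> * (\<integral>\<^sup>+x. w x \<partial>M)"
proof (rule nn_integral_weight_le[OF subalg_F _ _ w])
  show "half (Suc t) \<in> borel_measurable M" by (rule half_meas_M[OF t])
  fix A assume A: "A \<in> sets (F t)"
  then have AM: "A \<in> sets M" using subalg_F by (auto simp: subalgebra_def)
  have IM: "I (Suc t) \<in> sets M" using I_meas[OF t] subalg_G by (auto simp: subalgebra_def)
  have iA: "integrable M (\<lambda>x. indicator A x :: real)" "integrable M (\<lambda>x. indicator (A \<inter> I (Suc t)) x :: real)"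
    using AM IM by (auto intro!: integrable_real_indicator simp: less_top[symmetric])
  have "(\<integral>\<^sup>+x. indicator A x * half (Suc t) x \<partial>M)
      = (\<integral>\<^sup>+x. ennreal (indicator A x - 1 / 2 * indicator (A \<inter> I (Suc t)) x) \<partial>M)"
    by (intro nn_integral_cong) (auto simp: half_def indicator_def)
  also have "\<dots> = ennreal (\<integral>x. indicator A x - 1 / 2 * indicator (A \<inter> I (Suc t)) x \<partial>M)"
    using iA by (intro nn_integral_eq_integral) (auto simp: indicator_def)
  also have "(\<integral>x. indicator A x - 1 / 2 * indicator (A \<inter> I (Suc t)) x \<partial>M) = prob A - 1 / 2 * prob (A \<inter> I (Suc t))"
    using iA AM IM by (subst Bochner_Integration.integral_diff) auto
  also have "\<dots> \<le> \<theta> * prob A"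
    using visit_prob[OF t A] by (simp add: \<theta>_def algebra_simps)
  finally show "(\<integral>\<^sup>+x. indicator A x * half (Suc t) x \<partial>M) \<le> ennreal \<theta> * emeasure M A"
    using theta by (simp add: ennreal_mult emeasure_eq_measure ennreal_leI)
qed

text \<open>The first factor of a block of two steps is bounded by one; the second is integrated out
  given the information at the beginning of the block, which gains one factor \<theta> per
  block.\<close>

lemma peel_blocks:
  assumes "t + 2 * n \<le> m" and w: "w \<in> borel_measurable (F t)"
  shows "(\<integral>\<^sup>+x. w x * halves t (t + 2 * n) x \<partial>M) \<le> ennreal (\<theta> ^ n) * (\<integral>\<^sup>+x. w x \<partial>M)"
  using assms(1)
proof (induction n)
  case 0
  then show ?case by (simp add: halves_def)
next
  case (Suc n)
  let ?u = "t + 2 * n"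
  have u: "?u \<le> m" "Suc ?u < m" using Suc.prems by auto
  have wu: "(\<lambda>x. w x * halves t ?u x) \<in> borel_measurable (F ?u)"
    using measurable_F_mono[OF w, of ?u] halves_meas[OF u(1)] u by (intro borel_measurable_times_ennreal) auto
  have "halves t (t + 2 * Suc n) x = halves t ?u x * half ?u x * half (Suc ?u) x" for x
    by (simp add: halves_def)
  then have "(\<integral>\<^sup>+x. w x * halves t (t + 2 * Suc n) x \<partial>M)
      \<le> (\<integral>\<^sup>+x. (w x * halves t ?u x) * half (Suc ?u) x \<partial>M)"
    using mult_right_mono[OF mult_left_mono[OF half_le_1[of ?u]]]
    by (intro nn_integral_mono) (simp add: mult.assoc mult_left_mono mult_right_le_one_le half_le_1 mult_le_one)
  also have "\<dots> \<le> ennreal \<theta> * (\<integral>\<^sup>+x. w x * halves t ?u x \<partial>M)"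
    by (rule visit_halves[OF u(2) wu])
  also have "\<dots> \<le> ennreal \<theta> * (ennreal (\<theta> ^ n) * (\<integral>\<^sup>+x. w x \<partial>M))"
    by (intro mult_left_mono Suc.IH u(1)) simp
  also have "\<dots> = ennreal (\<theta> ^ Suc n) * (\<integral>\<^sup>+x. w x \<partial>M)"
    using theta by (simp add: ennreal_mult mult.assoc)
  finally show ?case .
qed

lemma peel:
  assumes "s \<le> t" "t \<le> m" and w: "w \<in> borel_measurable (F s)"
  shows "(\<integral>\<^sup>+x. w x * halves s t x \<partial>M) \<le> ennreal (\<theta> ^ ((t - s) div 2)) * (\<integral>\<^sup>+x. w x \<partial>M)"
proof -
  let ?u = "s + 2 * ((t - s) div 2)"
  have u: "s \<le> ?u" "?u \<le> t" using assms(1) by auto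
  have "(\<integral>\<^sup>+x. w x * halves s t x \<partial>M) \<le> (\<integral>\<^sup>+x. w x * halves s ?u x \<partial>M)"
  proof (intro nn_integral_mono mult_left_mono)
    fix x
    show "halves s t x \<le> halves s ?u x"
      using halves_split[OF u, of x] mult_left_mono[OF halves_le_1[of ?u t x], of "halves s ?u x"] by simp
  qed simp
  also have "\<dots> \<le> ennreal (\<theta> ^ ((t - s) div 2)) * (\<integral>\<^sup>+x. w x \<partial>M)"
    using u assms by (intro peel_blocks w) simp
  finally show ?thesis .
qed

text \<open>The factor of the observation at step \<open>t\<close> is integrated out between the later and
  the earlier visits.\<close>

lemma eta_halves:
  assumes t: "t < m" and w: "w \<in> borel_measurable (F 0)"
  shows "(\<integral>\<^sup>+x. w x * halves 0 m x * ennreal (\<eta> t x ^ 4) \<partial>M)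
    \<le> ennreal (\<theta> ^ (m div 2 - 1) * B) * (\<integral>\<^sup>+x. w x \<partial>M)"
proof -
  have wt: "w \<in> borel_measurable (F t)" "w \<in> borel_measurable (F (Suc t))" using measurable_F_mono[OF w] t by auto
  have ht: "halves 0 t \<in> borel_measurable (F t)" "halves 0 t \<in> borel_measurable (F (Suc t))"
    using halves_meas[of t 0] measurable_F_mono[of _ t "Suc t"] t by auto
  note [measurable] = wt ht eta_meas[OF t]
  have "(\<integral>\<^sup>+x. w x * halves 0 m x * ennreal (\<eta> t x ^ 4) \<partial>M)
      \<le> (\<integral>\<^sup>+x. (w x * halves 0 t x * ennreal (\<eta> t x ^ 4)) * halves (Suc t) m x \<partial>M)"
  proof (intro nn_integral_mono)
    fix x
    have "halves 0 m x = halves 0 t x * (halves t (Suc t) x * halves (Suc t) m x)"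
      using halves_split[of 0 t m x] halves_split[of t "Suc t" m x] t by simp
    also have "\<dots> \<le> halves 0 t x * (1 * halves (Suc t) m x)"
      by (intro mult_left_mono mult_right_mono halves_le_1) auto
    finally have "w x * halves 0 m x * ennreal (\<eta> t x ^ 4)
        \<le> w x * (halves 0 t x * (1 * halves (Suc t) m x)) * ennreal (\<eta> t x ^ 4)"
      by (intro mult_left_mono mult_right_mono) auto
    then show "w x * halves 0 m x * ennreal (\<eta> t x ^ 4)
        \<le> (w x * halves 0 t x * ennreal (\<eta> t x ^ 4)) * halves (Suc t) m x"
      by (simp add: mult_ac)
  qed
  also have "\<dots> \<le> ennreal (\<theta> ^ ((m - Suc t) div 2)) * (\<integral>\<^sup>+x. w x * halves 0 t x * ennreal (\<eta> t x ^ 4) \<partial>M)"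
    using t by (intro peel) auto
  also have "(\<integral>\<^sup>+x. w x * halves 0 t x * ennreal (\<eta> t x ^ 4) \<partial>M) \<le> ennreal B * (\<integral>\<^sup>+x. w x * halves 0 t x \<partial>M)"
    by (intro eta_fourth[OF t] measurable_F_G[OF _ t]) measurable
  also have "(\<integral>\<^sup>+x. w x * halves 0 t x \<partial>M) \<le> ennreal (\<theta> ^ ((t - 0) div 2)) * (\<integral>\<^sup>+x. w x \<partial>M)"
    using t by (intro peel w) auto
  finally have "(\<integral>\<^sup>+x. w x * halves 0 m x * ennreal (\<eta> t x ^ 4) \<partial>M)
      \<le> ennreal (\<theta> ^ ((m - Suc t) div 2)) * (ennreal B * (ennreal (\<theta> ^ ((t - 0) div 2)) * (\<integral>\<^sup>+x. w x \<partial>M)))"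
    by (simp add: mult_left_mono)
  also have "\<dots> = ennreal (\<theta> ^ ((m - Suc t) div 2 + t div 2) * B) * (\<integral>\<^sup>+x. w x \<partial>M)"
    using theta B by (simp add: ennreal_mult power_add mult_ac)
  also have "\<dots> \<le> ennreal (\<theta> ^ (m div 2 - 1) * B) * (\<integral>\<^sup>+x. w x \<partial>M)"
  proof (intro mult_right_mono ennreal_leI B power_decreasing)
    \<comment> \<open>Cutting out step \<open>t\<close> leaves two stretches whose numbers of
      complete blocks add up to at most one less than before.\<close>
    show "m div 2 - 1 \<le> (m - Suc t) div 2 + t div 2" using t by presburger
  qed (use theta in auto)
  finally show ?thesis .
qed

section \<open>From the martingale to the empirical mean\<close>

definition visits_num :: "'w \<Rightarrow> real" where
  "visits_num x = real (card {t. t < m \<and> x \<in> I t})"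

lemma halves_eq: "halves 0 m x = ennreal (2 powr (- visits_num x))"
proof -
  have "halves 0 m x = ennreal (\<Prod>j\<in>{0..<m}. if x \<in> I j then 1 / 2 else 1)"
    unfolding halves_def half_def by (rule prod_ennreal) auto
  also have "(\<Prod>j\<in>{0..<m}. if x \<in> I j then 1 / 2 else 1 :: real) = (1 / 2) ^ card {t. t < m \<and> x \<in> I t}"
    by (subst prod.If_cases) (simp_all add: Int_def conj_commute)
  also have "\<dots> = 2 powr (- visits_num x)"
    by (simp add: visits_num_def powr_minus powr_realpow power_divide inverse_eq_divide)
  finally show ?thesis .
qed

text \<open>The error of an empirical mean over visits. Here \<open>D\<close> is the deviation of
  the default value, which is in force when there are no visits.\<close>

definition mean_error :: "real \<Rightarrow> 'w \<Rightarrow> real" where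
  "mean_error D x = (if visits_num x = 0 then D else S m x / visits_num x)"

lemma mean_error_meas: "mean_error D \<in> borel_measurable (F m)"
proof -
  have "visits_num = (\<lambda>x. \<Sum>t<m. indicator (I t) x)"
    by (auto simp: visits_num_def indicator_def of_bool_def sum.If_cases Int_def fun_eq_iff intro!: arg_cong[where f=card])
  moreover have "(\<lambda>x. \<Sum>t<m. indicator (I t) x :: real) \<in> borel_measurable (F m)"
  proof (intro borel_measurable_sum borel_measurable_indicator)
    fix t assume "t \<in> {..<m}"
    then show "I t \<in> sets (F m)" using I_meas[of t] G_F[of t] F_mono[of "Suc t" m] by auto
  qed
  ultimately have [measurable]: "visits_num \<in> borel_measurable (F m)" by simp
  have [measurable]: "S m \<in> borel_measurable (F m)" by (rule S_meas) simp
  show ?thesis unfolding mean_error_def by measurable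
qed

text \<open>With at least \<open>a * real m\<close> visits the denominator is of order
  \<open>m\<close>. With fewer visits the mean is bounded crudely, and the weight
  \<open>2 powr (- visits_num x)\<close> times \<open>\<theta> powr (- (real m / 4))\<close> is at
  least one by the choice of \<open>a\<close>. Since the weight has expectation of order
  \<open>\<theta> powr (real m / 2)\<close>, half of the exponential decay is spent and the other
  half is left.\<close>

lemma mean_error_bound:
  assumes m: "1 \<le> m"
  defines "a \<equiv> log 2 (1 / \<theta>) / 4"
  shows "mean_error D x ^ 4 \<le> S m x ^ 4 / (a * real m) ^ 4
    + \<theta> powr (- (real m / 4)) * (2 powr (- visits_num x) * (D ^ 4 + (\<Sum>t<m. \<eta> t x ^ 4)))"
proof -
  have a: "0 < a" using theta by (simp add: a_def)
  have nn: "0 \<le> S m x ^ 4 / (a * real m) ^ 4" by (simp add: zero_le_even_power)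
  have sn: "0 \<le> (\<Sum>t<m. \<eta> t x ^ 4)" "0 \<le> D ^ 4" by (auto intro: sum_nonneg simp: zero_le_even_power)
  show ?thesis
  proof (cases "a * real m \<le> visits_num x")
    case True
    moreover have am: "0 < a * real m" using a m by simp
    ultimately have N: "0 < visits_num x" by linarith
    have "mean_error D x ^ 4 = S m x ^ 4 / visits_num x ^ 4"
      using N by (simp add: mean_error_def power_divide)
    also have "\<dots> \<le> S m x ^ 4 / (a * real m) ^ 4"
      using True am N a m by (intro divide_left_mono power_mono mult_pos_pos zero_less_power) (auto simp: zero_le_even_power)
    finally show ?thesis using sn by (simp add: add_increasing2)
  next
    case False
    \<comment> \<open>Without a lower bound on the visits, the fourth power of a mean is at most the
      sum of the fourth powers of its terms.\<close>
    have "mean_error D x ^ 4 \<le> D ^ 4 + (\<Sum>t<m. \<eta> t x ^ 4)"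
    proof (cases "visits_num x = 0")
      case True
      then show ?thesis using sn by (simp add: mean_error_def)
    next
      case False
      let ?V = "{t. t < m \<and> x \<in> I t}"
      have c: "1 \<le> real (card ?V)"
      proof -
        have "card ?V \<noteq> 0" using False unfolding visits_num_def by (metis of_nat_0)
        then have "1 \<le> card ?V" by linarith
        then show ?thesis using of_nat_mono by fastforce
      qed
      have "S m x = (\<Sum>t\<in>?V. \<eta> t x)"
        unfolding S_def by (rule sum.mono_neutral_right) (auto intro: eta_outside)
      then have "S m x ^ 4 \<le> real (card ?V) ^ 3 * (\<Sum>t\<in>?V. \<eta> t x ^ 4)"
        using power4_sum_le[of "\<lambda>t. \<eta> t x" ?V] by simp
      also have "\<dots> \<le> real (card ?V) ^ 4 * (\<Sum>t<m. \<eta> t x ^ 4)"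
        using c by (intro mult_mono power_increasing sum_mono2) (auto intro: sum_nonneg simp: zero_le_even_power)
      finally have "S m x ^ 4 \<le> real (card ?V) ^ 4 * (\<Sum>t<m. \<eta> t x ^ 4)" .
      then have "S m x ^ 4 / visits_num x ^ 4 \<le> (\<Sum>t<m. \<eta> t x ^ 4)"
      proof -
        have n: "0 < real (card ?V) ^ 4" using c by (intro zero_less_power) linarith
        show ?thesis
          using \<open>S m x ^ 4 \<le> real (card ?V) ^ 4 * (\<Sum>t<m. \<eta> t x ^ 4)\<close>
          unfolding visits_num_def pos_divide_le_eq[OF n] by (simp only: mult.commute)
      qed
      then show ?thesis using False by (simp add: mean_error_def power_divide add_increasing[OF sn(2)])
    qed
    moreover have "1 \<le> \<theta> powr (- (real m / 4)) * 2 powr (- visits_num x)"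
    proof -
      have "2 powr (a * real m) = (2 powr log 2 (1 / \<theta>)) powr (real m / 4)"
        by (simp add: powr_powr a_def)
      also have "\<dots> = \<theta> powr (- (real m / 4))"
        using theta by (simp add: powr_divide powr_minus_divide)
      finally have "\<theta> powr (- (real m / 4)) * 2 powr (- visits_num x) = 2 powr (a * real m - visits_num x)"
        by (simp add: powr_diff powr_minus_divide)
      then show ?thesis using False by (simp add: ge_one_powr_ge_zero)
    qed
    ultimately have "mean_error D x ^ 4 \<le> \<theta> powr (- (real m / 4)) * 2 powr (- visits_num x) * (D ^ 4 + (\<Sum>t<m. \<eta> t x ^ 4))"
      using mult_right_mono[of 1 _ "D ^ 4 + (\<Sum>t<m. \<eta> t x ^ 4)"] sn by fastforce
    then show ?thesis unfolding mult.assoc by (rule add_increasing[OF nn])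
  qed
qed

text \<open>In the condition on \<open>K\<close>, one power of \<open>m\<close> counts the
  observations in the crude bound and two make room for the target rate
  \<open>1 / m\<^sup>2\<close>. The shift by 2 in the exponent pays for rounding to blocks and for
  the block lost to the observation.\<close>

lemma weighted_mean_error:
  assumes m: "1 \<le> m" and w: "w \<in> borel_measurable (F 0)"
    and K: "real m ^ 3 * \<theta> powr (real m / 4 - 2) \<le> K"
  shows "(\<integral>\<^sup>+x. w x * ennreal (mean_error D x ^ 4) \<partial>M)
    \<le> ennreal ((8 * (1 + B)\<^sup>2 / (log 2 (1 / \<theta>) / 4) ^ 4 + K * (D ^ 4 + B)) / (real m)\<^sup>2) * (\<integral>\<^sup>+x. w x \<partial>M)"
proof -
  define a where "a = log 2 (1 / \<theta>) / 4"
  define b where "b = \<theta> powr (- (real m / 4))"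
  have a: "0 < a" using theta by (simp add: a_def)
  have b: "0 \<le> b" by (simp add: b_def)
  have D4: "0 \<le> D ^ 4" by (simp add: zero_le_even_power)
  note [measurable] = measurable_F_M[OF w] S_meas_M[OF order_refl] measurable_F_M[OF halves_meas[OF order_refl]]
  have [measurable]: "t < m \<Longrightarrow> \<eta> t \<in> borel_measurable M" for t by (rule eta_measurable_M)
  let ?W = "\<integral>\<^sup>+x. w x \<partial>M"
  have "(\<integral>\<^sup>+x. w x * ennreal (mean_error D x ^ 4) \<partial>M)
      \<le> (\<integral>\<^sup>+x. ennreal (1 / (a * real m) ^ 4) * (w x * ennreal (S m x ^ 4))
          + ennreal b * (ennreal (D ^ 4) * (w x * halves 0 m x)
             + (\<Sum>t<m. w x * halves 0 m x * ennreal (\<eta> t x ^ 4))) \<partial>M)"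
  proof (rule nn_integral_mono)
    fix x
    let ?h = "2 powr (- visits_num x) :: real"
    have sn: "0 \<le> (\<Sum>t<m. \<eta> t x ^ 4)" "0 \<le> S m x ^ 4"
      by (auto intro: sum_nonneg simp: zero_le_even_power)
    have "ennreal (mean_error D x ^ 4) \<le> ennreal (1 / (a * real m) ^ 4 * S m x ^ 4 + b * (D ^ 4 * ?h + ?h * (\<Sum>t<m. \<eta> t x ^ 4)))"
      using mean_error_bound[OF m, of D x] by (intro ennreal_leI) (simp add: a_def b_def algebra_simps)
    also have "\<dots> = ennreal (1 / (a * real m) ^ 4) * ennreal (S m x ^ 4)
        + ennreal b * (ennreal (D ^ 4) * halves 0 m x + halves 0 m x * (\<Sum>t<m. ennreal (\<eta> t x ^ 4)))"
      using sn D4 b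
      by (simp add: halves_eq ennreal_mult[symmetric] zero_le_even_power sum_nonneg
          flip: ennreal_plus)
    finally have "w x * ennreal (mean_error D x ^ 4) \<le> w x * (ennreal (1 / (a * real m) ^ 4) * ennreal (S m x ^ 4)
        + ennreal b * (ennreal (D ^ 4) * halves 0 m x + halves 0 m x * (\<Sum>t<m. ennreal (\<eta> t x ^ 4))))"
      by (rule mult_left_mono) simp
    also have "\<dots> = ennreal (1 / (a * real m) ^ 4) * (w x * ennreal (S m x ^ 4))
          + ennreal b * (ennreal (D ^ 4) * (w x * halves 0 m x)
             + (\<Sum>t<m. w x * halves 0 m x * ennreal (\<eta> t x ^ 4)))"
      unfolding sum_distrib_left[symmetric] by (simp only: distrib_left mult_ac)
    finally show "w x * ennreal (mean_error D x ^ 4) \<le> \<dots>" .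
  qed
  also have "\<dots> = ennreal (1 / (a * real m) ^ 4) * (\<integral>\<^sup>+x. w x * ennreal (S m x ^ 4) \<partial>M)
          + ennreal b * (ennreal (D ^ 4) * (\<integral>\<^sup>+x. w x * halves 0 m x \<partial>M)
             + (\<Sum>t<m. \<integral>\<^sup>+x. w x * halves 0 m x * ennreal (\<eta> t x ^ 4) \<partial>M))"
  proof -
    have "(\<integral>\<^sup>+x. (\<Sum>t<m. w x * halves 0 m x * ennreal (\<eta> t x ^ 4)) \<partial>M)
        = (\<Sum>t<m. \<integral>\<^sup>+x. w x * halves 0 m x * ennreal (\<eta> t x ^ 4) \<partial>M)"
    proof (rule nn_integral_sum)
      fix t assume "t \<in> {..<m}"
      then have [measurable]: "\<eta> t \<in> borel_measurable M" by (simp add: eta_measurable_M)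
      show "(\<lambda>x. w x * halves 0 m x * ennreal (\<eta> t x ^ 4)) \<in> borel_measurable M" by measurable
    qed
    then show ?thesis by (simp add: nn_integral_add nn_integral_cmult)
  qed
  also have "\<dots> \<le> ennreal (1 / (a * real m) ^ 4) * (ennreal (8 * (1 + B)\<^sup>2 * (real m)\<^sup>2) * ?W)
          + ennreal b * (ennreal (D ^ 4) * (ennreal (\<theta> ^ ((m - 0) div 2)) * ?W)
             + (\<Sum>t<m. ennreal (\<theta> ^ (m div 2 - 1) * B) * ?W))"
    by (intro add_mono mult_left_mono sum_mono weighted_S4 peel eta_halves w) auto
  also have "\<dots> = ennreal (1 / (a * real m) ^ 4 * (8 * (1 + B)\<^sup>2 * (real m)\<^sup>2)
      + b * (D ^ 4 * \<theta> ^ (m div 2) + real m * (\<theta> ^ (m div 2 - 1) * B))) * ?W"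
  proof -
    define X1 where "X1 = 1 / (a * real m) ^ 4 * (8 * (1 + B)\<^sup>2 * (real m)\<^sup>2)"
    define X2 where "X2 = b * (D ^ 4 * \<theta> ^ (m div 2))"
    define X3 where "X3 = b * (real m * (\<theta> ^ (m div 2 - 1) * B))"
    have X0: "0 \<le> X1" "0 \<le> X2" "0 \<le> X3"
      using a b B D4 theta unfolding X1_def X2_def X3_def by (auto simp: zero_le_even_power)
    have "ennreal (1 / (a * real m) ^ 4) * (ennreal (8 * (1 + B)\<^sup>2 * (real m)\<^sup>2) * ?W) = ennreal X1 * ?W"
      unfolding X1_def mult.assoc[symmetric] using a by (subst ennreal_mult[symmetric]) (auto simp: zero_le_even_power)
    moreover have "ennreal b * (ennreal (D ^ 4) * (ennreal (\<theta> ^ ((m - 0) div 2)) * ?W)) = ennreal X2 * ?W"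
      unfolding X2_def using b D4 theta by (simp add: ennreal_mult mult.assoc)
    moreover have "ennreal b * (\<Sum>t<m. ennreal (\<theta> ^ (m div 2 - 1) * B) * ?W) = ennreal X3 * ?W"
      unfolding X3_def using b B theta by (simp add: ennreal_mult mult.assoc ennreal_of_nat_eq_real_of_nat)
    ultimately have "ennreal (1 / (a * real m) ^ 4) * (ennreal (8 * (1 + B)\<^sup>2 * (real m)\<^sup>2) * ?W)
          + ennreal b * (ennreal (D ^ 4) * (ennreal (\<theta> ^ ((m - 0) div 2)) * ?W)
             + (\<Sum>t<m. ennreal (\<theta> ^ (m div 2 - 1) * B) * ?W)) = (ennreal X1 + (ennreal X2 + ennreal X3)) * ?W"
      by (simp only: distrib_left distrib_right)
    also have "ennreal X1 + (ennreal X2 + ennreal X3) = ennreal (X1 + (X2 + X3))"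
      using X0 by simp
    finally show ?thesis unfolding X1_def X2_def X3_def by (simp only: distrib_left)
  qed
  also have "\<dots> \<le> ennreal ((8 * (1 + B)\<^sup>2 / a ^ 4 + K * (D ^ 4 + B)) / (real m)\<^sup>2) * ?W"
  proof (intro mult_right_mono ennreal_leI)
    have "1 / (a * real m) ^ 4 * (8 * (1 + B)\<^sup>2 * (real m)\<^sup>2) = 8 * (1 + B)\<^sup>2 / a ^ 4 / (real m)\<^sup>2"
      using a m by (simp add: power_mult_distrib field_simps eval_nat_numeral)
    moreover have "b * (D ^ 4 * \<theta> ^ (m div 2) + real m * (\<theta> ^ (m div 2 - 1) * B)) \<le> K * (D ^ 4 + B) / (real m)\<^sup>2"
    proof -
      have e: "real m / 2 - 2 \<le> real (m div 2 - 1)" by linarith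
      have "\<theta> ^ (m div 2 - 1) = \<theta> powr real (m div 2 - 1)" using theta by (simp add: powr_realpow)
      also have "\<dots> \<le> \<theta> powr (real m / 2 - 2)" using theta e by (intro powr_mono') auto
      finally have "b * \<theta> ^ (m div 2 - 1) \<le> b * \<theta> powr (real m / 2 - 2)" using b by (rule mult_left_mono)
      also have "\<dots> = \<theta> powr (real m / 4 - 2)" unfolding b_def by (simp add: powr_add[symmetric])
      finally have k: "b * \<theta> ^ (m div 2 - 1) \<le> \<theta> powr (real m / 4 - 2)" .
      have "\<theta> ^ (m div 2) \<le> \<theta> ^ (m div 2 - 1)" using theta by (intro power_decreasing) auto
      then have "\<theta> ^ (m div 2) * D ^ 4 \<le> \<theta> ^ (m div 2 - 1) * D ^ 4"
        using D4 by (rule mult_right_mono)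
      moreover have "1 * (\<theta> ^ (m div 2 - 1) * D ^ 4) \<le> real m * (\<theta> ^ (m div 2 - 1) * D ^ 4)"
        using m D4 theta by (intro mult_right_mono) auto
      ultimately have "D ^ 4 * \<theta> ^ (m div 2) \<le> real m * (\<theta> ^ (m div 2 - 1) * D ^ 4)"
        by (simp only: mult_1 mult.commute[of "D ^ 4"])
      then have "b * (D ^ 4 * \<theta> ^ (m div 2) + real m * (\<theta> ^ (m div 2 - 1) * B))
          \<le> b * (real m * (\<theta> ^ (m div 2 - 1) * D ^ 4) + real m * (\<theta> ^ (m div 2 - 1) * B))"
        using b by (intro mult_left_mono add_right_mono)
      also have "\<dots> = (b * \<theta> ^ (m div 2 - 1)) * (real m * (D ^ 4 + B))" by (simp add: algebra_simps)
      also have "\<dots> \<le> \<theta> powr (real m / 4 - 2) * (real m * (D ^ 4 + B))"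
        using B D4 by (intro mult_right_mono k) auto
      also have "\<dots> = (real m ^ 3 * \<theta> powr (real m / 4 - 2)) * (D ^ 4 + B) / (real m)\<^sup>2"
        using m by (simp add: field_simps eval_nat_numeral)
      also have "\<dots> \<le> K * (D ^ 4 + B) / (real m)\<^sup>2"
        using B D4 by (intro divide_right_mono mult_right_mono K) auto
      finally show ?thesis .
    qed
    ultimately show "1 / (a * real m) ^ 4 * (8 * (1 + B)\<^sup>2 * (real m)\<^sup>2)
        + b * (D ^ 4 * \<theta> ^ (m div 2) + real m * (\<theta> ^ (m div 2 - 1) * B))
        \<le> (8 * (1 + B)\<^sup>2 / a ^ 4 + K * (D ^ 4 + B)) / (real m)\<^sup>2"
      by (simp add: add_divide_distrib)
  qed simp
  finally show ?thesis unfolding a_def .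
qed

end

text \<open>With \<open>q powr (1 / 12)\<close> as base, the product is a constant times the cube of
  \<open>real m * ?x ^ m\<close>, which tends to zero.\<close>

lemma cube_times_powr_bounded:
  fixes q :: real
  assumes "0 < q" "q < 1"
  shows "\<exists>K. \<forall>m::nat. real m ^ 3 * q powr (real m / 4 - 2) \<le> K"
proof -
  let ?x = "q powr (1 / 12)"
  have x: "0 \<le> ?x" "?x < 1" using assms powr_less_mono2[of "1 / 12" q 1] by auto
  have "(\<lambda>n. real n * ?x ^ n) \<longlonglongrightarrow> 0"
    using x by (intro powser_times_n_limit_0) auto
  then have "Bseq (\<lambda>n. real n * ?x ^ n)" by (intro convergent_imp_Bseq convergentI)
  then obtain k where k: "\<And>n. norm (real n * ?x ^ n) \<le> k" unfolding Bseq_def by auto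
  have "real m ^ 3 * q powr (real m / 4 - 2) \<le> k ^ 3 * q powr (- 2)" for m :: nat
  proof -
    have "?x ^ m = q powr (real m / 12)"
      using assms by (simp add: powr_power)
    then have "(?x ^ m) ^ 3 = q powr (real m / 4)"
      using assms by (simp add: powr_power)
    then have "real m ^ 3 * q powr (real m / 4 - 2) = (real m * ?x ^ m) ^ 3 * q powr (- 2)"
      by (simp add: power_mult_distrib powr_diff powr_minus_divide)
    also have "\<dots> \<le> k ^ 3 * q powr (- 2)"
      using k[of m] x by (intro mult_right_mono power_mono) auto
    finally show ?thesis .
  qed
  then show ?thesis by blast
qed

section \<open>The error of the empirical model\<close>

text \<open>A prescribed conditional probability, restated as an identity of integrals against any
  integrable weight known to \<open>F\<close>; indicators of events and martingale weights are both
  needed below.\<close>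

lemma (in prob_space) cond_prob_integral:
  assumes sub: "subalgebra M F" and Q: "{x \<in> space M. Q x} \<in> sets M"
    and g: "AE x in M. real_cond_exp M F (\<lambda>x. of_bool (Q x)) x = g x" "g \<in> borel_measurable M"
    and h: "h \<in> borel_measurable F" "integrable M h"
  shows "integrable M (\<lambda>x. h x * of_bool (Q x))" "integrable M (\<lambda>x. h x * g x)"
    and "(\<integral>x. h x * of_bool (Q x) \<partial>M) = (\<integral>x. h x * g x \<partial>M)"
proof -
  interpret finite_measure_subalgebra M F by unfold_locales (rule sub)
  have Qm [measurable]: "(\<lambda>x. of_bool (Q x) :: real) \<in> borel_measurable M"
    using Q by (simp add: borel_measurable_if_I of_bool_def cong: measurable_cong_simp)
  have [measurable]: "h \<in> borel_measurable M" by (rule measurable_from_subalg[OF sub h(1)])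
  note g(2) [measurable]
  show int: "integrable M (\<lambda>x. h x * of_bool (Q x))"
    by (rule Bochner_Integration.integrable_bound[OF h(2)]) auto
  have cm [measurable]: "(\<lambda>x. h x * real_cond_exp M F (\<lambda>x. of_bool (Q x)) x) \<in> borel_measurable M"
    by measurable
  have gm: "(\<lambda>x. h x * g x) \<in> borel_measurable M" by measurable
  have ae: "AE x in M. h x * real_cond_exp M F (\<lambda>x. of_bool (Q x)) x = h x * g x"
    using g(1) by (rule eventually_mono) simp
  note c = real_cond_exp_intg[OF int h(1) Qm]
  show "integrable M (\<lambda>x. h x * g x)"
    using c(1) integrable_cong_AE[OF cm gm ae] by simp
  show "(\<integral>x. h x * of_bool (Q x) \<partial>M) = (\<integral>x. h x * g x \<partial>M)"
    using c(2) integral_cong_AE[OF cm gm ae] by simp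
qed

lemma (in prob_space) cond_prob_integral_set:
  assumes "subalgebra M F" "{x \<in> space M. Q x} \<in> sets M"
    and "AE x in M. real_cond_exp M F (\<lambda>x. of_bool (Q x)) x = g x" "g \<in> borel_measurable M"
    and A: "A \<in> sets F"
  shows "prob (A \<inter> {x \<in> space M. Q x}) = (\<integral>x. indicator A x * g x \<partial>M)"
    and "integrable M (\<lambda>x. indicator A x * g x)"
proof -
  have AM: "A \<in> sets M" using assms(1) A by (auto simp: subalgebra_def)
  have h: "(indicator A :: 'a \<Rightarrow> real) \<in> borel_measurable F" "integrable M (indicator A :: 'a \<Rightarrow> real)"
    using A AM by (auto intro!: borel_measurable_indicator integrable_real_indicator simp: less_top[symmetric])
  note c = cond_prob_integral[OF assms(1-4) h]
  have "(\<integral>x. indicator A x * of_bool (Q x) \<partial>M) = (\<integral>x. (indicator (A \<inter> {x \<in> space M. Q x}) x :: real) \<partial>M)"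
    by (intro Bochner_Integration.integral_cong) (auto simp: indicator_def)
  also have "\<dots> = prob (A \<inter> {x \<in> space M. Q x})" using AM assms(2) by simp
  finally show "prob (A \<inter> {x \<in> space M. Q x}) = (\<integral>x. indicator A x * g x \<partial>M)" using c(3) by simp
  show "integrable M (\<lambda>x. indicator A x * g x)" by (rule c(2))
qed

lemma (in prob_space) integrable_indicator_mult:
  "A \<in> sets M \<Longrightarrow> integrable M (\<lambda>x. indicator A x * (d :: real))"
  by (intro integrable_mult_left integrable_real_indicator) (simp_all add: less_top[symmetric])

locale covered_run = admm_run M \<phi> c P r \<rho> \<gamma> P\<^sub>0 r\<^sub>0 \<pi>\<^sub>0 \<nu>\<^sub>0 \<beta> \<eta>\<^sub>\<pi> \<eta>\<^sub>V \<kappa> \<alpha> M\<^sub>4 X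
  for M :: "'w measure" and \<phi> :: "real^'a::finite^'s::finite \<Rightarrow> ereal"
    and c P r \<rho> \<gamma> P\<^sub>0 r\<^sub>0 \<pi>\<^sub>0 \<nu>\<^sub>0 \<beta> \<eta>\<^sub>\<pi> \<eta>\<^sub>V \<kappa> \<alpha> M\<^sub>4 and X :: "('w, 's, 'a) run" +
  fixes \<rho>\<^sub>m :: real
  assumes gamma01: "0 < \<gamma>" "\<gamma> < 1"
    and P_prob: "\<And>s a. prob_vec (P s a)" and P0_prob: "\<And>s a. prob_vec (P\<^sub>0 s a)"
    and rho_prob: "prob_vec \<rho>" and rho_cover: "0 < \<rho>\<^sub>m" "\<And>s. \<rho>\<^sub>m \<le> \<rho> s"
    and alpha_pos: "0 < \<alpha>"
begin

section \<open>Conditional probability of a visit\<close>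

definition visit_rate :: real where
  "visit_rate = (1 - \<gamma>) * \<rho>\<^sub>m * (\<alpha> * \<gamma>)"

lemma state_meas_M [measurable]: "t \<le> batch X k \<Longrightarrow> state X k t \<in> measurable M (count_space UNIV)"
  by (rule measurable_from_subalg[OF subalg_hist state_meas])

lemma action_meas_M [measurable]: "t < batch X k \<Longrightarrow> action X k t \<in> measurable M (count_space UNIV)"
  by (rule measurable_from_subalg[OF subalg_pre action_meas])

lemma reset_meas_M [measurable]: "t < batch X k \<Longrightarrow> reset X k t \<in> measurable M (count_space UNIV)"
  by (rule measurable_from_subalg[OF subalg_pre reset_meas])

lemma reward_meas_M [measurable]: "t < batch X k \<Longrightarrow> reward X k t \<in> borel_measurable M"
  by (rule measurable_from_subalg[OF subalg_hist reward_meas])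

lemma measurable_hist_pre: "t < batch X k \<Longrightarrow> f \<in> measurable (hist X k t) N \<Longrightarrow> f \<in> measurable (pre X k t) N"
  using hist_pre[of t k] subalg_hist[of k t] subalg_pre[of k t] by (auto simp: measurable_def subalgebra_def)

lemma space_hist: "space (hist X k t) = space M" and space_pre: "space (pre X k t) = space M"
  using subalg_hist subalg_pre by (auto simp: subalgebra_def)

lemma behav_entry_meas [measurable]: "(\<lambda>\<omega>. behav X k \<omega> $ s $ a) \<in> borel_measurable M"
proof -
  have [measurable]: "behav X k \<in> borel_measurable M"
    by (rule measurable_from_subalg[OF subalg_hist behav_meas])
  have "(\<lambda>\<pi>::real^'a^'s. \<pi> $ s $ a) \<in> borel_measurable borel"
    by (intro borel_measurable_continuous_onI continuous_intros)
  then show ?thesis by measurable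
qed

definition visit :: "nat \<Rightarrow> 's \<Rightarrow> 'a \<Rightarrow> nat \<Rightarrow> 'w set" where
  "visit k s a t = {\<omega> \<in> space M. \<not> reset X k t \<omega> \<and> state X k t \<omega> = s \<and> action X k t \<omega> = a}"

lemma visit_meas: "t < batch X k \<Longrightarrow> visit k s a t \<in> sets (pre X k t)"
proof -
  assume t: "t < batch X k"
  note [measurable] = reset_meas[OF t] action_meas[OF t] measurable_hist_pre[OF t state_meas[OF less_imp_le[OF t]]]
  have "{\<omega> \<in> space (pre X k t). \<not> reset X k t \<omega> \<and> state X k t \<omega> = s \<and> action X k t \<omega> = a} \<in> sets (pre X k t)"
    by measurable
  then show ?thesis by (simp add: visit_def space_pre)
qed

lemma sets_hist_M: "A \<in> sets (hist X k t) \<Longrightarrow> A \<in> sets M" and sets_pre_M: "A \<in> sets (pre X k t) \<Longrightarrow> A \<in> sets M"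
  using subalg_hist[of k t] subalg_pre[of k t] by (auto simp: subalgebra_def)

text \<open>The law of action and coin is given jointly; summing over the actions removes the
  behavior policy, whose rows add up to one.\<close>

lemma prob_reset:
  assumes t: "t < batch X k" and A: "A \<in> sets (hist X k t)"
  shows "prob (A \<inter> {\<omega> \<in> space M. reset X k t \<omega>}) = (1 - \<gamma>) * prob A"
proof -
  note [measurable] = reset_meas_M[OF t] action_meas_M[OF t] state_meas_M[OF less_imp_le[OF t]] sets_hist_M[OF A]
  let ?R = "\<lambda>a. {\<omega> \<in> space M. action X k t \<omega> = a \<and> reset X k t \<omega> = True}"
  let ?b = "\<lambda>a \<omega>. behav X k \<omega> $ state X k t \<omega> $ a * (if True then 1 - \<gamma> else \<gamma>)"
  have bm: "?b a \<in> borel_measurable M" for a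
    by (intro borel_measurable_times measurable_compose_countable[where g="state X k t" and f="\<lambda>s \<omega>. behav X k \<omega> $ s $ a"]) measurable
  have Rm: "?R a \<in> sets M" for a by measurable
  note b = cond_prob_integral_set[OF subalg_hist Rm action_reset_law[OF t, of _ True] bm A]
  have eq: "A \<inter> {\<omega> \<in> space M. reset X k t \<omega>} = (\<Union>a\<in>UNIV. A \<inter> ?R a)" by auto
  have "prob (A \<inter> {\<omega> \<in> space M. reset X k t \<omega>}) = (\<Sum>a\<in>UNIV. prob (A \<inter> ?R a))"
    unfolding eq
    by (rule finite_measure_finite_Union) (use Rm sets_hist_M[OF A] in \<open>auto simp: disjoint_family_on_def\<close>)
  also have "\<dots> = (\<Sum>a\<in>UNIV. \<integral>\<omega>. indicator A \<omega> * ?b a \<omega> \<partial>M)" by (simp only: b(1))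
  also have "\<dots> = (\<integral>\<omega>. (\<Sum>a\<in>UNIV. indicator A \<omega> * ?b a \<omega>) \<partial>M)"
    by (rule Bochner_Integration.integral_sum[symmetric]) (rule b(2))
  also have "\<dots> = (\<integral>\<omega>. (1 - \<gamma>) * indicator A \<omega> \<partial>M)"
  proof (rule Bochner_Integration.integral_cong)
    fix \<omega> assume "\<omega> \<in> space M"
    then have "(\<Sum>a\<in>UNIV. behav X k \<omega> $ state X k t \<omega> $ a) = 1"
      using behav_policy by (simp add: policies_def prob_vec_def)
    then show "(\<Sum>a\<in>UNIV. indicator A \<omega> * ?b a \<omega>) = (1 - \<gamma>) * indicator A \<omega>"
      by (simp add: sum_distrib_left[symmetric] sum_distrib_right[symmetric])
  qed simp
  also have "\<dots> = (1 - \<gamma>) * prob A" using sets_hist_M[OF A] by simp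
  finally show ?thesis .
qed

text \<open>Whatever the past at step \<open>t\<close>, a reset occurs with probability
  \<open>1 - \<gamma>\<close>, it leads to \<open>s\<close> with probability at least
  \<open>\<rho>\<^sub>m\<close>, and there \<open>a\<close> is taken without a reset with
  probability at least \<open>\<alpha> * \<gamma>\<close>. The detour over a reset makes the bound
  independent of the transition model.\<close>

lemma prob_visit:
  assumes t: "Suc t < batch X k" and A: "A \<in> sets (hist X k t)"
  shows "visit_rate * prob A \<le> prob (A \<inter> visit k s a (Suc t))"
proof -
  have t': "t < batch X k" using t by simp
  note [measurable] = reset_meas_M[OF t'] reset_meas_M[OF t] action_meas_M[OF t'] action_meas_M[OF t]
    state_meas_M[of t, OF less_imp_le[OF t']] state_meas_M[of "Suc t", OF less_imp_le[OF t]]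
  let ?R = "A \<inter> {\<omega> \<in> space M. reset X k t \<omega>}"
  let ?S = "?R \<inter> {\<omega> \<in> space M. state X k (Suc t) \<omega> = s}"
  let ?V = "{\<omega> \<in> space M. action X k (Suc t) \<omega> = a \<and> reset X k (Suc t) \<omega> = False}"
  note reset_meas[OF t', measurable]
  have "{\<omega> \<in> space (pre X k t). reset X k t \<omega>} \<in> sets (pre X k t)" by measurable
  then have R: "?R \<in> sets (pre X k t)" using A hist_pre[OF t'] by (auto simp: space_pre)
  note state_meas[OF less_imp_le[OF t], measurable]
  have "{\<omega> \<in> space (hist X k (Suc t)). state X k (Suc t) \<omega> = s} \<in> sets (hist X k (Suc t))" by measurable
  then have S: "?S \<in> sets (hist X k (Suc t))" using R pre_hist[OF t'] by (auto simp: space_hist)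
  note [measurable] = sets_pre_M[OF R] sets_hist_M[OF S]
  have Sm: "{\<omega> \<in> space M. state X k (Suc t) \<omega> = s} \<in> sets M" by measurable
  have gm: "(\<lambda>\<omega>. if reset X k t \<omega> then \<rho> s else P (state X k t \<omega>) (action X k t \<omega>) s) \<in> borel_measurable M"
    by (intro measurable_If borel_measurable_const
        measurable_compose_countable[where g="state X k t" and f="\<lambda>s' \<omega>. P s' (action X k t \<omega>) s"]
        measurable_compose_countable[where g="action X k t" and f="\<lambda>a' \<omega>. P _ a' s"]) measurable
  have "\<rho>\<^sub>m * prob ?R = (\<integral>\<omega>. indicator ?R \<omega> * \<rho>\<^sub>m \<partial>M)" by simp
  also have "\<dots> \<le> (\<integral>\<omega>. indicator ?R \<omega> * (if reset X k t \<omega> then \<rho> s else P (state X k t \<omega>) (action X k t \<omega>) s) \<partial>M)"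
    using rho_cover(2)[of s]
    by (intro integral_mono integrable_indicator_mult sets_pre_M[OF R] cond_prob_integral_set(2)[OF subalg_pre Sm next_state_law[OF t'] gm R])
      (auto simp: indicator_def)
  also have "\<dots> = prob ?S"
    by (rule cond_prob_integral_set(1)[OF subalg_pre Sm next_state_law[OF t'] gm R, symmetric])
  finally have 1: "\<rho>\<^sub>m * prob ?R \<le> prob ?S" .
  have Vm: "?V \<in> sets M" by measurable
  let ?b = "\<lambda>\<omega>. behav X k \<omega> $ state X k (Suc t) \<omega> $ a * (if False then 1 - \<gamma> else \<gamma>)"
  have bm: "?b \<in> borel_measurable M"
    by (intro borel_measurable_times measurable_compose_countable[where g="state X k (Suc t)" and f="\<lambda>s \<omega>. behav X k \<omega> $ s $ a"]) measurable
  have "\<alpha> * \<gamma> * prob ?S = (\<integral>\<omega>. indicator ?S \<omega> * (\<alpha> * \<gamma>) \<partial>M)" by simp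
  also have "\<dots> \<le> (\<integral>\<omega>. indicator ?S \<omega> * ?b \<omega> \<partial>M)"
    using behav_cover gamma01
    by (intro integral_mono integrable_indicator_mult sets_hist_M[OF S] cond_prob_integral_set(2)[OF subalg_hist Vm action_reset_law[OF t, of a False] bm S])
      (auto simp: indicator_def intro!: mult_right_mono)
  also have "\<dots> = prob (?S \<inter> ?V)"
    by (rule cond_prob_integral_set(1)[OF subalg_hist Vm action_reset_law[OF t, of a False] bm S, symmetric])
  also have "\<dots> \<le> prob (A \<inter> visit k s a (Suc t))"
    using sets_hist_M[OF A] sets_pre_M[OF visit_meas[OF t, of s a]]
    by (intro finite_measure_mono) (auto simp: visit_def)
  finally have 2: "\<alpha> * \<gamma> * prob ?S \<le> prob (A \<inter> visit k s a (Suc t))" .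
  have "visit_rate * prob A = \<alpha> * \<gamma> * (\<rho>\<^sub>m * prob ?R)"
    by (simp add: prob_reset[OF t' A] visit_rate_def mult_ac)
  also have "\<dots> \<le> \<alpha> * \<gamma> * prob ?S" using alpha_pos gamma01 by (intro mult_left_mono 1) auto
  finally show ?thesis using 2 by simp
qed

lemma visit_rate: "0 < visit_rate" "visit_rate \<le> 1"
proof -
  show "0 < visit_rate" using gamma01 rho_cover(1) alpha_pos by (simp add: visit_rate_def)
  have "\<rho>\<^sub>m \<le> 1"
  proof -
    have "\<rho> s \<le> (\<Sum>s\<in>UNIV. \<rho> s)" for s using rho_prob by (intro member_le_sum) (auto simp: prob_vec_def)
    then show ?thesis using rho_cover(2)[of undefined] rho_prob by (auto simp: prob_vec_def intro: order_trans)
  qed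
  moreover have "\<alpha> \<le> 1"
  proof -
    obtain \<omega> where w: "\<omega> \<in> space M" using not_empty by auto
    have "behav X k \<omega> $ s $ a \<le> (\<Sum>a\<in>UNIV. behav X k \<omega> $ s $ a)" for k s a
      using behav_policy[OF w] by (intro member_le_sum) (auto simp: policies_def prob_vec_def)
    then show ?thesis
      using behav_cover[OF w, of undefined undefined undefined] behav_policy[OF w]
      by (auto simp: policies_def prob_vec_def intro: order_trans)
  qed
  ultimately show "visit_rate \<le> 1"
    unfolding visit_rate_def using gamma01 rho_cover(1) alpha_pos
    by (intro mult_le_one) auto
qed

section \<open>Observation noise of transition rows and rewards\<close>

definition B\<^sub>4 :: real where "B\<^sub>4 = max 1 M\<^sub>4"

definition row_noise :: "nat \<Rightarrow> 's \<Rightarrow> 'a \<Rightarrow> 's \<Rightarrow> nat \<Rightarrow> 'w \<Rightarrow> real" where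
  "row_noise k s a s' t \<omega> = indicator (visit k s a t) \<omega> * (of_bool (state X k (Suc t) \<omega> = s') - P s a s')"

definition reward_noise :: "nat \<Rightarrow> 's \<Rightarrow> 'a \<Rightarrow> nat \<Rightarrow> 'w \<Rightarrow> real" where
  "reward_noise k s a t \<omega> = indicator (visit k s a t) \<omega> * (reward X k t \<omega> - r s a)"

lemma P_le_1: "0 \<le> P s a s'" "P s a s' \<le> 1"
proof -
  show "0 \<le> P s a s'" using P_prob[of s a] by (simp add: prob_vec_def)
  have "P s a s' \<le> (\<Sum>s'\<in>UNIV. P s a s')"
    using P_prob[of s a] by (intro member_le_sum) (auto simp: prob_vec_def)
  then show "P s a s' \<le> 1" using P_prob[of s a] by (simp add: prob_vec_def)
qed

text \<open>A visit excludes a reset and fixes state and action, so the next state has the row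
  \<open>P s a\<close> as its law given \<open>pre\<close>. This noise is at most one in modulus,
  which the maximum in \<open>B\<^sub>4\<close> covers.\<close>

lemma row_visited_mean:
  "visited_mean M (hist X k) (pre X k) (visit k s a) (row_noise k s a s') (batch X k) visit_rate B\<^sub>4"
proof (unfold_locales)
  fix t and h :: "'w \<Rightarrow> real"
  assume t: "t < batch X k" and h: "h \<in> borel_measurable (pre X k t)" "integrable M h"
  let ?I = "visit k s a t"
  note [measurable] = state_meas_M[OF Suc_leI[OF t]] visit_meas[OF t]
  have [measurable]: "?I \<in> sets M" by (rule sets_pre_M[OF visit_meas[OF t]])
  have Q: "{\<omega> \<in> space M. state X k (Suc t) \<omega> = s'} \<in> sets M" by measurable
  have hI: "(\<lambda>\<omega>. h \<omega> * indicator ?I \<omega>) \<in> borel_measurable (pre X k t)" "integrable M (\<lambda>\<omega>. h \<omega> * indicator ?I \<omega>)"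
    using h(1) integrable_real_mult_indicator[OF _ h(2), of ?I] by auto
  note [measurable] = action_meas_M[OF t] state_meas_M[OF less_imp_le[OF t]] reset_meas_M[OF t]
  have gm: "(\<lambda>\<omega>. if reset X k t \<omega> then \<rho> s' else P (state X k t \<omega>) (action X k t \<omega>) s') \<in> borel_measurable M"
    by (intro measurable_If borel_measurable_const
        measurable_compose_countable[where g="state X k t" and f="\<lambda>s \<omega>. P s (action X k t \<omega>) s'"]
        measurable_compose_countable[where g="action X k t" and f="\<lambda>a \<omega>. P _ a s'"]) measurable
  note cp = cond_prob_integral[OF subalg_pre Q next_state_law[OF t] gm hI]
  have "(\<integral>\<omega>. h \<omega> * row_noise k s a s' t \<omega> \<partial>M)
      = (\<integral>\<omega>. h \<omega> * indicator ?I \<omega> * of_bool (state X k (Suc t) \<omega> = s') - h \<omega> * indicator ?I \<omega> * P s a s' \<partial>M)"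
    by (intro Bochner_Integration.integral_cong) (simp_all add: row_noise_def right_diff_distrib mult.assoc)
  also have "\<dots> = (\<integral>\<omega>. h \<omega> * indicator ?I \<omega> * of_bool (state X k (Suc t) \<omega> = s') \<partial>M) - (\<integral>\<omega>. h \<omega> * indicator ?I \<omega> * P s a s' \<partial>M)"
    using cp(1) hI(2) by (intro Bochner_Integration.integral_diff integrable_mult_left)
  also have "(\<integral>\<omega>. h \<omega> * indicator ?I \<omega> * P s a s' \<partial>M)
      = (\<integral>\<omega>. h \<omega> * indicator ?I \<omega> * (if reset X k t \<omega> then \<rho> s' else P (state X k t \<omega>) (action X k t \<omega>) s') \<partial>M)"
    by (intro Bochner_Integration.integral_cong) (auto simp: visit_def indicator_def)
  finally show "(\<integral>\<omega>. h \<omega> * row_noise k s a s' t \<omega> \<partial>M) = 0" using cp(3) by simp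
next
  fix t and h :: "'w \<Rightarrow> ennreal" assume t: "t < batch X k" and h: "h \<in> borel_measurable (pre X k t)"
  have le: "row_noise k s a s' t \<omega> ^ 4 \<le> 1" for \<omega>
  proof -
    have "\<bar>row_noise k s a s' t \<omega>\<bar> \<le> 1"
      using P_le_1[of s a s'] by (auto simp: row_noise_def indicator_def of_bool_def)
    then have "\<bar>row_noise k s a s' t \<omega>\<bar> ^ 4 \<le> 1" by (intro power_le_one) auto
    then show ?thesis by simp
  qed
  have "(\<integral>\<^sup>+\<omega>. h \<omega> * ennreal (row_noise k s a s' t \<omega> ^ 4) \<partial>M) \<le> (\<integral>\<^sup>+\<omega>. h \<omega> * 1 \<partial>M)"
    by (intro nn_integral_mono mult_left_mono) (simp_all add: le)
  also have "\<dots> \<le> ennreal B\<^sub>4 * (\<integral>\<^sup>+\<omega>. h \<omega> \<partial>M)"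
    using mult_right_mono[of 1 "ennreal B\<^sub>4"] by (simp add: B\<^sub>4_def)
  finally show "(\<integral>\<^sup>+\<omega>. h \<omega> * ennreal (row_noise k s a s' t \<omega> ^ 4) \<partial>M) \<le> ennreal B\<^sub>4 * (\<integral>\<^sup>+\<omega>. h \<omega> \<partial>M)" .
next
  fix t assume t: "t < batch X k"
  note [measurable] = state_meas[OF Suc_leI[OF t]]
  have [measurable]: "visit k s a t \<in> sets (hist X k (Suc t))" using visit_meas[OF t] pre_hist[OF t] by auto
  show "row_noise k s a s' t \<in> borel_measurable (hist X k (Suc t))"
    unfolding row_noise_def of_bool_def by measurable
qed (use subalg_hist subalg_pre hist_pre pre_hist visit_meas prob_visit visit_rate in \<open>auto simp: row_noise_def B\<^sub>4_def\<close>)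

text \<open>Rows and rewards are separate instances of \<open>visited_mean\<close>, so no joint law
  of reward and next state enters and their dependence does no harm.\<close>

lemma reward_visited_mean:
  "visited_mean M (hist X k) (pre X k) (visit k s a) (reward_noise k s a) (batch X k) visit_rate B\<^sub>4"
proof (unfold_locales)
  fix t and h :: "'w \<Rightarrow> real"
  assume t: "t < batch X k" and h: "h \<in> borel_measurable (pre X k t)" "integrable M h"
    and int: "integrable M (\<lambda>\<omega>. h \<omega> * reward_noise k s a t \<omega>)"
  let ?I = "visit k s a t"
  let ?z = "\<lambda>\<omega>. reward X k t \<omega> - r (state X k t \<omega>) (action X k t \<omega>)"
  interpret finite_measure_subalgebra M "pre X k t" by unfold_locales (rule subalg_pre)
  note [measurable] = action_meas_M[OF t] state_meas_M[OF less_imp_le[OF t]] reward_meas_M[OF t] visit_meas[OF t] h(1)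
  have zm: "?z \<in> borel_measurable M"
    by (intro borel_measurable_diff
        measurable_compose_countable[where g="state X k t" and f="\<lambda>s \<omega>. r s (action X k t \<omega>)"]
        measurable_compose_countable[where g="action X k t" and f="\<lambda>a \<omega>. r _ a"]) measurable
  have eq: "h \<omega> * reward_noise k s a t \<omega> = (h \<omega> * indicator ?I \<omega>) * ?z \<omega>" for \<omega>
    by (simp add: reward_noise_def indicator_def visit_def)
  have hI: "(\<lambda>\<omega>. h \<omega> * indicator ?I \<omega>) \<in> borel_measurable (pre X k t)" by measurable
  have "(\<integral>\<omega>. h \<omega> * reward_noise k s a t \<omega> \<partial>M) = (\<integral>\<omega>. (h \<omega> * indicator ?I \<omega>) * real_cond_exp M (pre X k t) ?z \<omega> \<partial>M)"
    unfolding eq using int by (intro real_cond_exp_intg(2)[symmetric] hI zm) (simp add: eq)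
  also have "\<dots> = 0"
    using noise_mean[OF t] by (intro integral_eq_zero_AE) auto
  finally show "(\<integral>\<omega>. h \<omega> * reward_noise k s a t \<omega> \<partial>M) = 0" .
next
  fix t and h :: "'w \<Rightarrow> ennreal" assume t: "t < batch X k" and h: "h \<in> borel_measurable (pre X k t)"
  let ?z = "\<lambda>\<omega>. reward X k t \<omega> - r (state X k t \<omega>) (action X k t \<omega>)"
  interpret finite_measure_subalgebra M "pre X k t" by unfold_locales (rule subalg_pre)
  note [measurable] = action_meas_M[OF t] state_meas_M[OF less_imp_le[OF t]] reward_meas_M[OF t]
  have zm [measurable]: "?z \<in> borel_measurable M"
    by (intro borel_measurable_diff
        measurable_compose_countable[where g="state X k t" and f="\<lambda>s \<omega>. r s (action X k t \<omega>)"]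
        measurable_compose_countable[where g="action X k t" and f="\<lambda>a \<omega>. r _ a"]) measurable
  have [measurable]: "h \<in> borel_measurable M" by (rule measurable_from_subalg[OF subalg_pre h])
  have "(\<integral>\<^sup>+\<omega>. h \<omega> * ennreal (reward_noise k s a t \<omega> ^ 4) \<partial>M) \<le> (\<integral>\<^sup>+\<omega>. h \<omega> * ennreal (\<bar>?z \<omega>\<bar> ^ 4) \<partial>M)"
    by (intro nn_integral_mono mult_left_mono ennreal_leI) (auto simp: reward_noise_def indicator_def visit_def)
  also have "\<dots> = (\<integral>\<^sup>+\<omega>. h \<omega> * nn_cond_exp M (pre X k t) (\<lambda>\<omega>. ennreal (\<bar>?z \<omega>\<bar> ^ 4)) \<omega> \<partial>M)"
    by (rule nn_cond_exp_intg[symmetric, OF h]) measurable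
  also have "\<dots> \<le> (\<integral>\<^sup>+\<omega>. ennreal B\<^sub>4 * h \<omega> \<partial>M)"
  proof (rule nn_integral_mono_AE)
    have "ennreal M\<^sub>4 \<le> ennreal B\<^sub>4" by (intro ennreal_leI) (simp add: B\<^sub>4_def)
    then show "AE \<omega> in M. h \<omega> * nn_cond_exp M (pre X k t) (\<lambda>\<omega>. ennreal (\<bar>?z \<omega>\<bar> ^ 4)) \<omega> \<le> ennreal B\<^sub>4 * h \<omega>"
      using noise_moment[OF t] by (auto simp: mult.commute[of "h _"] intro!: mult_right_mono elim: order_trans)
  qed
  also have "\<dots> = ennreal B\<^sub>4 * (\<integral>\<^sup>+\<omega>. h \<omega> \<partial>M)" by (rule nn_integral_cmult) measurable
  finally show "(\<integral>\<^sup>+\<omega>. h \<omega> * ennreal (reward_noise k s a t \<omega> ^ 4) \<partial>M) \<le> ennreal B\<^sub>4 * (\<integral>\<^sup>+\<omega>. h \<omega> \<partial>M)" .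
next
  fix t assume t: "t < batch X k"
  note [measurable] = reward_meas[OF t]
  have [measurable]: "visit k s a t \<in> sets (hist X k (Suc t))" using visit_meas[OF t] pre_hist[OF t] by auto
  show "reward_noise k s a t \<in> borel_measurable (hist X k (Suc t))"
    unfolding reward_noise_def by measurable
qed (use subalg_hist subalg_pre hist_pre pre_hist visit_meas prob_visit visit_rate in \<open>auto simp: reward_noise_def B\<^sub>4_def\<close>)

section \<open>Moments of the whole empirical model\<close>

abbreviation model_err :: "nat \<Rightarrow> 'w \<Rightarrow> real" where
  "model_err k \<omega> \<equiv> model_error P r (P_hat P\<^sub>0 X k \<omega>) (r_hat r\<^sub>0 X k \<omega>)"

lemma visits_eq: "\<omega> \<in> space M \<Longrightarrow> visits X k \<omega> s a = {t. t < batch X k \<and> \<omega> \<in> visit k s a t}"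
  by (auto simp: visits_def visit_def)

lemma P_hat_prob: "prob_vec (P_hat P\<^sub>0 X k \<omega> s a)"
proof (cases "visits X k \<omega> s a = {}")
  case True
  then show ?thesis using P0_prob[of s a] by (simp add: P_hat_def[abs_def] prob_vec_def)
next
  case False
  let ?V = "visits X k \<omega> s a"
  have fin: "finite ?V" by (simp add: visits_def)
  have "(\<Sum>s'\<in>UNIV. card {t \<in> ?V. state X k (Suc t) \<omega> = s'}) = card (\<Union>s'\<in>UNIV. {t \<in> ?V. state X k (Suc t) \<omega> = s'})"
    using fin by (intro card_UN_disjoint[symmetric]) auto
  also have "(\<Union>s'\<in>UNIV. {t \<in> ?V. state X k (Suc t) \<omega> = s'}) = ?V" by auto
  finally have "(\<Sum>s'\<in>UNIV. real (card {t \<in> ?V. state X k (Suc t) \<omega> = s'})) = real (card ?V)"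
    by (simp flip: of_nat_sum)
  then show ?thesis using False fin
    by (auto simp: P_hat_def prob_vec_def sum_divide_distrib[symmetric])
qed

end

text \<open>The bound for the exponential remainder is chosen as a function of \<open>p\<close>
  alone, so that one constant serves all batch sizes and all runs.\<close>

definition mean_const :: "real \<Rightarrow> real \<Rightarrow> real \<Rightarrow> real" where
  "mean_const p B D = 8 * (1 + B)\<^sup>2 / (log 2 (1 / (1 - p / 2)) / 4) ^ 4
     + (SOME K. \<forall>m::nat. real m ^ 3 * (1 - p / 2) powr (real m / 4 - 2) \<le> K) * (D ^ 4 + B)"

lemma (in visited_mean) mean_error_moment:
  assumes m: "1 \<le> m" and w: "w \<in> borel_measurable (F 0)" and D: "\<bar>D\<bar> \<le> D'"
  shows "(\<integral>\<^sup>+x. w x * ennreal (mean_error D x ^ 4) \<partial>M) \<le> ennreal (mean_const p B D' / (real m)\<^sup>2) * (\<integral>\<^sup>+x. w x \<partial>M)"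
proof -
  let ?K = "SOME K. \<forall>m::nat. real m ^ 3 * (1 - p / 2) powr (real m / 4 - 2) \<le> K"
  have K: "real n ^ 3 * \<theta> powr (real n / 4 - 2) \<le> ?K" for n :: nat
    using someI_ex[OF cube_times_powr_bounded[OF theta[unfolded \<theta>_def]]] by (simp add: \<theta>_def)
  have "0 \<le> ?K" by (rule order_trans[OF _ K[of 1]]) simp
  moreover have "D ^ 4 \<le> D' ^ 4" using power_mono[OF D, of 4] by simp
  ultimately have "8 * (1 + B)\<^sup>2 / (log 2 (1 / \<theta>) / 4) ^ 4 + ?K * (D ^ 4 + B) \<le> mean_const p B D'"
    unfolding mean_const_def \<theta>_def by (intro add_left_mono mult_left_mono) auto
  then have "ennreal ((8 * (1 + B)\<^sup>2 / (log 2 (1 / \<theta>) / 4) ^ 4 + ?K * (D ^ 4 + B)) / (real m)\<^sup>2) * (\<integral>\<^sup>+x. w x \<partial>M)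
      \<le> ennreal (mean_const p B D' / (real m)\<^sup>2) * (\<integral>\<^sup>+x. w x \<partial>M)"
    by (intro mult_right_mono ennreal_leI divide_right_mono) auto
  then show ?thesis using weighted_mean_error[OF m w K] by (rule order_trans[rotated])
qed

lemma power4_add_le: "(x + y :: real) ^ 4 \<le> 8 * (x ^ 4 + y ^ 4)"
proof -
  have sq: "(a + b)\<^sup>2 \<le> 2 * (a\<^sup>2 + b\<^sup>2)" for a b :: real
    using sum_squares_bound[of a b] by (simp add: power2_sum)
  have "((x + y)\<^sup>2)\<^sup>2 \<le> (2 * (x\<^sup>2 + y\<^sup>2))\<^sup>2" by (intro power_mono sq) simp
  also have "\<dots> = 4 * (x\<^sup>2 + y\<^sup>2)\<^sup>2" by (subst power_mult_distrib) simp
  also have "\<dots> \<le> 4 * (2 * ((x\<^sup>2)\<^sup>2 + (y\<^sup>2)\<^sup>2))" by (intro mult_left_mono sq) simp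
  finally show ?thesis by simp
qed

lemma model_error_power4:
  fixes P Q :: "'s::finite \<Rightarrow> 'a::finite \<Rightarrow> 's \<Rightarrow> real"
  defines "n \<equiv> real CARD('s)" and "n' \<equiv> real CARD('a)"
  shows "model_error P r Q q ^ 4 \<le> 8 * ((n * n' * n) ^ 3 * (\<Sum>(s, a, s')\<in>UNIV. (Q s a s' - P s a s') ^ 4)
     + (n * n') ^ 3 * (\<Sum>(s, a)\<in>UNIV. (q s a - r s a) ^ 4))"
proof -
  have k: "kernel_l1 D ^ 4 \<le> (n * n' * n) ^ 3 * (\<Sum>(s, a, s')\<in>UNIV. D s a s' ^ 4)" for D :: "'s \<Rightarrow> 'a \<Rightarrow> 's \<Rightarrow> real"
  proof -
    have "kernel_l1 D = (\<Sum>(s, a, s')\<in>UNIV. \<bar>D s a s'\<bar>)"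
      unfolding kernel_l1_def by (simp add: sum.cartesian_product flip: UNIV_Times_UNIV)
    then show ?thesis
      using power4_sum_le[of "\<lambda>(s, a, s'). \<bar>D s a s'\<bar>" "UNIV :: ('s \<times> 'a \<times> 's) set"]
      by (simp add: n_def n'_def case_prod_beta mult.assoc flip: UNIV_Times_UNIV)
  qed
  have l: "reward_l1 d ^ 4 \<le> (n * n') ^ 3 * (\<Sum>(s, a)\<in>UNIV. d s a ^ 4)" for d :: "'s \<Rightarrow> 'a \<Rightarrow> real"
  proof -
    have "reward_l1 d = (\<Sum>(s, a)\<in>UNIV. \<bar>d s a\<bar>)"
      unfolding reward_l1_def by (simp add: sum.cartesian_product flip: UNIV_Times_UNIV)
    then show ?thesis
      using power4_sum_le[of "\<lambda>(s, a). \<bar>d s a\<bar>" "UNIV :: ('s \<times> 'a) set"]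
      by (simp add: n_def n'_def case_prod_beta flip: UNIV_Times_UNIV)
  qed
  show ?thesis
    unfolding model_error_def
    by (rule order_trans[OF power4_add_le]) (intro mult_left_mono add_mono k l; simp)
qed

text \<open>Written outside the run, with type tokens for the numbers of states and actions, because
  the final constants have to be fixed before a run is given.\<close>

definition model_const :: "real \<Rightarrow> real \<Rightarrow> real \<Rightarrow> 's::finite itself \<Rightarrow> 'a::finite itself \<Rightarrow> real" where
  "model_const p B D _ _ = 8 * ((real CARD('s) * real CARD('a) * real CARD('s)) ^ 4 + (real CARD('s) * real CARD('a)) ^ 4)
     * mean_const p B D"

context covered_run
begin

definition K\<^sub>4 :: real where
  "K\<^sub>4 = model_const visit_rate B\<^sub>4 (1 + reward_l1 (\<lambda>s a. r\<^sub>0 s a - r s a)) TYPE('s) TYPE('a)"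

text \<open>The entry error is a \<open>mean_error\<close> whose default deviation is that of
  \<open>P\<^sub>0\<close>; as both rows are probability vectors, this deviation is at most
  one.\<close>

lemma weighted_P_hat_error:
  assumes w: "w \<in> borel_measurable (hist X k 0)" and D: "1 \<le> D"
  shows "(\<integral>\<^sup>+\<omega>. w \<omega> * ennreal ((P_hat P\<^sub>0 X k \<omega> s a s' - P s a s') ^ 4) \<partial>M)
    \<le> ennreal (mean_const visit_rate B\<^sub>4 D / (real (batch X k))\<^sup>2) * (\<integral>\<^sup>+\<omega>. w \<omega> \<partial>M)"
    and "(\<lambda>\<omega>. P_hat P\<^sub>0 X k \<omega> s a s') \<in> borel_measurable (hist X k (batch X k))"
proof -
  interpret V: visited_mean M "hist X k" "pre X k" "visit k s a" "row_noise k s a s'" "batch X k" visit_rate B\<^sub>4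
    by (rule row_visited_mean)
  let ?D = "P\<^sub>0 s a s' - P s a s'"
  have "P\<^sub>0 s a s' \<le> (\<Sum>s'\<in>UNIV. P\<^sub>0 s a s')"
    using P0_prob[of s a] by (intro member_le_sum) (auto simp: prob_vec_def)
  then have D': "\<bar>?D\<bar> \<le> D"
    using P_le_1[of s a s'] P0_prob[of s a] D by (simp add: prob_vec_def abs_le_iff) (smt (verit))
  have eq: "P_hat P\<^sub>0 X k \<omega> s a s' - P s a s' = V.mean_error ?D \<omega>" if \<omega>: "\<omega> \<in> space M" for \<omega>
  proof -
    let ?V = "visits X k \<omega> s a"
    have num: "V.visits_num \<omega> = real (card ?V)" by (simp add: V.visits_num_def visits_eq[OF \<omega>])
    have fin: "finite ?V" by (simp add: visits_def)
    show ?thesis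
    proof (cases "?V = {}")
      case True
      then show ?thesis by (simp add: V.mean_error_def num P_hat_def)
    next
      case False
      then have c: "real (card ?V) \<noteq> 0" using fin by simp
      have "V.S (batch X k) \<omega> = (\<Sum>t\<in>?V. row_noise k s a s' t \<omega>)"
        unfolding V.S_def visits_eq[OF \<omega>] by (rule sum.mono_neutral_right) (auto simp: row_noise_def)
      also have "\<dots> = (\<Sum>t\<in>?V. of_bool (state X k (Suc t) \<omega> = s') - P s a s')"
        by (intro sum.cong) (auto simp: row_noise_def visits_eq[OF \<omega>])
      also have "\<dots> = real (card {t \<in> ?V. state X k (Suc t) \<omega> = s'}) - real (card ?V) * P s a s'"
        using fin by (simp add: sum_subtractf of_bool_def sum.If_cases Int_def)
      finally show ?thesis
        using c False by (simp add: V.mean_error_def num P_hat_def diff_divide_distrib)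
    qed
  qed
  have "(\<integral>\<^sup>+\<omega>. w \<omega> * ennreal ((P_hat P\<^sub>0 X k \<omega> s a s' - P s a s') ^ 4) \<partial>M)
      = (\<integral>\<^sup>+\<omega>. w \<omega> * ennreal (V.mean_error ?D \<omega> ^ 4) \<partial>M)"
    by (intro nn_integral_cong) (simp add: eq)
  also have "\<dots> \<le> ennreal (mean_const visit_rate B\<^sub>4 D / (real (batch X k))\<^sup>2) * (\<integral>\<^sup>+\<omega>. w \<omega> \<partial>M)"
    by (rule V.mean_error_moment[OF batch_pos w D'])
  finally show "(\<integral>\<^sup>+\<omega>. w \<omega> * ennreal ((P_hat P\<^sub>0 X k \<omega> s a s' - P s a s') ^ 4) \<partial>M)
    \<le> ennreal (mean_const visit_rate B\<^sub>4 D / (real (batch X k))\<^sup>2) * (\<integral>\<^sup>+\<omega>. w \<omega> \<partial>M)" .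
  have "(\<lambda>\<omega>. V.mean_error ?D \<omega> + P s a s') \<in> borel_measurable (hist X k (batch X k))"
    by (intro borel_measurable_add V.mean_error_meas borel_measurable_const)
  then show "(\<lambda>\<omega>. P_hat P\<^sub>0 X k \<omega> s a s') \<in> borel_measurable (hist X k (batch X k))"
    by (rule measurable_cong[THEN iffD1, rotated]) (simp add: space_hist flip: eq)
qed

lemma weighted_r_hat_error:
  assumes w: "w \<in> borel_measurable (hist X k 0)" and D: "\<bar>r\<^sub>0 s a - r s a\<bar> \<le> D"
  shows "(\<integral>\<^sup>+\<omega>. w \<omega> * ennreal ((r_hat r\<^sub>0 X k \<omega> s a - r s a) ^ 4) \<partial>M)
    \<le> ennreal (mean_const visit_rate B\<^sub>4 D / (real (batch X k))\<^sup>2) * (\<integral>\<^sup>+\<omega>. w \<omega> \<partial>M)"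
    and "(\<lambda>\<omega>. r_hat r\<^sub>0 X k \<omega> s a) \<in> borel_measurable (hist X k (batch X k))"
proof -
  interpret V: visited_mean M "hist X k" "pre X k" "visit k s a" "reward_noise k s a" "batch X k" visit_rate B\<^sub>4
    by (rule reward_visited_mean)
  let ?D = "r\<^sub>0 s a - r s a"
  have eq: "r_hat r\<^sub>0 X k \<omega> s a - r s a = V.mean_error ?D \<omega>" if \<omega>: "\<omega> \<in> space M" for \<omega>
  proof -
    let ?V = "visits X k \<omega> s a"
    have num: "V.visits_num \<omega> = real (card ?V)" by (simp add: V.visits_num_def visits_eq[OF \<omega>])
    have fin: "finite ?V" by (simp add: visits_def)
    show ?thesis
    proof (cases "?V = {}")
      case True
      then show ?thesis by (simp add: V.mean_error_def num r_hat_def)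
    next
      case False
      then have c: "real (card ?V) \<noteq> 0" using fin by simp
      have "V.S (batch X k) \<omega> = (\<Sum>t\<in>?V. reward_noise k s a t \<omega>)"
        unfolding V.S_def visits_eq[OF \<omega>] by (rule sum.mono_neutral_right) (auto simp: reward_noise_def)
      also have "\<dots> = (\<Sum>t\<in>?V. reward X k t \<omega> - r s a)"
        by (intro sum.cong) (auto simp: reward_noise_def visits_eq[OF \<omega>])
      also have "\<dots> = (\<Sum>t\<in>?V. reward X k t \<omega>) - real (card ?V) * r s a"
        by (simp add: sum_subtractf)
      finally show ?thesis
        using c False by (simp add: V.mean_error_def num r_hat_def diff_divide_distrib)
    qed
  qed
  have "(\<integral>\<^sup>+\<omega>. w \<omega> * ennreal ((r_hat r\<^sub>0 X k \<omega> s a - r s a) ^ 4) \<partial>M)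
      = (\<integral>\<^sup>+\<omega>. w \<omega> * ennreal (V.mean_error ?D \<omega> ^ 4) \<partial>M)"
    by (intro nn_integral_cong) (simp add: eq)
  also have "\<dots> \<le> ennreal (mean_const visit_rate B\<^sub>4 D / (real (batch X k))\<^sup>2) * (\<integral>\<^sup>+\<omega>. w \<omega> \<partial>M)"
    by (rule V.mean_error_moment[OF batch_pos w D])
  finally show "(\<integral>\<^sup>+\<omega>. w \<omega> * ennreal ((r_hat r\<^sub>0 X k \<omega> s a - r s a) ^ 4) \<partial>M)
    \<le> ennreal (mean_const visit_rate B\<^sub>4 D / (real (batch X k))\<^sup>2) * (\<integral>\<^sup>+\<omega>. w \<omega> \<partial>M)" .
  have "(\<lambda>\<omega>. V.mean_error ?D \<omega> + r s a) \<in> borel_measurable (hist X k (batch X k))"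
    by (intro borel_measurable_add V.mean_error_meas borel_measurable_const)
  then show "(\<lambda>\<omega>. r_hat r\<^sub>0 X k \<omega> s a) \<in> borel_measurable (hist X k (batch X k))"
    by (rule measurable_cong[THEN iffD1, rotated]) (simp add: space_hist flip: eq)
qed

lemma model_err_meas: "model_err k \<in> borel_measurable (hist X k (batch X k))"
  unfolding model_error_def kernel_l1_def reward_l1_def
  by (intro borel_measurable_add borel_measurable_sum borel_measurable_abs borel_measurable_diff
      weighted_P_hat_error(2)[of "\<lambda>_. 0" _ 1] weighted_r_hat_error(2)[of "\<lambda>_. 0", OF _ order_refl]) auto

text \<open>The decay of order \<open>1 / batch\<^sup>2\<close> holds conditionally on the
  information before the batch, so the weight may be a power of the size of the current
  iterates.\<close>

lemma weighted_model_err4: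
  assumes w: "w \<in> borel_measurable (hist X k 0)"
  shows "(\<integral>\<^sup>+\<omega>. w \<omega> * ennreal (model_err k \<omega> ^ 4) \<partial>M) \<le> ennreal (K\<^sub>4 / (real (batch X k))\<^sup>2) * (\<integral>\<^sup>+\<omega>. w \<omega> \<partial>M)"
proof -
  let ?n = "real CARD('s) * real CARD('a) * real CARD('s)" and ?l = "real CARD('s) * real CARD('a)"
  define D where "D = 1 + reward_l1 (\<lambda>s a. r\<^sub>0 s a - r s a)"
  define mc where "mc = mean_const visit_rate B\<^sub>4 D / (real (batch X k))\<^sup>2"
  let ?W = "\<integral>\<^sup>+\<omega>. w \<omega> \<partial>M"
  let ?p = "\<lambda>x \<omega>. (P_hat P\<^sub>0 X k \<omega> (fst x) (fst (snd x)) (snd (snd x)) - P (fst x) (fst (snd x)) (snd (snd x))) ^ 4"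
  let ?q = "\<lambda>x \<omega>. (r_hat r\<^sub>0 X k \<omega> (fst x) (snd x) - r (fst x) (snd x)) ^ 4"
  have D1: "1 \<le> D" using reward_l1_nonneg by (simp add: D_def)
  have Dr: "\<bar>r\<^sub>0 s a - r s a\<bar> \<le> D" for s a
  proof -
    have "\<bar>r\<^sub>0 s a - r s a\<bar> \<le> (\<Sum>a\<in>UNIV. \<bar>r\<^sub>0 s a - r s a\<bar>)" by (rule member_le_sum) auto
    also have "\<dots> \<le> reward_l1 (\<lambda>s a. r\<^sub>0 s a - r s a)"
      unfolding reward_l1_def by (rule member_le_sum[where f="\<lambda>s. \<Sum>a\<in>UNIV. \<bar>r\<^sub>0 s a - r s a\<bar>"]) (auto intro: sum_nonneg)
    finally show ?thesis by (simp add: D_def)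
  qed
  have [measurable]: "w \<in> borel_measurable M" by (rule measurable_from_subalg[OF subalg_hist w])
  have [measurable]: "?p x \<in> borel_measurable M" "?q y \<in> borel_measurable M" for x y
    using measurable_from_subalg[OF subalg_hist weighted_P_hat_error(2)[OF w D1]]
      measurable_from_subalg[OF subalg_hist weighted_r_hat_error(2)[OF w Dr]] by auto
  have le: "w \<omega> * ennreal (model_err k \<omega> ^ 4) \<le> ennreal (8 * ?n ^ 3) * (\<Sum>x\<in>UNIV. w \<omega> * ennreal (?p x \<omega>))
      + ennreal (8 * ?l ^ 3) * (\<Sum>x\<in>UNIV. w \<omega> * ennreal (?q x \<omega>))" for \<omega>
  proof -
    have "ennreal (model_err k \<omega> ^ 4) \<le> ennreal (8 * ?n ^ 3 * (\<Sum>x\<in>UNIV. ?p x \<omega>) + 8 * ?l ^ 3 * (\<Sum>x\<in>UNIV. ?q x \<omega>))"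
      using model_error_power4[of P r "P_hat P\<^sub>0 X k \<omega>" "r_hat r\<^sub>0 X k \<omega>"]
      by (intro ennreal_leI) (simp add: case_prod_beta distrib_left)
    also have "\<dots> = ennreal (8 * ?n ^ 3) * (\<Sum>x\<in>UNIV. ennreal (?p x \<omega>)) + ennreal (8 * ?l ^ 3) * (\<Sum>x\<in>UNIV. ennreal (?q x \<omega>))"
      by (subst (1 2) sum_ennreal) (auto simp: zero_le_even_power ennreal_mult[symmetric] sum_nonneg simp flip: ennreal_plus)
    finally have "w \<omega> * ennreal (model_err k \<omega> ^ 4) \<le> w \<omega> * (ennreal (8 * ?n ^ 3) * (\<Sum>x\<in>UNIV. ennreal (?p x \<omega>)) + ennreal (8 * ?l ^ 3) * (\<Sum>x\<in>UNIV. ennreal (?q x \<omega>)))"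
      by (rule mult_left_mono) simp
    then show ?thesis unfolding sum_distrib_left[symmetric] by (simp only: distrib_left mult_ac)
  qed
  have "(\<integral>\<^sup>+\<omega>. w \<omega> * ennreal (model_err k \<omega> ^ 4) \<partial>M)
      \<le> (\<integral>\<^sup>+\<omega>. ennreal (8 * ?n ^ 3) * (\<Sum>x\<in>UNIV. w \<omega> * ennreal (?p x \<omega>))
        + ennreal (8 * ?l ^ 3) * (\<Sum>x\<in>UNIV. w \<omega> * ennreal (?q x \<omega>)) \<partial>M)"
    by (intro nn_integral_mono le)
  also have "\<dots> = ennreal (8 * ?n ^ 3) * (\<Sum>x\<in>UNIV. \<integral>\<^sup>+\<omega>. w \<omega> * ennreal (?p x \<omega>) \<partial>M)
        + ennreal (8 * ?l ^ 3) * (\<Sum>x\<in>UNIV. \<integral>\<^sup>+\<omega>. w \<omega> * ennreal (?q x \<omega>) \<partial>M)"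
    by (simp add: nn_integral_add nn_integral_cmult nn_integral_sum)
  also have "\<dots> \<le> ennreal (8 * ?n ^ 3) * (\<Sum>x\<in>(UNIV::('s \<times> 'a \<times> 's) set). ennreal mc * ?W)
        + ennreal (8 * ?l ^ 3) * (\<Sum>x\<in>(UNIV::('s \<times> 'a) set). ennreal mc * ?W)"
    unfolding mc_def
    by (intro add_mono mult_left_mono sum_mono weighted_P_hat_error(1)[OF w D1] weighted_r_hat_error(1)[OF w Dr]) auto
  also have "\<dots> = ennreal (8 * ?n ^ 3 * ?n + 8 * ?l ^ 3 * ?l) * (ennreal mc * ?W)"
  proof -
    have c: "of_nat CARD('s \<times> 'a \<times> 's) = ennreal ?n" "of_nat CARD('s \<times> 'a) = ennreal ?l"
      by (simp_all add: ennreal_of_nat_eq_real_of_nat mult.assoc flip: UNIV_Times_UNIV)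
    have "ennreal (8 * ?n ^ 3) * (ennreal ?n * (ennreal mc * ?W)) + ennreal (8 * ?l ^ 3) * (ennreal ?l * (ennreal mc * ?W))
        = (ennreal (8 * ?n ^ 3) * ennreal ?n + ennreal (8 * ?l ^ 3) * ennreal ?l) * (ennreal mc * ?W)"
      by (simp only: distrib_right mult.assoc)
    also have "ennreal (8 * ?n ^ 3) * ennreal ?n + ennreal (8 * ?l ^ 3) * ennreal ?l = ennreal (8 * ?n ^ 3 * ?n + 8 * ?l ^ 3 * ?l)"
      by (subst ennreal_plus) (auto simp: ennreal_mult)
    finally show ?thesis by (simp only: sum_constant c)
  qed
  also have "\<dots> = ennreal ((8 * ?n ^ 3 * ?n + 8 * ?l ^ 3 * ?l) * mc) * ?W"
    by (subst ennreal_mult') (auto simp: mult.assoc)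
  also have "(8 * ?n ^ 3 * ?n + 8 * ?l ^ 3 * ?l) * mc = K\<^sub>4 / (real (batch X k))\<^sup>2"
  proof -
    have "8 * x ^ 3 * x + 8 * y ^ 3 * y = 8 * (x ^ 4 + y ^ 4)" for x y :: real
      by (simp add: eval_nat_numeral)
    then show ?thesis by (simp only: K\<^sub>4_def mc_def model_const_def D_def times_divide_eq_right)
  qed
  finally show ?thesis .
qed

end

section \<open>Summation along a run\<close>

definition path_const :: "real \<Rightarrow> real \<Rightarrow> real" where
  "path_const C g = (1 + 10 * C ^ 10) * (12 * C * (g + 680 * C ^ 15)) + 10 * C ^ 10 + 2"

text \<open>The inner sum bounds the initial fourth moment and satisfies the recursion of
  \<open>iter_size_moment\<close>; the outer factors translate back to the size of the
  iterates.\<close>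

definition moment_const :: "real \<Rightarrow> real \<Rightarrow> real \<Rightarrow> real" where
  "moment_const C k m = 8 * (1 + C ^ 8 * (16 * C ^ 8 * m + 200000 * C ^ 16 * (1 + k)))"

text \<open>Convexity of the fourth power with weights \<open>3 / 5\<close> and \<open>2 / 5\<close>
  at the points \<open>a\<close> and \<open>5 / 2 * b\<close>; the resulting
  \<open>(5 / 2) ^ 3\<close> is below 16.\<close>

lemma convex_power4:
  fixes a b :: real
  assumes "0 \<le> a" "0 \<le> b"
  shows "(3 / 5 * a + b) ^ 4 \<le> 3 / 5 * a ^ 4 + 16 * b ^ 4"
proof -
  have sq: "(3 / 5 * x + 2 / 5 * y)\<^sup>2 \<le> 3 / 5 * x\<^sup>2 + 2 / 5 * y\<^sup>2" for x y :: real
  proof -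
    have "0 \<le> 6 / 25 * (x - y)\<^sup>2" by simp
    then show ?thesis by (simp add: power2_eq_square algebra_simps)
  qed
  define y where "y = 5 / 2 * b"
  have "((3 / 5 * a + 2 / 5 * y)\<^sup>2)\<^sup>2 \<le> (3 / 5 * a\<^sup>2 + 2 / 5 * y\<^sup>2)\<^sup>2" by (intro power_mono sq) simp
  also have "\<dots> \<le> 3 / 5 * (a\<^sup>2)\<^sup>2 + 2 / 5 * (y\<^sup>2)\<^sup>2" by (rule sq)
  finally have "(3 / 5 * a + b) ^ 4 \<le> 3 / 5 * a ^ 4 + 2 / 5 * (5 / 2 * b) ^ 4" by (simp add: y_def)
  also have "2 / 5 * (5 / 2 * b) ^ 4 \<le> 16 * b ^ 4"
    by (simp add: power_mult_distrib power_divide zero_le_even_power)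
  finally show ?thesis by simp
qed

locale bellman_run =
  covered_run M \<phi> c P r \<rho> \<gamma> P\<^sub>0 r\<^sub>0 \<pi>\<^sub>0 \<nu>\<^sub>0 \<beta> \<eta>\<^sub>\<pi> \<eta>\<^sub>V \<kappa> \<alpha> M\<^sub>4 X \<rho>\<^sub>m +
  bellman_data \<phi> c P r \<gamma> \<beta> \<eta>\<^sub>\<pi> \<eta>\<^sub>V \<kappa> L C
  for M :: "'w measure" and \<phi> :: "real^'a::finite^'s::finite \<Rightarrow> ereal"
    and c P r \<rho> \<gamma> P\<^sub>0 r\<^sub>0 \<pi>\<^sub>0 \<nu>\<^sub>0 \<beta> \<eta>\<^sub>\<pi> \<eta>\<^sub>V \<kappa> \<alpha> M\<^sub>4 and X :: "('w, 's, 'a) run"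
    and \<rho>\<^sub>m L C :: real +
  fixes l m\<^sub>0 :: real
  assumes pi0_policy: "\<pi>\<^sub>0 \<in> policies" and phi_pi0: "\<phi> \<pi>\<^sub>0 \<noteq> \<infinity>"
    and phi_lower: "\<And>\<pi>. \<pi> \<in> policies \<Longrightarrow> ereal l \<le> \<phi> \<pi>"
    and nu0_sets: "sets \<nu>\<^sub>0 = sets borel"
    and init_moment: "(\<integral>\<^sup>+z. ennreal ((1 + norm (fst z) + norm (snd z)) ^ 4) \<partial>\<nu>\<^sub>0) \<le> ennreal m\<^sub>0" "0 \<le> m\<^sub>0"
begin

section \<open>Pathwise summation\<close>

lemma step_of_policy:
  assumes "\<omega> \<in> space M" "pol X k \<omega> \<in> policies" "\<phi> (pol X k \<omega>) \<noteq> \<infinity>"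
  shows "bellman_step \<phi> c P r \<gamma> \<beta> \<eta>\<^sub>\<pi> \<eta>\<^sub>V \<kappa> L C (P_hat P\<^sub>0 X k \<omega>) (r_hat r\<^sub>0 X k \<omega>)
    (pol X k \<omega>) (val X k \<omega>) (mult X k \<omega>) (pol X (Suc k) \<omega>) (val X (Suc k) \<omega>) (mult X (Suc k) \<omega>)"
  using assms P_hat_prob kappa_hat pol_step val_step mult_step by unfold_locales auto

text \<open>Feasibility and finiteness propagate: the step analysis presupposes them for the current
  policy and yields them for the next.\<close>

lemma pol_policy: "\<omega> \<in> space M \<Longrightarrow> pol X k \<omega> \<in> policies \<and> \<phi> (pol X k \<omega>) \<noteq> \<infinity>"
proof (induction k)
  case 0
  then show ?case using pol_0 pi0_policy phi_pi0 by simp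
next
  case (Suc k)
  then interpret S: bellman_step \<phi> c P r \<gamma> \<beta> \<eta>\<^sub>\<pi> \<eta>\<^sub>V \<kappa> L C "P_hat P\<^sub>0 X k \<omega>" "r_hat r\<^sub>0 X k \<omega>"
    "pol X k \<omega>" "val X k \<omega>" "mult X k \<omega>" "pol X (Suc k) \<omega>" "val X (Suc k) \<omega>" "mult X (Suc k) \<omega>"
    by (intro step_of_policy) auto
  show ?case using S.pi'_policy S.phi_pi'_finite by auto
qed

lemma step:
  "\<omega> \<in> space M \<Longrightarrow> bellman_step \<phi> c P r \<gamma> \<beta> \<eta>\<^sub>\<pi> \<eta>\<^sub>V \<kappa> L C (P_hat P\<^sub>0 X k \<omega>) (r_hat r\<^sub>0 X k \<omega>)
    (pol X k \<omega>) (val X k \<omega>) (mult X k \<omega>) (pol X (Suc k) \<omega>) (val X (Suc k) \<omega>) (mult X (Suc k) \<omega>)"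
  using pol_policy step_of_policy by blast

definition iter_size :: "nat \<Rightarrow> 'w \<Rightarrow> real" where
  "iter_size k \<omega> = 1 + norm (val X k \<omega>) + norm (mult X k \<omega>)"

definition noise_level :: "nat \<Rightarrow> 'w \<Rightarrow> real" where
  "noise_level k \<omega> = model_err k \<omega> * (1 + model_err k \<omega>) * (iter_size k \<omega>)\<^sup>2"

definition primal_move :: "nat \<Rightarrow> 'w \<Rightarrow> real" where
  "primal_move k \<omega> = (norm (pol X (Suc k) \<omega> - pol X k \<omega>))\<^sup>2 + (norm (val X (Suc k) \<omega> - val X k \<omega>))\<^sup>2"

definition dual_move :: "nat \<Rightarrow> 'w \<Rightarrow> real" where
  "dual_move k \<omega> = (norm (mult X (Suc k) \<omega> - mult X k \<omega>))\<^sup>2"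

definition lyapunov :: "nat \<Rightarrow> 'w \<Rightarrow> real" where
  "lyapunov k \<omega> = real_of_ereal (\<phi> (pol X k \<omega>)) + smooth_lag c \<gamma> \<beta> P r (pol X k \<omega>) (val X k \<omega>) (mult X k \<omega>)"

definition residual_bound :: "nat \<Rightarrow> 'w \<Rightarrow> real" where
  "residual_bound k \<omega> = 108 * C ^ 6 * (primal_move k \<omega> + dual_move k \<omega> + (noise_level k \<omega>)\<^sup>2)"

lemma iter_size_ge_1: "1 \<le> iter_size k \<omega>"
  by (simp add: iter_size_def)

lemma moves_nonneg: "0 \<le> primal_move k \<omega>" "0 \<le> dual_move k \<omega>"
  by (simp_all add: primal_move_def dual_move_def)

lemma companion_residual_le:
  assumes "\<omega> \<in> space M"
  shows "companion_residual \<phi> c P r \<gamma> \<beta> P\<^sub>0 r\<^sub>0 X k \<omega> \<le> ennreal (residual_bound k \<omega>)"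
proof -
  interpret S: bellman_step \<phi> c P r \<gamma> \<beta> \<eta>\<^sub>\<pi> \<eta>\<^sub>V \<kappa> L C "P_hat P\<^sub>0 X k \<omega>" "r_hat r\<^sub>0 X k \<omega>"
    "pol X k \<omega>" "val X k \<omega>" "mult X k \<omega>" "pol X (Suc k) \<omega>" "val X (Suc k) \<omega>" "mult X (Suc k) \<omega>"
    by (rule step[OF assms])
  show ?thesis
    using S.companion_residual_bound
    by (simp add: companion_residual_def companion_mult_def residual_bound_def primal_move_def
        dual_move_def noise_level_def iter_size_def)
qed

lemma model_err_le_noise: "model_err k \<omega> \<le> noise_level k \<omega>"
proof -
  have e: "0 \<le> model_err k \<omega>" by (rule model_error_nonneg)
  have "model_err k \<omega> * 1 * 1 \<le> model_err k \<omega> * (1 + model_err k \<omega>) * (iter_size k \<omega>)\<^sup>2"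
    using e iter_size_ge_1[of k \<omega>] by (intro mult_mono) auto
  then show ?thesis by (simp add: noise_level_def)
qed

lemma lyapunov_first:
  assumes "\<omega> \<in> space M"
  shows "lyapunov 1 \<omega> + (norm (val X 1 \<omega> - val X 0 \<omega>))\<^sup>2 / (6 * \<eta>\<^sub>V)
    \<le> lyapunov 0 \<omega> - primal_move 0 \<omega> / (12 * C) + 2 * C * dual_move 0 \<omega> + 335 * C ^ 15 * (noise_level 0 \<omega>)\<^sup>2"
proof -
  interpret S: bellman_step \<phi> c P r \<gamma> \<beta> \<eta>\<^sub>\<pi> \<eta>\<^sub>V \<kappa> L C "P_hat P\<^sub>0 X 0 \<omega>" "r_hat r\<^sub>0 X 0 \<omega>"
    "pol X 0 \<omega>" "val X 0 \<omega>" "mult X 0 \<omega>" "pol X (Suc 0) \<omega>" "val X (Suc 0) \<omega>" "mult X (Suc 0) \<omega>"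
    by (rule step[OF assms])
  show ?thesis
    using S.initial_descent by (simp add: lyapunov_def primal_move_def dual_move_def noise_level_def iter_size_def)
qed

text \<open>Two consecutive steps are combined; the optimality condition of the earlier value step
  is what allows the later multiplier increment to be estimated.\<close>

lemma lyapunov_step:
  assumes "\<omega> \<in> space M"
  shows "lyapunov (Suc (Suc k)) \<omega> + (norm (val X (Suc (Suc k)) \<omega> - val X (Suc k) \<omega>))\<^sup>2 / (6 * \<eta>\<^sub>V)
    \<le> lyapunov (Suc k) \<omega> + (norm (val X (Suc k) \<omega> - val X k \<omega>))\<^sup>2 / (6 * \<eta>\<^sub>V)
      - primal_move (Suc k) \<omega> / (12 * C) + 335 * C ^ 15 * ((noise_level (Suc k) \<omega>)\<^sup>2 + (noise_level k \<omega>)\<^sup>2)"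
    and "dual_move (Suc k) \<omega> \<le> 5 * C ^ 10 * (primal_move (Suc k) \<omega> + primal_move k \<omega>
      + (noise_level (Suc k) \<omega>)\<^sup>2 + (noise_level k \<omega>)\<^sup>2)"
proof -
  interpret S: bellman_step \<phi> c P r \<gamma> \<beta> \<eta>\<^sub>\<pi> \<eta>\<^sub>V \<kappa> L C "P_hat P\<^sub>0 X k \<omega>" "r_hat r\<^sub>0 X k \<omega>"
    "pol X k \<omega>" "val X k \<omega>" "mult X k \<omega>" "pol X (Suc k) \<omega>" "val X (Suc k) \<omega>" "mult X (Suc k) \<omega>"
    by (rule step[OF assms])
  interpret S': bellman_step \<phi> c P r \<gamma> \<beta> \<eta>\<^sub>\<pi> \<eta>\<^sub>V \<kappa> L C "P_hat P\<^sub>0 X (Suc k) \<omega>" "r_hat r\<^sub>0 X (Suc k) \<omega>"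
    "pol X (Suc k) \<omega>" "val X (Suc k) \<omega>" "mult X (Suc k) \<omega>"
    "pol X (Suc (Suc k)) \<omega>" "val X (Suc (Suc k)) \<omega>" "mult X (Suc (Suc k)) \<omega>"
    by (rule step[OF assms])
  have e: "(model_err k \<omega>)\<^sup>2 \<le> (noise_level k \<omega>)\<^sup>2"
    by (intro power_mono model_err_le_noise model_error_nonneg)
  have C0: "0 \<le> C" using C_ge by simp
  note prev = P_hat_prob kappa_hat[OF assms S.pi'_policy] S.value_gradient
  have "335 * C ^ 15 * ((noise_level (Suc k) \<omega>)\<^sup>2 + (model_err k \<omega>)\<^sup>2)
      \<le> 335 * C ^ 15 * ((noise_level (Suc k) \<omega>)\<^sup>2 + (noise_level k \<omega>)\<^sup>2)"
    using e C0 by (intro mult_left_mono) auto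
  then show "lyapunov (Suc (Suc k)) \<omega> + (norm (val X (Suc (Suc k)) \<omega> - val X (Suc k) \<omega>))\<^sup>2 / (6 * \<eta>\<^sub>V)
    \<le> lyapunov (Suc k) \<omega> + (norm (val X (Suc k) \<omega> - val X k \<omega>))\<^sup>2 / (6 * \<eta>\<^sub>V)
      - primal_move (Suc k) \<omega> / (12 * C) + 335 * C ^ 15 * ((noise_level (Suc k) \<omega>)\<^sup>2 + (noise_level k \<omega>)\<^sup>2)"
    using S'.potential_descent[OF prev, of "r_hat r\<^sub>0 X k \<omega>"]
    unfolding lyapunov_def primal_move_def noise_level_def[of "Suc k"] iter_size_def by linarith
  have "5 * C ^ 10 * (primal_move (Suc k) \<omega> + (norm (val X (Suc k) \<omega> - val X k \<omega>))\<^sup>2 + (noise_level (Suc k) \<omega>)\<^sup>2 + (model_err k \<omega>)\<^sup>2)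
      \<le> 5 * C ^ 10 * (primal_move (Suc k) \<omega> + primal_move k \<omega> + (noise_level (Suc k) \<omega>)\<^sup>2 + (noise_level k \<omega>)\<^sup>2)"
    using e C0 by (intro mult_left_mono) (auto simp: primal_move_def[of k] intro: add_increasing)
  then show "dual_move (Suc k) \<omega> \<le> 5 * C ^ 10 * (primal_move (Suc k) \<omega> + primal_move k \<omega>
      + (noise_level (Suc k) \<omega>)\<^sup>2 + (noise_level k \<omega>)\<^sup>2)"
    using S'.dual_increment_C[OF prev, of "r_hat r\<^sub>0 X k \<omega>"]
    unfolding dual_move_def primal_move_def[of "Suc k"] noise_level_def[of "Suc k"] iter_size_def by linarith
qed

text \<open>Telescoping. A noise level is charged in its own step and, through the multiplier
  difference, in the next one; hence the two sums.\<close>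

lemma lyapunov_sum:
  assumes "\<omega> \<in> space M"
  shows "lyapunov (Suc n) \<omega> + (norm (val X (Suc n) \<omega> - val X n \<omega>))\<^sup>2 / (6 * \<eta>\<^sub>V) + (\<Sum>k<Suc n. primal_move k \<omega>) / (12 * C)
    \<le> lyapunov 0 \<omega> + 2 * C * dual_move 0 \<omega>
      + 335 * C ^ 15 * ((\<Sum>k<Suc n. (noise_level k \<omega>)\<^sup>2) + (\<Sum>k<n. (noise_level k \<omega>)\<^sup>2))"
proof (induction n)
  case 0
  then show ?case using lyapunov_first[OF assms] by simp
next
  case (Suc n)
  then show ?case using lyapunov_step(1)[OF assms, of n] by (simp add: add_divide_distrib algebra_simps)
qed

lemma dual_sum:
  assumes "\<omega> \<in> space M"
  shows "(\<Sum>k<Suc n. dual_move k \<omega>) \<le> dual_move 0 \<omega>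
    + 10 * C ^ 10 * ((\<Sum>k<Suc n. primal_move k \<omega>) + (\<Sum>k<Suc n. (noise_level k \<omega>)\<^sup>2))"
proof -
  have "(\<Sum>k<Suc n. dual_move k \<omega>) = dual_move 0 \<omega> + (\<Sum>k<n. dual_move (Suc k) \<omega>)"
    by (rule sum.lessThan_Suc_shift)
  also have "(\<Sum>k<n. dual_move (Suc k) \<omega>) \<le> (\<Sum>k<n. 5 * C ^ 10 * (primal_move (Suc k) \<omega> + primal_move k \<omega>
      + (noise_level (Suc k) \<omega>)\<^sup>2 + (noise_level k \<omega>)\<^sup>2))"
    by (intro sum_mono lyapunov_step(2) assms)
  also have "\<dots> = 5 * C ^ 10 * ((\<Sum>k<n. primal_move (Suc k) \<omega>) + (\<Sum>k<n. primal_move k \<omega>)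
      + (\<Sum>k<n. (noise_level (Suc k) \<omega>)\<^sup>2) + (\<Sum>k<n. (noise_level k \<omega>)\<^sup>2))"
    by (simp only: sum_distrib_left[symmetric] sum.distrib)
  also have "\<dots> \<le> 5 * C ^ 10 * ((\<Sum>k<Suc n. primal_move k \<omega>) + (\<Sum>k<Suc n. primal_move k \<omega>)
      + (\<Sum>k<Suc n. (noise_level k \<omega>)\<^sup>2) + (\<Sum>k<Suc n. (noise_level k \<omega>)\<^sup>2))"
  proof (intro mult_left_mono add_mono)
    show "(\<Sum>k<n. primal_move (Suc k) \<omega>) \<le> (\<Sum>k<Suc n. primal_move k \<omega>)"
      using moves_nonneg(1)[of 0 \<omega>] by (simp only: sum.lessThan_Suc_shift)
    show "(\<Sum>k<n. (noise_level (Suc k) \<omega>)\<^sup>2) \<le> (\<Sum>k<Suc n. (noise_level k \<omega>)\<^sup>2)"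
      by (simp only: sum.lessThan_Suc_shift) simp
  qed (use moves_nonneg C_ge in auto)
  finally show ?thesis by (simp add: algebra_simps)
qed

text \<open>The potential at the end is bounded below by the infimum of \<phi> and the squared size
  of the last iterate, and the first multiplier increment by the sizes of the first two iterates.
  The number of steps enters only through the sum of noise levels.\<close>

lemma path_bound:
  assumes \<omega>: "\<omega> \<in> space M" and T: "1 \<le> T"
  shows "(\<Sum>k<T. primal_move k \<omega> + dual_move k \<omega>)
    \<le> path_const C \<bar>real_of_ereal (\<phi> \<pi>\<^sub>0) - l\<bar>
        * (1 + (iter_size 0 \<omega>)\<^sup>2 + (iter_size 1 \<omega>)\<^sup>2 + (iter_size T \<omega>)\<^sup>2 + (\<Sum>k<T. (noise_level k \<omega>)\<^sup>2))"
proof -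
  obtain n where n: "T = Suc n" using T by (cases T) auto
  define g where "g = \<bar>real_of_ereal (\<phi> \<pi>\<^sub>0) - l\<bar>"
  define SD where "SD = (\<Sum>k<T. primal_move k \<omega>)"
  define Sx where "Sx = (\<Sum>k<T. (noise_level k \<omega>)\<^sup>2)"
  define s0 s1 sT where "s0 = (iter_size 0 \<omega>)\<^sup>2" "s1 = (iter_size 1 \<omega>)\<^sup>2" "sT = (iter_size T \<omega>)\<^sup>2"
  define H where "H = 1 + s0 + s1 + sT + Sx"
  have C1: "1 \<le> C" using C_ge by simp
  have s: "0 \<le> s0" "0 \<le> s1" "0 \<le> sT" "0 \<le> Sx" "0 \<le> g"
    by (simp_all add: s0_s1_sT_def Sx_def sum_nonneg g_def)
  have H: "1 \<le> H" "s0 + sT \<le> H" "s0 + s1 \<le> H" "Sx \<le> H" using s by (simp_all add: H_def)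
  have dual0: "dual_move 0 \<omega> \<le> 2 * (s0 + s1)"
  proof -
    have "norm (mult X 1 \<omega> - mult X 0 \<omega>) \<le> iter_size 1 \<omega> + iter_size 0 \<omega>"
      using norm_triangle_ineq4[of "mult X 1 \<omega>" "mult X 0 \<omega>"]
        norm_ge_zero[of "val X 1 \<omega>"] norm_ge_zero[of "val X 0 \<omega>"]
      unfolding iter_size_def by linarith
    then have "dual_move 0 \<omega> \<le> (iter_size 1 \<omega> + iter_size 0 \<omega>)\<^sup>2"
      unfolding dual_move_def by (intro power_mono) auto
    also have "\<dots> \<le> 2 * (s0 + s1)"
      using sum_squares_bound[of "iter_size 1 \<omega>" "iter_size 0 \<omega>"] by (simp add: power2_sum s0_s1_sT_def)
    finally show ?thesis .
  qed
  have lag: "\<bar>smooth_lag c \<gamma> \<beta> P r (pol X k \<omega>) (val X k \<omega>) (mult X k \<omega>)\<bar> \<le> 3 * C ^ 3 * (iter_size k \<omega>)\<^sup>2" for k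
    using smooth_lag_bound pol_policy[OF \<omega>] by (simp add: iter_size_def)
  have "ereal l \<le> \<phi> (pol X T \<omega>)" using phi_lower pol_policy[OF \<omega>] by blast
  then have lT: "l \<le> real_of_ereal (\<phi> (pol X T \<omega>))"
    using pol_policy[OF \<omega>, of T] by (cases "\<phi> (pol X T \<omega>)") auto
  \<comment> \<open>The initial policy is deterministic, so the gap between its objective and the
    lower bound \<open>l\<close> is one number for all runs.\<close>
  have L0: "lyapunov 0 \<omega> - lyapunov T \<omega> \<le> g + 3 * C ^ 3 * (s0 + sT)"
    using lag[of 0] lag[of T] lT pol_0[OF \<omega>]
    unfolding lyapunov_def g_def s0_s1_sT_def distrib_left by (simp add: abs_le_iff) argo
  have sub: "(\<Sum>k<n. (noise_level k \<omega>)\<^sup>2) \<le> Sx" by (simp add: Sx_def n)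
  have v0: "0 \<le> (norm (val X (Suc n) \<omega> - val X n \<omega>))\<^sup>2 / (6 * \<eta>\<^sub>V)" using steps_pos by simp
  have "SD / (12 * C) \<le> (lyapunov 0 \<omega> - lyapunov T \<omega>) + 2 * C * dual_move 0 \<omega>
      + 335 * C ^ 15 * (Sx + (\<Sum>k<n. (noise_level k \<omega>)\<^sup>2))"
    using lyapunov_sum[OF \<omega>, of n] v0 unfolding SD_def Sx_def n by argo
  also have "\<dots> \<le> (g + 3 * C ^ 3 * (s0 + sT)) + 2 * C * (2 * (s0 + s1)) + 335 * C ^ 15 * (Sx + Sx)"
    using C1 by (intro add_mono mult_left_mono L0 dual0 sub) auto
  also have "\<dots> \<le> (g * H + 3 * C ^ 15 * H) + 4 * C ^ 15 * H + 670 * C ^ 15 * H"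
  proof -
    have "g * 1 \<le> g * H" using s H by (intro mult_left_mono)
    moreover have "3 * C ^ 3 * (s0 + sT) \<le> 3 * C ^ 15 * H"
      using C1 H s by (intro mult_mono power_increasing) auto
    moreover have "4 * C * (s0 + s1) \<le> 4 * C ^ 15 * H"
      using C1 H s by (intro mult_mono self_le_power) auto
    moreover have "670 * C ^ 15 * Sx \<le> 670 * C ^ 15 * H"
      using C1 H by (intro mult_left_mono) auto
    moreover have "2 * C * (2 * (s0 + s1)) = 4 * C * (s0 + s1)" "335 * C ^ 15 * (Sx + Sx) = 670 * C ^ 15 * Sx"
      by simp_all
    ultimately show ?thesis by linarith
  qed
  also have "\<dots> \<le> (g + 680 * C ^ 15) * H"
    using H C1 by (simp add: distrib_right)
  finally have "SD \<le> (12 * C * (g + 680 * C ^ 15)) * H"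
    using C1 by (simp add: pos_divide_le_eq mult_ac)
  then have 1: "(1 + 10 * C ^ 10) * SD \<le> (1 + 10 * C ^ 10) * ((12 * C * (g + 680 * C ^ 15)) * H)"
    using C1 by (intro mult_left_mono) auto
  have "(\<Sum>k<T. dual_move k \<omega>) \<le> dual_move 0 \<omega> + 10 * C ^ 10 * (SD + Sx)"
    using dual_sum[OF \<omega>, of n] by (simp only: n SD_def Sx_def)
  also have "\<dots> \<le> 2 * H + 10 * C ^ 10 * (SD + H)"
    using C1 H dual0 by (intro add_mono mult_left_mono) auto
  finally have 2: "(\<Sum>k<T. dual_move k \<omega>) \<le> 2 * H + 10 * C ^ 10 * (SD + H)" .
  have "(\<Sum>k<T. primal_move k \<omega> + dual_move k \<omega>) \<le> path_const C g * H"
    using 1 2 unfolding sum.distrib SD_def[symmetric] path_const_def by (simp add: distrib_right distrib_left mult.assoc)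
  then show ?thesis by (simp add: H_def g_def s0_s1_sT_def Sx_def add.assoc)
qed

section \<open>Measurability along the run\<close>

lemma hist_mono0: "i \<le> k \<Longrightarrow> sets (hist X i 0) \<subseteq> sets (hist X k 0)"
  and hist_batch: "t \<le> batch X k \<Longrightarrow> sets (hist X k 0) \<subseteq> sets (hist X k t)"
proof -
  show *: "t \<le> batch X k \<Longrightarrow> sets (hist X k 0) \<subseteq> sets (hist X k t)" for t k
  proof (induction t)
    case (Suc t)
    then show ?case using hist_pre[of t k] pre_hist[of t k] by auto
  qed simp
  show "i \<le> k \<Longrightarrow> sets (hist X i 0) \<subseteq> sets (hist X k 0)"
  proof (induction k rule: dec_induct)
    case (step k)
    then show ?case using *[of "batch X k" k] hist_next[of k] by auto
  qed simp
qed

lemma measurable_hist_mono: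
  "f \<in> borel_measurable (hist X i s) \<Longrightarrow> sets (hist X i s) \<subseteq> sets (hist X k t) \<Longrightarrow> f \<in> borel_measurable (hist X k t)"
  using space_hist by (auto simp: measurable_def)

lemma iter_size_meas: "iter_size k \<in> borel_measurable (hist X k 0)"
proof -
  note [measurable] = val_meas[of k] mult_meas[of k]
  show ?thesis unfolding iter_size_def by measurable
qed

lemma iter_size_meas_M [measurable]: "iter_size k \<in> borel_measurable M"
  by (rule measurable_from_subalg[OF subalg_hist iter_size_meas])

lemma model_err_meas_next: "model_err k \<in> borel_measurable (hist X (Suc k) 0)"
  by (rule measurable_hist_mono[OF model_err_meas hist_next])

lemma model_err_meas_M [measurable]: "model_err k \<in> borel_measurable M"
  by (rule measurable_from_subalg[OF subalg_hist model_err_meas])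

lemma noise_level_meas_M [measurable]: "noise_level k \<in> borel_measurable M"
  unfolding noise_level_def by measurable

text \<open>The residual of the companion iterate involves a distance to a limiting subdifferential
  and is only dominated; this measurable majorant is what the independence of the random index is
  applied to.\<close>

lemma residual_bound_meas: "residual_bound k \<in> borel_measurable (hist X (Suc k) 0)"
proof -
  have s: "sets (hist X k 0) \<subseteq> sets (hist X (Suc k) 0)" by (rule hist_mono0) simp
  note [measurable] = measurable_hist_mono[OF iter_size_meas s] model_err_meas_next
    pol_meas[of "Suc k"] val_meas[of "Suc k"] mult_meas[of "Suc k"]
  have [measurable]: "pol X k \<in> borel_measurable (hist X (Suc k) 0)" "val X k \<in> borel_measurable (hist X (Suc k) 0)"
    "mult X k \<in> borel_measurable (hist X (Suc k) 0)"
    using pol_meas[of k] val_meas[of k] mult_meas[of k] s space_hist by (auto simp: measurable_def)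
  show ?thesis
    unfolding residual_bound_def primal_move_def dual_move_def noise_level_def by measurable
qed

lemma residual_bound_meas_M [measurable]: "residual_bound k \<in> borel_measurable M"
  by (rule measurable_from_subalg[OF subalg_hist residual_bound_meas])

section \<open>Uniform moments of iterates and noise\<close>

abbreviation "k\<^sub>4 \<equiv> \<bar>K\<^sub>4\<bar>"
abbreviation "m\<^sub>4 \<equiv> moment_const C k\<^sub>4 m\<^sub>0"

lemma weighted_model_err4':
  assumes "w \<in> borel_measurable (hist X k 0)"
  shows "(\<integral>\<^sup>+\<omega>. w \<omega> * ennreal (model_err k \<omega> ^ 4) \<partial>M) \<le> ennreal (k\<^sub>4 / (real (batch X k))\<^sup>2) * (\<integral>\<^sup>+\<omega>. w \<omega> \<partial>M)"
  by (rule order_trans[OF weighted_model_err4[OF assms]])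
    (intro mult_right_mono ennreal_leI divide_right_mono; simp)

lemma m4_nonneg: "0 \<le> m\<^sub>4"
  using C_ge init_moment(2) by (simp add: moment_const_def)

text \<open>The norm in which \<open>contraction\<close> holds is raised to the fourth power. The
  model error has bounded fourth moment in every batch because batches are nonempty, so the
  recursion has factor \<open>3 / 5\<close> and a constant input.\<close>

lemma iter_size_moment: "(\<integral>\<^sup>+\<omega>. ennreal (iter_size k \<omega> ^ 4) \<partial>M) \<le> ennreal m\<^sub>4"
proof -
  have C1: "1 \<le> C" and C0: "0 \<le> C" using C_ge by auto
  have [measurable]: "val X k \<in> borel_measurable M" "mult X k \<in> borel_measurable M" for k
    using measurable_from_subalg[OF subalg_hist val_meas] measurable_from_subalg[OF subalg_hist mult_meas] by auto
  define W where "W k \<omega> = norm (val X k \<omega>) + 2 * (\<kappa> / \<beta> * norm (mult X k \<omega>))" for k \<omega>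
  define Y where "Y = 16 * C ^ 8 * m\<^sub>0 + 200000 * C ^ 16 * (1 + k\<^sub>4)"
  have [measurable]: "W k \<in> borel_measurable M" for k unfolding W_def by measurable
  have W0: "0 \<le> W k \<omega>" for k \<omega> using kappa_pos steps_pos by (simp add: W_def)
  have Y0: "0 \<le> Y" using C1 init_moment(2) by (simp add: Y_def)
  have start: "(\<integral>\<^sup>+\<omega>. ennreal (W 0 \<omega> ^ 4) \<partial>M) \<le> ennreal Y"
  proof -
    have "W 0 \<omega> \<le> 2 * C\<^sup>2 * iter_size 0 \<omega>" for \<omega>
    proof -
      have "\<kappa> * (1 / \<beta>) \<le> C * C" using kappa_pos C_ge steps_pos by (intro mult_mono) auto
      then have "2 * (\<kappa> / \<beta> * norm (mult X 0 \<omega>)) \<le> 2 * (C\<^sup>2 * norm (mult X 0 \<omega>))"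
        by (intro mult_left_mono mult_right_mono) (auto simp: power2_eq_square)
      moreover have "1 * norm (val X 0 \<omega>) \<le> 2 * C\<^sup>2 * norm (val X 0 \<omega>)"
        using one_le_power[OF C1, of 2] by (intro mult_right_mono) auto
      moreover have "0 \<le> 2 * C\<^sup>2" by simp
      ultimately show ?thesis unfolding W_def iter_size_def distrib_left by linarith
    qed
    then have "W 0 \<omega> ^ 4 \<le> (2 * C\<^sup>2 * iter_size 0 \<omega>) ^ 4" for \<omega> by (intro power_mono W0)
    then have "(\<integral>\<^sup>+\<omega>. ennreal (W 0 \<omega> ^ 4) \<partial>M) \<le> (\<integral>\<^sup>+\<omega>. ennreal (16 * C ^ 8) * ennreal (iter_size 0 \<omega> ^ 4) \<partial>M)"
      using C0 by (intro nn_integral_mono)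
        (simp add: ennreal_mult[symmetric] zero_le_even_power ennreal_leI power_mult_distrib power_mult[symmetric])
    also have "\<dots> = ennreal (16 * C ^ 8) * (\<integral>\<^sup>+\<omega>. ennreal (iter_size 0 \<omega> ^ 4) \<partial>M)"
      by (rule nn_integral_cmult) measurable
    also have "(\<integral>\<^sup>+\<omega>. ennreal (iter_size 0 \<omega> ^ 4) \<partial>M)
        = (\<integral>\<^sup>+z. ennreal ((1 + norm (fst z) + norm (snd z)) ^ 4) \<partial>distr M borel (\<lambda>\<omega>. (val X 0 \<omega>, mult X 0 \<omega>)))"
      by (subst nn_integral_distr) (simp_all add: iter_size_def borel_prod[symmetric])
    also have "\<dots> \<le> ennreal m\<^sub>0" unfolding val_mult_0 by (rule init_moment(1))
    also have "ennreal (16 * C ^ 8) * ennreal m\<^sub>0 = ennreal (16 * C ^ 8 * m\<^sub>0)"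
      using C0 init_moment(2) by (simp add: ennreal_mult)
    also have "\<dots> \<le> ennreal Y" using C0 by (intro ennreal_leI) (simp add: Y_def)
    finally show ?thesis by (simp add: mult_left_mono)
  qed
  have err4: "(\<integral>\<^sup>+\<omega>. ennreal (model_err k \<omega> ^ 4) \<partial>M) \<le> ennreal k\<^sub>4" for k
  proof -
    have "(\<integral>\<^sup>+\<omega>. ennreal (model_err k \<omega> ^ 4) \<partial>M) \<le> ennreal (k\<^sub>4 / (real (batch X k))\<^sup>2)"
      using weighted_model_err4'[of "\<lambda>_. 1" k] by (simp add: emeasure_space_1)
    also have "\<dots> \<le> ennreal (k\<^sub>4 / 1)"
      using batch_pos[of k] by (intro ennreal_leI divide_left_mono) auto
    finally show ?thesis by simp
  qed
  have "(\<integral>\<^sup>+\<omega>. ennreal (W k \<omega> ^ 4) \<partial>M) \<le> ennreal Y" for k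
  proof (induction k)
    case 0
    show ?case by (rule start)
  next
    case (Suc k)
    have le: "W (Suc k) \<omega> ^ 4 \<le> 3 / 5 * W k \<omega> ^ 4 + 80000 * C ^ 16 * (1 + model_err k \<omega> ^ 4)" if \<omega>: "\<omega> \<in> space M" for \<omega>
    proof -
      interpret S: bellman_step \<phi> c P r \<gamma> \<beta> \<eta>\<^sub>\<pi> \<eta>\<^sub>V \<kappa> L C "P_hat P\<^sub>0 X k \<omega>" "r_hat r\<^sub>0 X k \<omega>"
        "pol X k \<omega>" "val X k \<omega>" "mult X k \<omega>" "pol X (Suc k) \<omega>" "val X (Suc k) \<omega>" "mult X (Suc k) \<omega>"
        by (rule step[OF \<omega>])
      have e: "0 \<le> 5 * C ^ 4 * (1 + model_err k \<omega>)" using S.e_nonneg C0 by simp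
      have "W (Suc k) \<omega> ^ 4 \<le> (3 / 5 * W k \<omega> + 5 * C ^ 4 * (1 + model_err k \<omega>)) ^ 4"
        by (intro power_mono W0) (use S.contraction in \<open>simp add: W_def\<close>)
      also have "\<dots> \<le> 3 / 5 * W k \<omega> ^ 4 + 16 * (5 * C ^ 4 * (1 + model_err k \<omega>)) ^ 4"
        by (rule convex_power4[OF W0 e])
      also have "16 * (5 * C ^ 4 * (1 + model_err k \<omega>)) ^ 4 = 10000 * C ^ 16 * (1 + model_err k \<omega>) ^ 4"
        by (simp add: power_mult_distrib flip: power_mult)
      also have "\<dots> \<le> 10000 * C ^ 16 * (8 * (1 ^ 4 + model_err k \<omega> ^ 4))"
        using C0 by (intro mult_left_mono power4_add_le) auto
      finally show ?thesis by (simp add: algebra_simps)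
    qed
    have "(\<integral>\<^sup>+\<omega>. ennreal (W (Suc k) \<omega> ^ 4) \<partial>M)
        \<le> (\<integral>\<^sup>+\<omega>. ennreal (3 / 5) * ennreal (W k \<omega> ^ 4) + ennreal (80000 * C ^ 16) * (1 + ennreal (model_err k \<omega> ^ 4)) \<partial>M)"
    proof (rule nn_integral_mono)
      fix \<omega> assume \<omega>: "\<omega> \<in> space M"
      have "ennreal (W (Suc k) \<omega> ^ 4) \<le> ennreal (3 / 5 * W k \<omega> ^ 4 + 80000 * C ^ 16 * (1 + model_err k \<omega> ^ 4))"
        by (intro ennreal_leI le \<omega>)
      also have "\<dots> = ennreal (3 / 5) * ennreal (W k \<omega> ^ 4) + ennreal (80000 * C ^ 16) * (1 + ennreal (model_err k \<omega> ^ 4))"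
      proof -
        have "0 \<le> (3 / 5 :: real)" "0 \<le> W k \<omega> ^ 4" "0 \<le> 80000 * C ^ 16" "0 \<le> model_err k \<omega> ^ 4"
          using C0 by (auto simp: zero_le_even_power)
        then show ?thesis
          by (simp only: ennreal_plus ennreal_mult mult_nonneg_nonneg add_nonneg_nonneg zero_le_one ennreal_1)
      qed
      finally show "ennreal (W (Suc k) \<omega> ^ 4) \<le> \<dots>" .
    qed
    also have "\<dots> = ennreal (3 / 5) * (\<integral>\<^sup>+\<omega>. ennreal (W k \<omega> ^ 4) \<partial>M) + ennreal (80000 * C ^ 16) * (1 + (\<integral>\<^sup>+\<omega>. ennreal (model_err k \<omega> ^ 4) \<partial>M))"
      by (simp add: nn_integral_add nn_integral_cmult emeasure_space_1)
    also have "\<dots> \<le> ennreal (3 / 5) * ennreal Y + ennreal (80000 * C ^ 16) * (1 + ennreal k\<^sub>4)"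
      by (intro add_mono mult_left_mono Suc.IH err4) auto
    also have "\<dots> = ennreal (3 / 5 * Y + 80000 * C ^ 16 * (1 + k\<^sub>4))"
    proof -
      have "0 \<le> (3 / 5 :: real)" "0 \<le> 80000 * C ^ 16" "0 \<le> k\<^sub>4" using C0 by auto
      with Y0 show ?thesis
        by (simp only: ennreal_plus ennreal_mult mult_nonneg_nonneg add_nonneg_nonneg zero_le_one ennreal_1)
    qed
    \<comment> \<open>The input \<open>80000 * C ^ 16 * (1 + k\<^sub>4)\<close> is
      \<open>2 / 5\<close> of the second summand of \<open>Y\<close>, so the bound reproduces
      itself.\<close>
    also have "\<dots> \<le> ennreal Y"
      using C0 init_moment(2) by (intro ennreal_leI) (simp add: Y_def)
    finally show ?case .
  qed
  note WY = this
  have le: "iter_size k \<omega> ^ 4 \<le> 8 * (1 + C ^ 8 * W k \<omega> ^ 4)" for \<omega>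
  proof -
    \<comment> \<open>The weighted norm controls the multiplier only because
      \<open>\<kappa> / \<beta>\<close> is bounded away from zero; this is the purpose of the bound
      on \<open>1 / \<kappa>\<close> in the data.\<close>
    have k1: "1 \<le> C\<^sup>2 * (2 * (\<kappa> / \<beta>))"
    proof -
      have "1 / \<kappa> * \<beta> \<le> C * C" using C_ge kappa_pos steps_pos by (intro mult_mono) auto
      then have "\<beta> \<le> C\<^sup>2 * \<kappa>" using kappa_pos by (simp add: power2_eq_square pos_divide_le_eq)
      then have "1 \<le> C\<^sup>2 * \<kappa> / \<beta>" using steps_pos by simp
      moreover have "C\<^sup>2 * (2 * (\<kappa> / \<beta>)) = 2 * (C\<^sup>2 * \<kappa> / \<beta>)" by simp
      ultimately show ?thesis by linarith
    qed
    have "1 * norm (mult X k \<omega>) \<le> C\<^sup>2 * (2 * (\<kappa> / \<beta>)) * norm (mult X k \<omega>)"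
      by (intro mult_right_mono k1) simp
    moreover have "1 * norm (val X k \<omega>) \<le> C\<^sup>2 * norm (val X k \<omega>)"
      using one_le_power[OF C1, of 2] by (intro mult_right_mono) auto
    ultimately have "iter_size k \<omega> \<le> 1 + C\<^sup>2 * W k \<omega>"
      unfolding iter_size_def W_def distrib_left mult.assoc by simp
    then have "iter_size k \<omega> ^ 4 \<le> (1 + C\<^sup>2 * W k \<omega>) ^ 4" using iter_size_ge_1[of k \<omega>] by (intro power_mono) auto
    also have "\<dots> \<le> 8 * (1 ^ 4 + (C\<^sup>2 * W k \<omega>) ^ 4)" by (rule power4_add_le)
    finally show ?thesis by (simp add: power_mult_distrib flip: power_mult)
  qed
  have "(\<integral>\<^sup>+\<omega>. ennreal (iter_size k \<omega> ^ 4) \<partial>M) \<le> (\<integral>\<^sup>+\<omega>. 8 * (1 + ennreal (C ^ 8) * ennreal (W k \<omega> ^ 4)) \<partial>M)"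
  proof (rule nn_integral_mono)
    fix \<omega>
    have "ennreal (iter_size k \<omega> ^ 4) \<le> ennreal (8 * (1 + C ^ 8 * W k \<omega> ^ 4))" by (intro ennreal_leI le)
    also have "\<dots> = 8 * (1 + ennreal (C ^ 8) * ennreal (W k \<omega> ^ 4))"
      using C0 by (simp add: ennreal_mult ennreal_plus zero_le_even_power)
    finally show "ennreal (iter_size k \<omega> ^ 4) \<le> \<dots>" .
  qed
  also have "\<dots> = 8 * (1 + ennreal (C ^ 8) * (\<integral>\<^sup>+\<omega>. ennreal (W k \<omega> ^ 4) \<partial>M))"
    by (simp add: nn_integral_add nn_integral_cmult emeasure_space_1)
  also have "\<dots> \<le> 8 * (1 + ennreal (C ^ 8) * ennreal Y)"
    by (intro mult_left_mono add_left_mono WY) auto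
  also have "\<dots> = ennreal m\<^sub>4"
    using C0 Y0 by (simp add: moment_const_def Y_def[symmetric] ennreal_mult ennreal_plus)
  finally show ?thesis .
qed

text \<open>A squared model error is traded for a fourth power with a weight depending on the batch:
  the fourth moment is of order \<open>1 / m\<^sup>2\<close>, so the factor \<open>m + 2\<close>
  still leaves order \<open>1 / m\<close>. The fourth power of the iterate size is the weight known
  before the batch.\<close>

lemma noise_level_moment:
  "(\<integral>\<^sup>+\<omega>. ennreal ((noise_level k \<omega>)\<^sup>2) \<partial>M) \<le> ennreal ((1 + 3 * k\<^sub>4) * m\<^sub>4 * (1 / real (batch X k)))"
proof -
  define m where "m = real (batch X k)"
  have m: "1 \<le> m" using batch_pos[of k] by (simp add: m_def)
  have le: "(noise_level k \<omega>)\<^sup>2 \<le> iter_size k \<omega> ^ 4 * (1 / m + (m + 2) * model_err k \<omega> ^ 4)" for \<omega>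
  proof -
    let ?e = "model_err k \<omega>"
    \<comment> \<open>Young's inequality balanced at \<open>?e\<^sup>2 = 1 / m\<close>, the expected
      order of the squared error.\<close>
    have "0 \<le> (m * ?e\<^sup>2 - 1)\<^sup>2 / m" using m by simp
    also have "\<dots> = m * ?e ^ 4 + 1 / m - 2 * ?e\<^sup>2"
      using m by (simp add: power2_eq_square power4_eq_xxxx field_simps)
    finally have 1: "2 * ?e\<^sup>2 \<le> 1 / m + m * ?e ^ 4" by simp
    have "(1 + ?e)\<^sup>2 \<le> 2 * (1 + ?e\<^sup>2)" using sum_squares_bound[of 1 ?e] by (simp add: power2_sum)
    then have "?e\<^sup>2 * (1 + ?e)\<^sup>2 \<le> ?e\<^sup>2 * (2 * (1 + ?e\<^sup>2))" by (intro mult_left_mono) auto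
    also have "\<dots> = 2 * ?e\<^sup>2 + 2 * ?e ^ 4" by (simp add: power2_eq_square power4_eq_xxxx algebra_simps)
    finally have 2: "?e\<^sup>2 * (1 + ?e)\<^sup>2 \<le> 1 / m + (m + 2) * ?e ^ 4" using 1 by (simp add: distrib_right)
    have "(noise_level k \<omega>)\<^sup>2 = iter_size k \<omega> ^ 4 * (?e\<^sup>2 * (1 + ?e)\<^sup>2)"
      by (simp add: noise_level_def power_mult_distrib flip: power_mult)
    also have "\<dots> \<le> iter_size k \<omega> ^ 4 * (1 / m + (m + 2) * ?e ^ 4)"
      by (intro mult_left_mono 2) (simp add: zero_le_even_power)
    finally show ?thesis .
  qed
  let ?w = "\<lambda>\<omega>. ennreal (iter_size k \<omega> ^ 4)"
  have wF: "?w \<in> borel_measurable (hist X k 0)" using iter_size_meas[of k] by measurable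
  have "(\<integral>\<^sup>+\<omega>. ennreal ((noise_level k \<omega>)\<^sup>2) \<partial>M)
      \<le> (\<integral>\<^sup>+\<omega>. ennreal (1 / m) * ?w \<omega> + ennreal (m + 2) * (?w \<omega> * ennreal (model_err k \<omega> ^ 4)) \<partial>M)"
  proof (rule nn_integral_mono)
    fix \<omega>
    have "ennreal ((noise_level k \<omega>)\<^sup>2) \<le> ennreal (1 / m * iter_size k \<omega> ^ 4 + (m + 2) * (iter_size k \<omega> ^ 4 * model_err k \<omega> ^ 4))"
      using le[of \<omega>] by (intro ennreal_leI) (simp add: algebra_simps)
    also have "\<dots> = ennreal (1 / m) * ?w \<omega> + ennreal (m + 2) * (?w \<omega> * ennreal (model_err k \<omega> ^ 4))"
    proof -
      have "0 \<le> 1 / m" "0 \<le> m + 2" "0 \<le> iter_size k \<omega> ^ 4" "0 \<le> model_err k \<omega> ^ 4"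
        using m by (auto simp: zero_le_even_power)
      then show ?thesis by (simp only: ennreal_plus ennreal_mult mult_nonneg_nonneg)
    qed
    finally show "ennreal ((noise_level k \<omega>)\<^sup>2) \<le> \<dots>" .
  qed
  also have "\<dots> = ennreal (1 / m) * (\<integral>\<^sup>+\<omega>. ?w \<omega> \<partial>M) + ennreal (m + 2) * (\<integral>\<^sup>+\<omega>. ?w \<omega> * ennreal (model_err k \<omega> ^ 4) \<partial>M)"
    by (simp add: nn_integral_add nn_integral_cmult)
  also have "\<dots> \<le> ennreal (1 / m) * ennreal m\<^sub>4 + ennreal (m + 2) * (ennreal (k\<^sub>4 / m\<^sup>2) * ennreal m\<^sub>4)"
    by (intro add_mono mult_left_mono iter_size_moment order_trans[OF weighted_model_err4'[OF wF]])
      (simp_all add: m_def mult_left_mono iter_size_moment)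
  also have "\<dots> = ennreal (1 / m * m\<^sub>4 + (m + 2) * (k\<^sub>4 / m\<^sup>2 * m\<^sub>4))"
  proof -
    have "0 \<le> 1 / m" "0 \<le> m + 2" "0 \<le> k\<^sub>4 / m\<^sup>2" using m by auto
    with m4_nonneg show ?thesis by (simp only: ennreal_plus ennreal_mult mult_nonneg_nonneg)
  qed
  also have "\<dots> \<le> ennreal ((1 + 3 * k\<^sub>4) * m\<^sub>4 * (1 / m))"
  proof (rule ennreal_leI)
    have "(m + 2) / m\<^sup>2 \<le> 3 * (1 / m)" using m by (simp add: power2_eq_square field_simps)
    then have "(m + 2) / m\<^sup>2 * (k\<^sub>4 * m\<^sub>4) \<le> 3 * (1 / m) * (k\<^sub>4 * m\<^sub>4)"
      using m4_nonneg by (intro mult_right_mono) auto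
    then show "1 / m * m\<^sub>4 + (m + 2) * (k\<^sub>4 / m\<^sup>2 * m\<^sub>4) \<le> (1 + 3 * k\<^sub>4) * m\<^sub>4 * (1 / m)"
      by (simp add: algebra_simps)
  qed
  finally show ?thesis by (simp add: m_def)
qed

section \<open>Summed residuals and the random index\<close>

definition run_A :: real where
  "run_A = 108 * C ^ 6 * path_const C \<bar>real_of_ereal (\<phi> \<pi>\<^sub>0) - l\<bar> * (1 + 3 * m\<^sub>4)"

definition run_B :: real where
  "run_B = 108 * C ^ 6 * (path_const C \<bar>real_of_ereal (\<phi> \<pi>\<^sub>0) - l\<bar> + 1) * ((1 + 3 * k\<^sub>4) * m\<^sub>4)"

lemma residual_sum:
  assumes T: "1 \<le> T"
  shows "(\<Sum>k<T. \<integral>\<^sup>+\<omega>. ennreal (residual_bound k \<omega>) \<partial>M)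
    \<le> ennreal (run_A + run_B * (\<Sum>k<T. 1 / real (batch X k)))"
proof -
  define pc where "pc = path_const C \<bar>real_of_ereal (\<phi> \<pi>\<^sub>0) - l\<bar>"
  have C0: "0 \<le> C" using C_ge by simp
  have pc0: "0 \<le> pc" using C0 by (simp add: pc_def path_const_def)
  let ?c = "108 * C ^ 6"
  have rb0: "0 \<le> residual_bound k \<omega>" for k \<omega>
    using moves_nonneg[of k \<omega>] C0 by (simp add: residual_bound_def)
  have le: "(\<Sum>k<T. residual_bound k \<omega>) \<le> ?c * pc * (1 + (iter_size 0 \<omega> ^ 4 + iter_size 1 \<omega> ^ 4 + iter_size T \<omega> ^ 4))
      + ?c * (pc + 1) * (\<Sum>k<T. (noise_level k \<omega>)\<^sup>2)" if \<omega>: "\<omega> \<in> space M" for \<omega>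
  proof -
    define Sx where "Sx = (\<Sum>k<T. (noise_level k \<omega>)\<^sup>2)"
    have s: "(iter_size k \<omega>)\<^sup>2 \<le> iter_size k \<omega> ^ 4" for k
      using iter_size_ge_1 by (intro power_increasing) auto
    have "(\<Sum>k<T. residual_bound k \<omega>) = ?c * ((\<Sum>k<T. primal_move k \<omega> + dual_move k \<omega>) + Sx)"
      by (simp only: residual_bound_def sum_distrib_left[symmetric] sum.distrib Sx_def)
    also have "\<dots> \<le> ?c * (pc * (1 + (iter_size 0 \<omega>)\<^sup>2 + (iter_size 1 \<omega>)\<^sup>2 + (iter_size T \<omega>)\<^sup>2 + Sx) + Sx)"
      using C0 path_bound[OF \<omega> T] unfolding pc_def Sx_def by (intro mult_left_mono add_right_mono) auto
    also have "\<dots> \<le> ?c * (pc * (1 + iter_size 0 \<omega> ^ 4 + iter_size 1 \<omega> ^ 4 + iter_size T \<omega> ^ 4 + Sx) + Sx)"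
      using C0 pc0 s by (intro mult_left_mono add_right_mono add_mono) auto
    also have "\<dots> = ?c * pc * (1 + (iter_size 0 \<omega> ^ 4 + iter_size 1 \<omega> ^ 4 + iter_size T \<omega> ^ 4)) + ?c * (pc + 1) * Sx"
      by (simp add: algebra_simps)
    finally show ?thesis by (simp only: Sx_def)
  qed
  have "(\<Sum>k<T. \<integral>\<^sup>+\<omega>. ennreal (residual_bound k \<omega>) \<partial>M) = (\<integral>\<^sup>+\<omega>. (\<Sum>k<T. ennreal (residual_bound k \<omega>)) \<partial>M)"
    by (rule nn_integral_sum[symmetric]) measurable
  also have "\<dots> \<le> (\<integral>\<^sup>+\<omega>. ennreal (?c * pc) * (1 + (ennreal (iter_size 0 \<omega> ^ 4) + ennreal (iter_size 1 \<omega> ^ 4) + ennreal (iter_size T \<omega> ^ 4)))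
      + ennreal (?c * (pc + 1)) * (\<Sum>k<T. ennreal ((noise_level k \<omega>)\<^sup>2)) \<partial>M)"
  proof (rule nn_integral_mono)
    fix \<omega> assume \<omega>: "\<omega> \<in> space M"
    have i: "0 \<le> iter_size k \<omega> ^ 4" for k by (simp add: zero_le_even_power)
    have "(\<Sum>k<T. ennreal (residual_bound k \<omega>)) = ennreal (\<Sum>k<T. residual_bound k \<omega>)"
      by (rule sum_ennreal) (rule rb0)
    also have "\<dots> \<le> ennreal (?c * pc * (1 + (iter_size 0 \<omega> ^ 4 + iter_size 1 \<omega> ^ 4 + iter_size T \<omega> ^ 4))
      + ?c * (pc + 1) * (\<Sum>k<T. (noise_level k \<omega>)\<^sup>2))"
      by (intro ennreal_leI le \<omega>)
    also have "\<dots> = ennreal (?c * pc) * (1 + (ennreal (iter_size 0 \<omega> ^ 4) + ennreal (iter_size 1 \<omega> ^ 4) + ennreal (iter_size T \<omega> ^ 4)))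
      + ennreal (?c * (pc + 1)) * (\<Sum>k<T. ennreal ((noise_level k \<omega>)\<^sup>2))"
      using C0 pc0 i by (subst ennreal_plus) (auto simp: ennreal_mult sum_nonneg)
    finally show "(\<Sum>k<T. ennreal (residual_bound k \<omega>)) \<le> \<dots>" .
  qed
  also have "\<dots> = ennreal (?c * pc) * (1 + ((\<integral>\<^sup>+\<omega>. ennreal (iter_size 0 \<omega> ^ 4) \<partial>M) + (\<integral>\<^sup>+\<omega>. ennreal (iter_size 1 \<omega> ^ 4) \<partial>M)
        + (\<integral>\<^sup>+\<omega>. ennreal (iter_size T \<omega> ^ 4) \<partial>M)))
      + ennreal (?c * (pc + 1)) * (\<Sum>k<T. \<integral>\<^sup>+\<omega>. ennreal ((noise_level k \<omega>)\<^sup>2) \<partial>M)"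
    by (simp add: nn_integral_add nn_integral_cmult nn_integral_sum emeasure_space_1 del: sum_ennreal)
  also have "\<dots> \<le> ennreal (?c * pc) * (1 + (ennreal m\<^sub>4 + ennreal m\<^sub>4 + ennreal m\<^sub>4))
      + ennreal (?c * (pc + 1)) * (\<Sum>k<T. ennreal ((1 + 3 * k\<^sub>4) * m\<^sub>4 * (1 / real (batch X k))))"
    by (intro add_mono mult_left_mono add_left_mono iter_size_moment sum_mono noise_level_moment) auto
  also have "(\<Sum>k<T. ennreal ((1 + 3 * k\<^sub>4) * m\<^sub>4 * (1 / real (batch X k)))) = ennreal ((1 + 3 * k\<^sub>4) * m\<^sub>4 * (\<Sum>k<T. 1 / real (batch X k)))"
    using m4_nonneg by (subst sum_ennreal) (auto simp: sum_distrib_left)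
  also have "ennreal (?c * pc) * (1 + (ennreal m\<^sub>4 + ennreal m\<^sub>4 + ennreal m\<^sub>4)) = ennreal (?c * pc * (1 + (m\<^sub>4 + m\<^sub>4 + m\<^sub>4)))"
  proof -
    have "1 + (ennreal m\<^sub>4 + ennreal m\<^sub>4 + ennreal m\<^sub>4) = ennreal (1 + (m\<^sub>4 + m\<^sub>4 + m\<^sub>4))"
      by (simp only: ennreal_plus add_nonneg_nonneg m4_nonneg zero_le_one ennreal_1)
    moreover have "0 \<le> ?c * pc" using C0 pc0 by simp
    ultimately show ?thesis by (simp only: ennreal_mult')
  qed
  also have "ennreal (?c * (pc + 1)) * ennreal ((1 + 3 * k\<^sub>4) * m\<^sub>4 * (\<Sum>k<T. 1 / real (batch X k)))
      = ennreal (?c * (pc + 1) * ((1 + 3 * k\<^sub>4) * m\<^sub>4 * (\<Sum>k<T. 1 / real (batch X k))))"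
    using C0 pc0 m4_nonneg by (subst ennreal_mult) (auto intro!: mult_nonneg_nonneg sum_nonneg)
  also have "ennreal (?c * pc * (1 + (m\<^sub>4 + m\<^sub>4 + m\<^sub>4))) + \<dots> = ennreal (?c * pc * (1 + (m\<^sub>4 + m\<^sub>4 + m\<^sub>4)) + ?c * (pc + 1) * ((1 + 3 * k\<^sub>4) * m\<^sub>4 * (\<Sum>k<T. 1 / real (batch X k))))"
    using C0 pc0 m4_nonneg by (intro ennreal_plus[symmetric] mult_nonneg_nonneg sum_nonneg) auto
  also have "?c * pc * (1 + (m\<^sub>4 + m\<^sub>4 + m\<^sub>4)) + ?c * (pc + 1) * ((1 + 3 * k\<^sub>4) * m\<^sub>4 * (\<Sum>k<T. 1 / real (batch X k)))
      = run_A + run_B * (\<Sum>k<T. 1 / real (batch X k))"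
    by (simp add: run_A_def run_B_def pc_def)
  finally show ?thesis .
qed

lemma space_run_sigma: "space (run_sigma M X) = space M"
  and sets_run_sigma: "sets (run_sigma M X) = sigma_sets (space M) (\<Union>k. sets (hist X k 0))"
proof -
  have "(\<Union>k. sets (hist X k 0)) \<subseteq> Pow (space M)"
    using sets.sets_into_space[of _ "hist X _ 0"] space_hist by blast
  then show "space (run_sigma M X) = space M" "sets (run_sigma M X) = sigma_sets (space M) (\<Union>k. sets (hist X k 0))"
    by (simp_all add: run_sigma_def)
qed

lemma subalg_run_sigma: "subalgebra M (run_sigma M X)"
  unfolding subalgebra_def space_run_sigma sets_run_sigma
  using sets_hist_M by (auto intro!: sets.sigma_sets_subset)

text \<open>On the event that the index equals \<open>k\<close> the residual is at most
  \<open>residual_bound k\<close>, which is a function of the run; independence pulls out the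
  probability \<open>1 / real T\<close>, and the average of the bounds remains.\<close>

theorem expected_residual:
  assumes T: "1 \<le> T" and K: "uniform_index M X T K"
  shows "(\<integral>\<^sup>+\<omega>. companion_residual \<phi> c P r \<gamma> \<beta> P\<^sub>0 r\<^sub>0 X (K \<omega>) \<omega> \<partial>M)
    \<le> ennreal (run_A / real T + run_B / real T * (\<Sum>k<T. 1 / real (batch X k)))"
proof -
  have Km [measurable]: "K \<in> measurable M (count_space UNIV)"
    and Kd: "distr M (count_space UNIV) K = measure_pmf (pmf_of_set {..<T})"
    and Ki: "indep_set {K -` B \<inter> space M | B. True} (sets (run_sigma M X))"
    using K by (auto simp: uniform_index_def)
  define E where "E k = K -` {k} \<inter> space M" for k
  have Em [measurable]: "E k \<in> sets M" for k unfolding E_def by measurable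
  have ne: "{..<T} \<noteq> {}" using T by (auto simp: lessThan_empty_iff)
  have pE: "prob (E k) = 1 / real T" if "k < T" for k
  proof -
    have "prob (E k) = measure (distr M (count_space UNIV) K) {k}"
      unfolding E_def by (subst measure_distr) auto
    also have "\<dots> = 1 / real T"
      unfolding Kd using ne that by (simp add: measure_pmf_single pmf_of_set)
    finally show ?thesis .
  qed
  have AEK: "AE \<omega> in M. K \<omega> < T"
  proof -
    have "AE k in distr M (count_space UNIV) K. k < T"
      unfolding Kd AE_measure_pmf_iff using ne by (simp add: set_pmf_of_set)
    then show ?thesis by (subst (asm) AE_distr_iff) auto
  qed
  have each: "(\<integral>\<^sup>+\<omega>. ennreal (residual_bound k \<omega>) * indicator (E k) \<omega> \<partial>M)
      \<le> ennreal (1 / real T) * (\<integral>\<^sup>+\<omega>. ennreal (residual_bound k \<omega>) \<partial>M)" if k: "k < T" for k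
  proof (rule nn_integral_weight_le[OF subalg_run_sigma])
    show "(indicator (E k) :: 'w \<Rightarrow> ennreal) \<in> borel_measurable M" by measurable
    have "sets (hist X (Suc k) 0) \<subseteq> sets (run_sigma M X)" unfolding sets_run_sigma by auto
    then have [measurable]: "residual_bound k \<in> borel_measurable (run_sigma M X)"
      using residual_bound_meas[of k] space_hist space_run_sigma by (auto simp: measurable_def)
    show "(\<lambda>\<omega>. ennreal (residual_bound k \<omega>)) \<in> borel_measurable (run_sigma M X)" by measurable
    fix A assume A: "A \<in> sets (run_sigma M X)"
    then have AM [measurable]: "A \<in> sets M" using subalg_run_sigma by (auto simp: subalgebra_def)
    have "(\<integral>\<^sup>+\<omega>. indicator A \<omega> * indicator (E k) \<omega> \<partial>M) = (\<integral>\<^sup>+\<omega>. indicator (E k \<inter> A) \<omega> \<partial>M)"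
      by (intro nn_integral_cong) (auto simp: indicator_def)
    also have "\<dots> = ennreal (prob (E k \<inter> A))" by (simp add: emeasure_eq_measure)
    also have "prob (E k \<inter> A) = prob (E k) * prob A"
      using A by (intro indep_setD[OF Ki]) (auto simp: E_def)
    also have "ennreal (prob (E k) * prob A) = ennreal (1 / real T) * emeasure M A"
      unfolding pE[OF k] emeasure_eq_measure by (rule ennreal_mult) auto
    finally show "(\<integral>\<^sup>+\<omega>. indicator A \<omega> * indicator (E k) \<omega> \<partial>M) \<le> ennreal (1 / real T) * emeasure M A" by simp
  qed
  have "(\<integral>\<^sup>+\<omega>. companion_residual \<phi> c P r \<gamma> \<beta> P\<^sub>0 r\<^sub>0 X (K \<omega>) \<omega> \<partial>M)
      \<le> (\<integral>\<^sup>+\<omega>. (\<Sum>k<T. ennreal (residual_bound k \<omega>) * indicator (E k) \<omega>) \<partial>M)"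
  proof (rule nn_integral_mono_AE)
    show "AE \<omega> in M. companion_residual \<phi> c P r \<gamma> \<beta> P\<^sub>0 r\<^sub>0 X (K \<omega>) \<omega>
        \<le> (\<Sum>k<T. ennreal (residual_bound k \<omega>) * indicator (E k) \<omega>)"
      using AEK AE_space
    proof eventually_elim
      case (elim \<omega>)
      have "companion_residual \<phi> c P r \<gamma> \<beta> P\<^sub>0 r\<^sub>0 X (K \<omega>) \<omega> \<le> ennreal (residual_bound (K \<omega>) \<omega>) * indicator (E (K \<omega>)) \<omega>"
        using companion_residual_le elim by (simp add: E_def)
      also have "\<dots> \<le> (\<Sum>k<T. ennreal (residual_bound k \<omega>) * indicator (E k) \<omega>)"
        using elim by (intro member_le_sum[where f="\<lambda>k. ennreal (residual_bound k \<omega>) * indicator (E k) \<omega>"]) auto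
      finally show ?case .
    qed
  qed
  also have "\<dots> = (\<Sum>k<T. \<integral>\<^sup>+\<omega>. ennreal (residual_bound k \<omega>) * indicator (E k) \<omega> \<partial>M)"
    by (rule nn_integral_sum) measurable
  also have "\<dots> \<le> (\<Sum>k<T. ennreal (1 / real T) * (\<integral>\<^sup>+\<omega>. ennreal (residual_bound k \<omega>) \<partial>M))"
    by (intro sum_mono each) simp
  also have "\<dots> = ennreal (1 / real T) * (\<Sum>k<T. \<integral>\<^sup>+\<omega>. ennreal (residual_bound k \<omega>) \<partial>M)"
    by (rule sum_distrib_left[symmetric])
  also have "\<dots> \<le> ennreal (1 / real T) * ennreal (run_A + run_B * (\<Sum>k<T. 1 / real (batch X k)))"
    by (intro mult_left_mono residual_sum T) simp
  also have "\<dots> = ennreal (run_A / real T + run_B / real T * (\<Sum>k<T. 1 / real (batch X k)))"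
    by (subst ennreal_mult'[symmetric]) (simp_all add: add_divide_distrib)
  finally show ?thesis .
qed

end

section \<open>The main estimate\<close>

theorem theorem5p2:
  fixes P :: "'s::finite \<Rightarrow> 'a::finite \<Rightarrow> 's \<Rightarrow> real" and r :: "'s \<Rightarrow> 'a \<Rightarrow> real"
    and \<rho> :: "'s \<Rightarrow> real" and \<gamma> :: real
    and \<phi> :: "real^'a^'s \<Rightarrow> ereal" and c :: "real^'s"
    and P\<^sub>0 :: "'s \<Rightarrow> 'a \<Rightarrow> 's \<Rightarrow> real" and r\<^sub>0 :: "'s \<Rightarrow> 'a \<Rightarrow> real"
    and \<pi>\<^sub>0 :: "real^'a^'s" and \<nu>\<^sub>0 :: "((real^'s) \<times> (real^'s)) measure"
    and \<beta> \<eta>\<^sub>\<pi> \<eta>\<^sub>V \<kappa> L\<^sub>M \<rho>\<^sub>m\<^sub>i\<^sub>n \<alpha> R\<^sub>m\<^sub>a\<^sub>x M\<^sub>4 :: real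
  assumes gamma: "0 < \<gamma>" "\<gamma> < 1"
    and P_stochastic: "\<forall>s a. prob_vec (P s a)"
    and rho_prob: "prob_vec \<rho>"
    and phi_proper: "\<forall>\<pi>\<in>policies. \<phi> \<pi> \<noteq> -\<infinity>" "edom \<phi> \<inter> policies \<noteq> {}"
    and phi_lsc: "lsc_on policies \<phi>"
    and phi_bdd_below: "\<exists>l::real. \<forall>\<pi>\<in>policies. ereal l \<le> \<phi> \<pi>"
    and default_row: "\<forall>s a. prob_vec (P\<^sub>0 s a)"
    and steps_pos: "\<beta> > 0" "\<eta>\<^sub>\<pi> > 0" "\<eta>\<^sub>V > 0"
    and kappa: "\<forall>\<pi>\<in>policies. spectral_norm (matrix_inv (M_pol \<gamma> P \<pi>)) \<le> \<kappa>"
    and rho_cover: "\<rho>\<^sub>m\<^sub>i\<^sub>n > 0" "\<forall>s. \<rho>\<^sub>m\<^sub>i\<^sub>n \<le> \<rho> s"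
    and alpha_pos: "\<alpha> > 0"
    and r_bounded: "\<forall>s a. \<bar>r s a\<bar> \<le> R\<^sub>m\<^sub>a\<^sub>x"
    and pi0: "\<pi>\<^sub>0 \<in> edom (psi \<phi>)"
    and M_Lipschitz: "\<forall>\<pi>\<in>policies. \<forall>\<pi>'\<in>policies.
          spectral_norm (M_pol \<gamma> P \<pi>' - M_pol \<gamma> P \<pi>) \<le> L\<^sub>M * norm (\<pi>' - \<pi>)"
    and b_bdd_below: "\<exists>l::real. \<forall>\<pi>\<in>policies.
          ereal l \<le> \<phi> \<pi> + ereal (c \<bullet> (matrix_inv (M_pol \<gamma> P \<pi>) *v r_pol r \<pi>))"
    and beta_margin: "\<beta> > max (60 * \<kappa>\<^sup>2 / \<eta>\<^sub>V) (30 * \<eta>\<^sub>\<pi> * \<kappa> ^ 4 * L\<^sub>M\<^sup>2 * (norm c)\<^sup>2)"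
    and init_law: "prob_space \<nu>\<^sub>0" "sets \<nu>\<^sub>0 = sets borel"
    and init_moments: "(\<integral>\<^sup>+z. ennreal (norm (fst z) ^ 4) \<partial>\<nu>\<^sub>0)
          + (\<integral>\<^sup>+z. ennreal (norm (snd z) ^ 4) \<partial>\<nu>\<^sub>0) < \<infinity>"
  shows "\<exists>A>0. \<exists>B>0.
     (\<forall>(M :: 'w measure) (X :: ('w, 's, 'a) run) (T :: nat) (K :: 'w \<Rightarrow> nat).
        admm_run M \<phi> c P r \<rho> \<gamma> P\<^sub>0 r\<^sub>0 \<pi>\<^sub>0 \<nu>\<^sub>0 \<beta> \<eta>\<^sub>\<pi> \<eta>\<^sub>V \<kappa> \<alpha> M\<^sub>4 X
        \<and> T \<ge> 1 \<and> uniform_index M X T K \<longrightarrow>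
          (\<integral>\<^sup>+\<omega>. companion_residual \<phi> c P r \<gamma> \<beta> P\<^sub>0 r\<^sub>0 X (K \<omega>) \<omega> \<partial>M)
            \<le> ennreal (A / real T + B / real T * (\<Sum>k<T. 1 / real (batch X k)))
          \<and> (\<forall>N :: nat. N = (\<Sum>k<T. batch X k)
                \<and> (\<forall>k<T. real (batch X k) = real N / real T) \<longrightarrow>
              (\<integral>\<^sup>+\<omega>. companion_residual \<phi> c P r \<gamma> \<beta> P\<^sub>0 r\<^sub>0 X (K \<omega>) \<omega> \<partial>M)
                \<le> ennreal (A / real T + B * real T / real N)))
     \<and> (\<exists>(T :: real \<Rightarrow> nat) (N :: real \<Rightarrow> nat).
          (\<lambda>\<epsilon>. real (T \<epsilon>)) \<in> O[at_right 0](\<lambda>\<epsilon>. 1 / \<epsilon>)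
          \<and> (\<lambda>\<epsilon>. real (N \<epsilon>)) \<in> O[at_right 0](\<lambda>\<epsilon>. 1 / \<epsilon>\<^sup>2)
          \<and> (\<forall>\<epsilon>>0. T \<epsilon> \<ge> 1 \<and> N \<epsilon> \<ge> 1 \<and> T \<epsilon> dvd N \<epsilon> \<and>
               (\<forall>(M :: 'w measure) (X :: ('w, 's, 'a) run) (K :: 'w \<Rightarrow> nat).
                  admm_run M \<phi> c P r \<rho> \<gamma> P\<^sub>0 r\<^sub>0 \<pi>\<^sub>0 \<nu>\<^sub>0 \<beta> \<eta>\<^sub>\<pi> \<eta>\<^sub>V \<kappa> \<alpha> M\<^sub>4 X
                  \<and> (\<forall>k<T \<epsilon>. batch X k = N \<epsilon> div T \<epsilon>)
                  \<and> uniform_index M X (T \<epsilon>) K \<longrightarrow>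
                    (\<integral>\<^sup>+\<omega>. companion_residual \<phi> c P r \<gamma> \<beta> P\<^sub>0 r\<^sub>0 X (K \<omega>) \<omega> \<partial>M)
                      \<le> ennreal \<epsilon>)))"
proof -
  obtain l where l: "\<And>\<pi>. \<pi> \<in> policies \<Longrightarrow> ereal l \<le> \<phi> \<pi>" using phi_bdd_below by blast
  have pi0': "\<pi>\<^sub>0 \<in> policies" "\<phi> \<pi>\<^sub>0 \<noteq> \<infinity>"
    using pi0 by (auto simp: edom_def psi_def split: if_splits)
  have kappa_pos: "0 < \<kappa>"
  proof (rule ccontr)
    let ?x = "axis undefined 1 :: real^'s"
    assume "\<not> 0 < \<kappa>"
    \<comment> \<open>The inverse bound applied to a unit vector forces a positive constant;
      \<kappa> is then available as a divisor.\<close>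
    have "norm ?x \<le> \<kappa> * norm (M_pol \<gamma> P \<pi>\<^sub>0 *v ?x)"
      using gamma P_stochastic pi0'(1) kappa by (intro norm_le_inverse_bound invertible_M_pol) auto
    also have "\<dots> \<le> 0" using \<open>\<not> 0 < \<kappa>\<close> by (intro mult_nonpos_nonneg) auto
    finally show False by (simp add: norm_axis_1)
  qed
  \<comment> \<open>The sum of all nonnegative quantities that \<open>C\<close> has to
    dominate.\<close>
  define C where "C = 1 + \<beta> + 1 / \<beta> + 1 / \<eta>\<^sub>\<pi> + 1 / \<eta>\<^sub>V + \<kappa> + norm c + \<eta>\<^sub>\<pi> + \<eta>\<^sub>V + 1 / \<kappa>
      + (kernel_l1 P + reward_l1 r) * real CARD('s)"
  have pos: "0 \<le> \<beta>" "0 \<le> 1 / \<beta>" "0 \<le> 1 / \<eta>\<^sub>\<pi>" "0 \<le> 1 / \<eta>\<^sub>V" "0 \<le> \<kappa>" "0 \<le> norm c" "0 \<le> \<eta>\<^sub>\<pi>" "0 \<le> \<eta>\<^sub>V"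
    "0 \<le> 1 / \<kappa>" "0 \<le> (kernel_l1 P + reward_l1 r) * real CARD('s)"
    using steps_pos kappa_pos kernel_l1_nonneg[of P] reward_l1_nonneg[of r] by auto
  \<comment> \<open>The given Lipschitz constant may be negative. Its positive part still satisfies
    the Lipschitz bound, and its square is no larger, so the margin survives.\<close>
  let ?L = "max 0 L\<^sub>M"
  have data: "bellman_data \<phi> c P r \<gamma> \<beta> \<eta>\<^sub>\<pi> \<eta>\<^sub>V \<kappa> ?L C"
  proof
    show "0 < \<gamma>" "\<gamma> < 1" "0 < \<beta>" "0 < \<eta>\<^sub>\<pi>" "0 < \<eta>\<^sub>V" "0 < \<kappa>" "0 \<le> ?L" by (use gamma steps_pos kappa_pos in auto)
    show "prob_vec (P s a)" for s a using P_stochastic by blast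
    show "\<phi> \<pi> \<noteq> -\<infinity>" if "\<pi> \<in> policies" for \<pi> using that phi_proper(1) by blast
    fix \<pi> \<pi>' :: "real^'a^'s" assume "\<pi> \<in> policies" "\<pi>' \<in> policies"
    then have "spectral_norm (M_pol \<gamma> P \<pi>' - M_pol \<gamma> P \<pi>) \<le> L\<^sub>M * norm (\<pi>' - \<pi>)"
      using M_Lipschitz by blast
    also have "\<dots> \<le> ?L * norm (\<pi>' - \<pi>)" by (intro mult_right_mono) auto
    finally show "spectral_norm (M_pol \<gamma> P \<pi>' - M_pol \<gamma> P \<pi>) \<le> ?L * norm (\<pi>' - \<pi>)" .
  next
    show "60 * \<kappa>\<^sup>2 / \<eta>\<^sub>V < \<beta>" using beta_margin by simp
    have "?L\<^sup>2 \<le> L\<^sub>M\<^sup>2" by (simp add: max_def)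
    then have "30 * \<eta>\<^sub>\<pi> * \<kappa> ^ 4 * ?L\<^sup>2 * (norm c)\<^sup>2 \<le> 30 * \<eta>\<^sub>\<pi> * \<kappa> ^ 4 * L\<^sub>M\<^sup>2 * (norm c)\<^sup>2"
      using steps_pos kappa_pos by (intro mult_right_mono mult_left_mono) auto
    then show "30 * \<eta>\<^sub>\<pi> * \<kappa> ^ 4 * ?L\<^sup>2 * (norm c)\<^sup>2 < \<beta>" using beta_margin by simp
  qed (use pos in \<open>unfold C_def, linarith+\<close>)
  let ?I = "(\<integral>\<^sup>+z. ennreal (norm (fst z) ^ 4) \<partial>\<nu>\<^sub>0) + (\<integral>\<^sup>+z. ennreal (norm (snd z) ^ 4) \<partial>\<nu>\<^sub>0)"
  let ?J = "\<integral>\<^sup>+z. ennreal ((1 + norm (fst z) + norm (snd z)) ^ 4) \<partial>\<nu>\<^sub>0"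
  have "?J \<le> (\<integral>\<^sup>+z. 64 * (1 + (ennreal (norm (fst z) ^ 4) + ennreal (norm (snd z) ^ 4))) \<partial>\<nu>\<^sub>0)"
  proof (rule nn_integral_mono)
    fix z :: "(real^'s) \<times> (real^'s)"
    define x y where "x = norm (fst z)" "y = norm (snd z)"
    have xy: "0 \<le> x" "0 \<le> y" by (simp_all add: x_y_def)
    have "(1 + (x + y)) ^ 4 \<le> 8 * (1 ^ 4 + (x + y) ^ 4)" by (rule power4_add_le)
    \<comment> \<open>The fourth power of a sum is split twice, each time at the cost of a factor 8,
      which gives the 64.\<close>
    also have "\<dots> \<le> 8 * (1 + 8 * (x ^ 4 + y ^ 4))" using power4_add_le[of x y] by simp
    also have "\<dots> \<le> 64 * (1 + (x ^ 4 + y ^ 4))" by simp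
    finally have "ennreal ((1 + x + y) ^ 4) \<le> ennreal (64 * (1 + (x ^ 4 + y ^ 4)))"
      by (intro ennreal_leI) (simp add: add.assoc)
    also have "\<dots> = 64 * (1 + (ennreal (x ^ 4) + ennreal (y ^ 4)))"
      using xy by (simp add: ennreal_mult ennreal_plus)
    finally show "ennreal ((1 + norm (fst z) + norm (snd z)) ^ 4)
        \<le> 64 * (1 + (ennreal (norm (fst z) ^ 4) + ennreal (norm (snd z) ^ 4)))" by (simp add: x_y_def)
  qed
  also have "\<dots> = 64 * (1 + ?I)"
  proof -
    have b: "borel_measurable \<nu>\<^sub>0 = (borel_measurable borel :: (_ \<Rightarrow> ennreal) set)"
      by (rule measurable_cong_sets) (simp_all add: init_law(2))
    have m: "(\<lambda>z. ennreal (norm (fst z) ^ 4)) \<in> borel_measurable \<nu>\<^sub>0" "(\<lambda>z. ennreal (norm (snd z) ^ 4)) \<in> borel_measurable \<nu>\<^sub>0"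
      unfolding b borel_prod[symmetric] by measurable
    show ?thesis
      using m prob_space.emeasure_space_1[OF init_law(1)] by (simp add: nn_integral_cmult nn_integral_add)
  qed
  also have "\<dots> < \<infinity>" using init_moments by (simp add: ennreal_mult_less_top)
  finally have J: "?J = ennreal (enn2real ?J)" by (simp add: less_top)
  define m\<^sub>0 where "m\<^sub>0 = enn2real ?J"
  \<comment> \<open>The modulus of \<open>K\<^sub>4\<close> for every admissible run, expressed by
    the data alone before any run is introduced.\<close>
  define k where "k = \<bar>model_const ((1 - \<gamma>) * \<rho>\<^sub>m\<^sub>i\<^sub>n * (\<alpha> * \<gamma>)) (max 1 M\<^sub>4) (1 + reward_l1 (\<lambda>s a. r\<^sub>0 s a - r s a)) TYPE('s) TYPE('a)\<bar>"
  define pc where "pc = path_const C \<bar>real_of_ereal (\<phi> \<pi>\<^sub>0) - l\<bar>"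
  \<comment> \<open>The maximum with 1 makes the constant positive, also for degenerate
    data.\<close>
  define A where "A = max 1 (108 * C ^ 6 * pc * (1 + 3 * moment_const C k m\<^sub>0))"
  define B where "B = max 1 (108 * C ^ 6 * (pc + 1) * ((1 + 3 * k) * moment_const C k m\<^sub>0))"
  have AB: "0 < A" "0 < B" by (simp_all add: A_def B_def)
  have main: "(\<integral>\<^sup>+\<omega>. companion_residual \<phi> c P r \<gamma> \<beta> P\<^sub>0 r\<^sub>0 X (K \<omega>) \<omega> \<partial>M)
      \<le> ennreal (A / real T + B / real T * (\<Sum>k<T. 1 / real (batch X k)))"
    if run: "admm_run M \<phi> c P r \<rho> \<gamma> P\<^sub>0 r\<^sub>0 \<pi>\<^sub>0 \<nu>\<^sub>0 \<beta> \<eta>\<^sub>\<pi> \<eta>\<^sub>V \<kappa> \<alpha> M\<^sub>4 X"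
      and T: "1 \<le> T" and K: "uniform_index M X T K"
    for M :: "'w measure" and X :: "('w, 's, 'a) run" and T :: nat and K :: "'w \<Rightarrow> nat"
  proof -
    interpret admm_run M \<phi> c P r \<rho> \<gamma> P\<^sub>0 r\<^sub>0 \<pi>\<^sub>0 \<nu>\<^sub>0 \<beta> \<eta>\<^sub>\<pi> \<eta>\<^sub>V \<kappa> \<alpha> M\<^sub>4 X by (rule run)
    interpret bellman_data \<phi> c P r \<gamma> \<beta> \<eta>\<^sub>\<pi> \<eta>\<^sub>V \<kappa> ?L C by (rule data)
    interpret bellman_run M \<phi> c P r \<rho> \<gamma> P\<^sub>0 r\<^sub>0 \<pi>\<^sub>0 \<nu>\<^sub>0 \<beta> \<eta>\<^sub>\<pi> \<eta>\<^sub>V \<kappa> \<alpha> M\<^sub>4 X \<rho>\<^sub>m\<^sub>i\<^sub>n ?L C l m\<^sub>0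
      using assms pi0' l J by unfold_locales (auto simp: m\<^sub>0_def)
    have k: "\<bar>K\<^sub>4\<bar> = k" by (simp add: k_def K\<^sub>4_def visit_rate_def B\<^sub>4_def)
    have "run_A \<le> A" "run_B \<le> B" by (simp_all add: run_A_def run_B_def A_def B_def pc_def k)
    then have "run_A / real T + run_B / real T * (\<Sum>k<T. 1 / real (batch X k))
        \<le> A / real T + B / real T * (\<Sum>k<T. 1 / real (batch X k))"
      by (intro add_mono mult_right_mono divide_right_mono sum_nonneg) auto
    then show ?thesis using expected_residual[OF T K] by (meson ennreal_leI order_trans)
  qed
  \<comment> \<open>The two error terms receive half of \<epsilon> each: the number of iterations
    handles \<open>A / T\<close> and the common batch size handles \<open>B / m\<close>. Their
    product is the total sample size, hence the square in its order.\<close>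
  define T\<^sub>\<epsilon> where "T\<^sub>\<epsilon> \<epsilon> = max 1 (nat \<lceil>2 * A / \<epsilon>\<rceil>)" for \<epsilon> :: real
  define m\<^sub>\<epsilon> where "m\<^sub>\<epsilon> \<epsilon> = max 1 (nat \<lceil>2 * B / \<epsilon>\<rceil>)" for \<epsilon> :: real
  define N\<^sub>\<epsilon> where "N\<^sub>\<epsilon> \<epsilon> = T\<^sub>\<epsilon> \<epsilon> * m\<^sub>\<epsilon> \<epsilon>" for \<epsilon>
  have up: "real (max 1 (nat \<lceil>2 * D / \<epsilon>\<rceil>)) \<le> (2 * D + 1) * (1 / \<epsilon>)" if "0 < \<epsilon>" "\<epsilon> < 1" "0 < D" for D \<epsilon> :: real
  proof -
    have "0 \<le> 2 * D / \<epsilon>" "1 \<le> 1 / \<epsilon>" using that by simp_all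
    then have "real (nat \<lceil>2 * D / \<epsilon>\<rceil>) \<le> 2 * D / \<epsilon> + 1" by linarith
    then have "real (max 1 (nat \<lceil>2 * D / \<epsilon>\<rceil>)) \<le> 2 * D / \<epsilon> + 1"
      using \<open>0 \<le> 2 * D / \<epsilon>\<close> by (auto simp: max_def)
    also have "\<dots> \<le> (2 * D + 1) * (1 / \<epsilon>)" using \<open>1 \<le> 1 / \<epsilon>\<close> by (simp add: add_divide_distrib)
    finally show ?thesis .
  qed
  have low: "D / real (max 1 (nat \<lceil>2 * D / \<epsilon>\<rceil>)) \<le> \<epsilon> / 2" if "0 < \<epsilon>" "0 < D" for D \<epsilon> :: real
  proof -
    have "2 * D / \<epsilon> \<le> real (max 1 (nat \<lceil>2 * D / \<epsilon>\<rceil>))" by linarith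
    then show ?thesis using that by (simp add: field_simps)
  qed
  have ev: "\<forall>\<^sub>F \<epsilon> in at_right (0::real). 0 < \<epsilon> \<and> \<epsilon> < 1"
    by (rule eventually_at_rightI[of 0 1]) auto
  show ?thesis
  proof (rule exI[of _ A], rule conjI[OF AB(1)], rule exI[of _ B], rule conjI[OF AB(2)], rule conjI;
      ((rule exI[of _ T\<^sub>\<epsilon>], rule exI[of _ N\<^sub>\<epsilon>])?; intro conjI allI impI))
    fix M :: "'w measure" and X :: "('w, 's, 'a) run" and T :: nat and K :: "'w \<Rightarrow> nat"
    assume *: "admm_run M \<phi> c P r \<rho> \<gamma> P\<^sub>0 r\<^sub>0 \<pi>\<^sub>0 \<nu>\<^sub>0 \<beta> \<eta>\<^sub>\<pi> \<eta>\<^sub>V \<kappa> \<alpha> M\<^sub>4 X \<and> T \<ge> 1 \<and> uniform_index M X T K"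
    show "(\<integral>\<^sup>+\<omega>. companion_residual \<phi> c P r \<gamma> \<beta> P\<^sub>0 r\<^sub>0 X (K \<omega>) \<omega> \<partial>M)
      \<le> ennreal (A / real T + B / real T * (\<Sum>k<T. 1 / real (batch X k)))"
      using * by (intro main) auto
    fix N :: nat
    assume N: "N = (\<Sum>k<T. batch X k) \<and> (\<forall>k<T. real (batch X k) = real N / real T)"
    have "(\<Sum>k<T. 1 / real (batch X k)) = (\<Sum>k<T. 1 / (real N / real T))"
      using conjunct2[OF N] by (intro sum.cong) auto
    also have "\<dots> = real T * (real T / real N)" by simp
    finally have sum: "(\<Sum>k<T. 1 / real (batch X k)) = real T * (real T / real N)" .
    have "A / real T + B / real T * (\<Sum>k<T. 1 / real (batch X k)) = A / real T + B * real T / real N"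
      unfolding sum using * by simp
    then show "(\<integral>\<^sup>+\<omega>. companion_residual \<phi> c P r \<gamma> \<beta> P\<^sub>0 r\<^sub>0 X (K \<omega>) \<omega> \<partial>M)
      \<le> ennreal (A / real T + B * real T / real N)"
      using main[OF conjunct1[OF *] conjunct1[OF conjunct2[OF *]] conjunct2[OF conjunct2[OF *]]] by (simp only:)
  next
    show "(\<lambda>\<epsilon>. real (T\<^sub>\<epsilon> \<epsilon>)) \<in> O[at_right 0](\<lambda>\<epsilon>. 1 / \<epsilon>)"
    proof (rule bigoI)
      show "\<forall>\<^sub>F \<epsilon> in at_right 0. norm (real (T\<^sub>\<epsilon> \<epsilon>)) \<le> (2 * A + 1) * norm (1 / \<epsilon>)"
        using ev by eventually_elim (use up AB in \<open>simp add: T\<^sub>\<epsilon>_def\<close>)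
    qed
    show "(\<lambda>\<epsilon>. real (N\<^sub>\<epsilon> \<epsilon>)) \<in> O[at_right 0](\<lambda>\<epsilon>. 1 / \<epsilon>\<^sup>2)"
    proof (rule bigoI)
      show "\<forall>\<^sub>F \<epsilon> in at_right 0. norm (real (N\<^sub>\<epsilon> \<epsilon>)) \<le> ((2 * A + 1) * (2 * B + 1)) * norm (1 / \<epsilon>\<^sup>2)"
        using ev
      proof eventually_elim
        case (elim \<epsilon>)
        have "real (T\<^sub>\<epsilon> \<epsilon>) * real (m\<^sub>\<epsilon> \<epsilon>) \<le> ((2 * A + 1) * (1 / \<epsilon>)) * ((2 * B + 1) * (1 / \<epsilon>))"
          unfolding T\<^sub>\<epsilon>_def m\<^sub>\<epsilon>_def using elim AB by (intro mult_mono up) auto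
        also have "\<dots> = ((2 * A + 1) * (2 * B + 1)) * (1 / \<epsilon>\<^sup>2)"
          by (simp add: power2_eq_square)
        finally show ?case by (simp add: N\<^sub>\<epsilon>_def)
      qed
    qed
  next
    fix \<epsilon> :: real assume \<epsilon>: "0 < \<epsilon>"
    show T1: "1 \<le> T\<^sub>\<epsilon> \<epsilon>" by (simp add: T\<^sub>\<epsilon>_def)
    have m1: "1 \<le> m\<^sub>\<epsilon> \<epsilon>" by (simp add: m\<^sub>\<epsilon>_def)
    show "1 \<le> N\<^sub>\<epsilon> \<epsilon>" using mult_le_mono[OF T1 m1] by (simp add: N\<^sub>\<epsilon>_def)
    show "T\<^sub>\<epsilon> \<epsilon> dvd N\<^sub>\<epsilon> \<epsilon>" by (simp add: N\<^sub>\<epsilon>_def)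
    fix M :: "'w measure" and X :: "('w, 's, 'a) run" and K :: "'w \<Rightarrow> nat"
    assume *: "admm_run M \<phi> c P r \<rho> \<gamma> P\<^sub>0 r\<^sub>0 \<pi>\<^sub>0 \<nu>\<^sub>0 \<beta> \<eta>\<^sub>\<pi> \<eta>\<^sub>V \<kappa> \<alpha> M\<^sub>4 X
      \<and> (\<forall>k<T\<^sub>\<epsilon> \<epsilon>. batch X k = N\<^sub>\<epsilon> \<epsilon> div T\<^sub>\<epsilon> \<epsilon>) \<and> uniform_index M X (T\<^sub>\<epsilon> \<epsilon>) K"
    have "(\<Sum>k<T\<^sub>\<epsilon> \<epsilon>. 1 / real (batch X k)) = real (T\<^sub>\<epsilon> \<epsilon>) * (1 / real (m\<^sub>\<epsilon> \<epsilon>))"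
      using * T1 by (simp add: N\<^sub>\<epsilon>_def)
    then have "A / real (T\<^sub>\<epsilon> \<epsilon>) + B / real (T\<^sub>\<epsilon> \<epsilon>) * (\<Sum>k<T\<^sub>\<epsilon> \<epsilon>. 1 / real (batch X k))
        = A / real (T\<^sub>\<epsilon> \<epsilon>) + B / real (m\<^sub>\<epsilon> \<epsilon>)"
      using T1 by simp
    also have "\<dots> \<le> \<epsilon> / 2 + \<epsilon> / 2"
      unfolding T\<^sub>\<epsilon>_def m\<^sub>\<epsilon>_def by (intro add_mono low \<epsilon> AB)
    finally have le: "ennreal (A / real (T\<^sub>\<epsilon> \<epsilon>) + B / real (T\<^sub>\<epsilon> \<epsilon>) * (\<Sum>k<T\<^sub>\<epsilon> \<epsilon>. 1 / real (batch X k))) \<le> ennreal \<epsilon>"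
      by (intro ennreal_leI) simp
    show "(\<integral>\<^sup>+\<omega>. companion_residual \<phi> c P r \<gamma> \<beta> P\<^sub>0 r\<^sub>0 X (K \<omega>) \<omega> \<partial>M) \<le> ennreal \<epsilon>"
      by (rule order_trans[OF main[OF conjunct1[OF *] T1 conjunct2[OF conjunct2[OF *]]] le])
  qed
qed

end
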